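(* Let $\alpha\in(0,1)$. Then $\mathcal X$ localizes, i.e., for almost every realization of $\tau$, $\sup_{i\in\mathbb Z}P(\mathcal X_t=i\mid\tau)$ does not converge to $0$ as $t\to\infty$.
   Context: Let $\beta\in(1,2]$. Let $(\varepsilon_j)_{j\ge1}$ be i.i.d. integer-valued with $E\varepsilon_1=0$, $E(e^{it\varepsilon_1})=1$ iff $t\in2\pi\mathbb Z$, $P(\varepsilon_1<-x)\sim x^{-\beta}(c^-+o(1))h(x)$, $P(\varepsilon_1>x)\sim x^{-\beta}(c^++o(1))h(x)$, $c^\pm>0$, $h$ slowly varying; $X_0=0$, $X_n=\sum_{j\le n}\varepsilon_j$. Let $\tau=(\tau_i)_{i\in\mathbb Z}$ be i.i.d. positive random variables independent of $X$ with $P(\tau_0>x)\sim x^{-\alpha}(\kappa^++o(1))s(x)$, $\kappa^+>0$, $s$ positive slowly varying. The trap model $\mathcal X$ is the continuous-time random walk on $\mathbb Z$ with $\mathcal X_0=0$, embedded chain $X$, and jump rate $\tau_i^{-1}$ at site $i$ (holding times exponential with mean $\tau_i$, conditionally independent given $X,\tau$). *)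

theory Defs
  imports "HOL-Probability.Probability"
begin

definition slowly_varying :: "(real \<Rightarrow> real) \<Rightarrow> bool" where
  "slowly_varying h \<longleftrightarrow> h \<in> borel_measurable borel \<and> (\<forall>x>0. h x > 0) \<and>
     (\<forall>l>0. ((\<lambda>x. h (l * x) / h x) \<longlongrightarrow> 1) at_top)"

text \<open>A sample point omega : nat => int * real encodes the increments
  eps_(j+1) = fst (omega j) of the embedded walk and i.i.d. Exp(1) variables
  e_j = snd (omega j); the holding time at the j-th visited site X_j is tau(X_j) * e_j.\<close>
definition walk :: "(nat \<Rightarrow> int \<times> real) \<Rightarrow> nat \<Rightarrow> int" where
  "walk \<omega> n = (\<Sum>j<n. fst (\<omega> j))"

definition jump_time :: "(int \<Rightarrow> real) \<Rightarrow> (nat \<Rightarrow> int \<times> real) \<Rightarrow> nat \<Rightarrow> real" where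
  "jump_time \<tau> \<omega> n = (\<Sum>k<n. \<tau> (walk \<omega> k) * snd (\<omega> k))"

definition trap_pos :: "(int \<Rightarrow> real) \<Rightarrow> (nat \<Rightarrow> int \<times> real) \<Rightarrow> real \<Rightarrow> int" where
  "trap_pos \<tau> \<omega> t = walk \<omega> (LEAST n. t < jump_time \<tau> \<omega> (Suc n))"

definition step_measure :: "int pmf \<Rightarrow> (int \<times> real) measure" where
  "step_measure p = measure_pmf p \<Otimes>\<^sub>M density lborel (exponential_density 1)"

definition path_law :: "int pmf \<Rightarrow> (nat \<Rightarrow> int \<times> real) measure" where
  "path_law p = PiM UNIV (\<lambda>_::nat. step_measure p)"

definition env_law :: "real measure \<Rightarrow> (int \<Rightarrow> real) measure" where
  "env_law \<nu> = PiM UNIV (\<lambda>_::int. \<nu>)"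

definition quenched_prob :: "int pmf \<Rightarrow> (int \<Rightarrow> real) \<Rightarrow> real \<Rightarrow> int \<Rightarrow> real" where
  "quenched_prob p \<tau> t i = measure (path_law p) {\<omega>. trap_pos \<tau> \<omega> t = i}"

end

theory Submission
  imports Defs
begin

text \<open>
  If the supremum tended to 0, so would the time averages of the occupation probabilities, hence it
  suffices to find, for arbitrarily large times $t$, a site at which the process spends in
  expectation a fixed fraction of $[0,t]$. Let $V(x)$ be the variance of a step truncated at $x$.
  In $n \approx L^2/V(L)$ steps the walk stays within distance $RL$ up to a small probability, while
  a Fourier estimate bounds the expected number of visits to any site by $g \approx n/L$. The $n$
  visits are therefore spread over a positive fraction of the sites within distance of order $L$,
  each of which receives at least $cg$ expected visits, and the clock after $n$ steps is at most of
  order $g \sum_{|j|<RL} \tau_j$. As $\alpha<1$, with a probability bounded away from 0 one of these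
  favourite sites carries a fixed fraction of $\sum_{|j|<RL} \tau_j$. Applied to disjoint annuli at
  rapidly growing scales, the Borel--Cantelli lemmas make this happen infinitely often almost surely.
  All scales are dyadic: $L = 2^k$.
\<close>

section \<open>Regularly varying tails and truncated moments\<close>

text \<open>The obstacle is a lower bound on the visits to a deep trap. No local limit theorem is
  used: the Fourier estimate bounds visits from above at every site, and a pigeonhole argument turns
  it into a lower bound on a set \<open>S k\<close> of at least \<open>c' * 2 ^ k\<close> sites.
  This set depends on the step law alone, so the environment can be asked for a deep trap inside it
  without conditioning. The same upper bound controls the second moment of the occupation time, so
  the visits cannot all sit on the few paths whose clock runs late. Regular variation enters only
  through ratios over one doubling. \<beta> > 1 lets the truncated variance grow by a factor
  \<open>q < 2\<close>, so that the visit count \<open>g k\<close> diverges; \<alpha> < 1 keeps the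
  ratio of trap tails above 1/2, so that truncated trap sums are governed by their top level.
  Averaging over time avoids any regularity of the quenched probabilities in \<open>t\<close>.
  Events on disjoint annuli are independent; the ball inside an annulus is made harmless by choosing
  each scale only after a tightness threshold for the previous ball.\<close>

lemma regularly_varying_doubling:
  fixes f s :: "real \<Rightarrow> real"
  assumes s: "slowly_varying s" and lim: "((\<lambda>x. f x / (x powr (- a) * s x)) \<longlongrightarrow> \<kappa>) at_top"
    and \<kappa>: "\<kappa> > 0"
  shows "((\<lambda>x. f (2 * x) / f x) \<longlongrightarrow> 2 powr (- a)) at_top"
    and "eventually (\<lambda>x. f x > 0) at_top"
proof -
  define g where "g x = f x / (x powr (- a) * s x)" for x
  have g: "(g \<longlongrightarrow> \<kappa>) at_top" using lim by (simp add: g_def[abs_def])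
  have g2: "((\<lambda>x. g (2 * x)) \<longlongrightarrow> \<kappa>) at_top"
    by (rule filterlim_compose[OF g]) (rule filterlim_tendsto_pos_mult_at_top[OF tendsto_const _ filterlim_ident], simp)
  have s2: "((\<lambda>x. s (2 * x) / s x) \<longlongrightarrow> 1) at_top" using s by (auto simp: slowly_varying_def)
  have spos: "s x > 0" if "x > 0" for x using s that by (auto simp: slowly_varying_def)
  have "((\<lambda>x. g (2 * x) / g x * 2 powr (- a) * (s (2 * x) / s x)) \<longlongrightarrow> \<kappa> / \<kappa> * 2 powr (- a) * 1) at_top"
    using \<kappa> by (intro tendsto_intros g g2 s2) auto
  then have L: "((\<lambda>x. g (2 * x) / g x * 2 powr (- a) * (s (2 * x) / s x)) \<longlongrightarrow> 2 powr (- a)) at_top"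
    using \<kappa> by simp
  show "((\<lambda>x. f (2 * x) / f x) \<longlongrightarrow> 2 powr (- a)) at_top"
  proof (rule Lim_transform_eventually[OF L])
    show "\<forall>\<^sub>F x in at_top. g (2 * x) / g x * 2 powr (- a) * (s (2 * x) / s x) = f (2 * x) / f x"
      using eventually_gt_at_top[of 0]
    proof eventually_elim
      case (elim x)
      have "s x > 0" "s (2*x) > 0" using spos elim by auto
      moreover have "x powr (-a) > 0" "2 powr (-a) > (0::real)" using elim by auto
      moreover have "(2 * x) powr (-a) = 2 powr (-a) * x powr (-a)" using elim by (simp add: powr_mult)
      ultimately show ?case by (simp add: g_def field_simps)
    qed
  qed
  show "eventually (\<lambda>x. f x > 0) at_top"
    using order_tendstoD(1)[OF g \<kappa>] eventually_gt_at_top[of 0]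
  proof eventually_elim
    case (elim x)
    have "x powr (-a) * s x > 0" using elim spos by simp
    then show ?case using elim by (simp add: g_def zero_less_divide_iff)
  qed
qed

text \<open>A strict margin on both sides of the limit ratio gives inequalities for a single
  doubling, which iterate to geometric bounds. This is the only form in which the tails of the steps
  and of the traps are used later.\<close>

lemma dyadic_doubling:
  fixes f s :: "real \<Rightarrow> real"
  assumes s: "slowly_varying s" and lim: "((\<lambda>x. f x / (x powr (- a) * s x)) \<longlongrightarrow> \<kappa>) at_top" and \<kappa>: "\<kappa> > 0"
    and b: "l < 2 powr (- a)" "2 powr (- a) < h"
  shows "\<exists>m. \<forall>k\<ge>m. 0 < f (2 ^ k) \<and> l * f (2 ^ k) \<le> f (2 ^ Suc k) \<and> f (2 ^ Suc k) \<le> h * f (2 ^ k)"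
proof -
  have pow: "filterlim (\<lambda>k. (2::real) ^ k) at_top sequentially"
    by (intro filterlim_at_infinity_imp_filterlim_at_top filterlim_realpow_sequentially_gt1) (auto intro!: always_eventually)
  have ev: "eventually (\<lambda>x. 0 < f x \<and> l < f (2 * x) / f x \<and> f (2 * x) / f x < h) at_top"
    using regularly_varying_doubling(2)[OF s lim \<kappa>] order_tendstoD(1)[OF regularly_varying_doubling(1)[OF s lim \<kappa>] b(1)]
      order_tendstoD(2)[OF regularly_varying_doubling(1)[OF s lim \<kappa>] b(2)]
    by eventually_elim auto
  from eventually_compose_filterlim[OF this pow]
  have "eventually (\<lambda>k. 0 < f (2 ^ k) \<and> l * f (2 ^ k) \<le> f (2 ^ Suc k) \<and> f (2 ^ Suc k) \<le> h * f (2 ^ k)) sequentially"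
    by eventually_elim (auto simp: field_simps)
  then show ?thesis by (simp add: eventually_sequentially)
qed

lemma two_sided_tail:
  fixes p :: "int pmf"
  assumes left: "((\<lambda>x. measure_pmf.prob p {k. real_of_int k < - x} / (x powr (- \<beta>) * h x)) \<longlongrightarrow> c1) at_top"
    and right: "((\<lambda>x. measure_pmf.prob p {k. real_of_int k > x} / (x powr (- \<beta>) * h x)) \<longlongrightarrow> c2) at_top"
  shows "((\<lambda>x. measure_pmf.prob p {k. x < \<bar>real_of_int k\<bar>} / (x powr (- \<beta>) * h x)) \<longlongrightarrow> c1 + c2) at_top"
proof (rule Lim_transform_eventually[OF tendsto_add[OF left right]])
  show "\<forall>\<^sub>F x in at_top. measure_pmf.prob p {k. real_of_int k < - x} / (x powr (- \<beta>) * h x)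
      + measure_pmf.prob p {k. real_of_int k > x} / (x powr (- \<beta>) * h x)
    = measure_pmf.prob p {k. x < \<bar>real_of_int k\<bar>} / (x powr (- \<beta>) * h x)"
    using eventually_gt_at_top[of 0]
  proof eventually_elim
    case (elim x)
    have "{k. x < \<bar>real_of_int k\<bar>} = {k. real_of_int k < - x} \<union> {k. real_of_int k > x}" by auto
    moreover have "measure_pmf.prob p ({k. real_of_int k < - x} \<union> {k. real_of_int k > x})
      = measure_pmf.prob p {k. real_of_int k < - x} + measure_pmf.prob p {k. real_of_int k > x}"
      using elim by (intro measure_pmf.finite_measure_Union) auto
    ultimately show ?case by (simp add: add_divide_distrib)
  qed
qed

text \<open>The induction closes because \<open>a k / (r - 1) + a k = r * a k / (r - 1)\<close>. It
  is applied with \<open>r = 2 / q\<close> to the visit scale \<open>2 ^ k / W k\<close> and with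
  \<open>r = 2 * \<rho>'\<close> to the truncated mean of a trap.\<close>

lemma geometric_sum_le_last:
  fixes a :: "nat \<Rightarrow> real"
  assumes r: "1 < r" and a: "\<And>j. m \<le> j \<Longrightarrow> r * a j \<le> a (Suc j)" and "0 \<le> a m" and "m \<le> k"
  shows "(\<Sum>j=m..<k. a j) \<le> a k / (r - 1)"
  using \<open>m \<le> k\<close>
proof (induction k rule: dec_induct)
  case base
  then show ?case using assms by simp
next
  case (step k)
  have "(\<Sum>j=m..<Suc k. a j) \<le> a k / (r - 1) + a k" using step by simp
  also have "\<dots> = r * a k / (r - 1)" using r by (simp add: field_simps)
  also have "\<dots> \<le> a (Suc k) / (r - 1)" using a[of k] step r by (intro divide_right_mono) auto
  finally show ?case .
qed

section \<open>Truncated moments of one step at dyadic levels\<close>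

definition big_jump_prob :: "int pmf \<Rightarrow> nat \<Rightarrow> real" where
  "big_jump_prob p k = measure_pmf.prob p {j. 2 ^ k < \<bar>j\<bar>}"

lemma integrable_truncated:
  fixes f :: "int \<Rightarrow> real"
  assumes "\<And>j. \<bar>f j\<bar> \<le> B"
  shows "integrable (measure_pmf p) f"
  by (rule measure_pmf.integrable_const_bound[where B=B]) (use assms in auto)

lemma expectation_indicator_pmf: "measure_pmf.expectation p (\<lambda>j. if P j then c else 0) = c * measure_pmf.prob p {j. P j}"
  for c :: real
proof -
  have "measure_pmf.expectation p (\<lambda>j. if P j then c else 0) = measure_pmf.expectation p (\<lambda>j. c * indicator {j. P j} j)"
    by (intro Bochner_Integration.integral_cong) (auto simp: indicator_def)
  then show ?thesis by simp
qed

lemma int_sq_le: "\<bar>j\<bar> \<le> 2 ^ k \<Longrightarrow> (real_of_int j)\<^sup>2 \<le> 4 ^ k"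
proof -
  assume "\<bar>j\<bar> \<le> 2 ^ k"
  then have "real_of_int \<bar>j\<bar> \<le> real_of_int (2^k)" by (simp only: of_int_le_iff)
  then have "\<bar>real_of_int j\<bar> \<le> 2^k" by simp
  then have "\<bar>real_of_int j\<bar>\<^sup>2 \<le> (2^k)\<^sup>2" by (intro power_mono) auto
  also have "(2^k)\<^sup>2 = (4::real)^k" by (simp add: power2_eq_square flip: power_mult_distrib)
  finally show ?thesis by simp
qed

lemma int_sq_ge: "2 ^ k \<le> \<bar>j\<bar> \<Longrightarrow> (real_of_int j)\<^sup>2 \<ge> 4 ^ k"
proof -
  assume "2 ^ k \<le> \<bar>j\<bar>"
  then have "real_of_int (2^k) \<le> real_of_int \<bar>j\<bar>" by (simp only: of_int_le_iff)
  then have "2^k \<le> \<bar>real_of_int j\<bar>" by simp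
  then have "(2^k)\<^sup>2 \<le> \<bar>real_of_int j\<bar>\<^sup>2" by (intro power_mono) auto
  moreover have "(2^k)\<^sup>2 = (4::real)^k" by (simp add: power2_eq_square flip: power_mult_distrib)
  ultimately show ?thesis by simp
qed

lemma card_int_ball: "finite {j::int. \<bar>j\<bar> < 2 ^ k}" "real (card {j::int. \<bar>j\<bar> < 2 ^ k}) \<le> 2 * 2 ^ k"
proof -
  have A: "{j::int. \<bar>j\<bar> < 2 ^ k} = {- (2 ^ k) + 1 .. 2 ^ k - 1}" by auto
  show "finite {j::int. \<bar>j\<bar> < 2 ^ k}" unfolding A by simp
  have "real (card {j::int. \<bar>j\<bar> < 2 ^ k}) = real_of_int (2 * 2 ^ k - 1)" unfolding A by simp
  then show "real (card {j::int. \<bar>j\<bar> < 2 ^ k}) \<le> 2 * 2 ^ k" by simp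
qed

text \<open>The shell \<open>2 ^ k < \<bar>j\<bar> \<le> 2 ^ Suc k\<close> has squares of size at
  least \<open>4 ^ k\<close>, and its mass is a difference of two tails. Discarding large jumps is
  the right truncation for lower bounds; the Fourier estimate uses this one.\<close>

lemma truncated_variance_step:
  "measure_pmf.expectation p (\<lambda>j. if \<bar>j\<bar> \<le> 2 ^ Suc k then (real_of_int j)\<^sup>2 else 0)
   \<ge> measure_pmf.expectation p (\<lambda>j. if \<bar>j\<bar> \<le> 2 ^ k then (real_of_int j)\<^sup>2 else 0)
     + 4 ^ k * (big_jump_prob p k - big_jump_prob p (Suc k))" (is "?U (Suc k) \<ge> ?U k + _")
proof -
  have int: "integrable p (\<lambda>j. if \<bar>j\<bar> \<le> 2 ^ m then (real_of_int j)\<^sup>2 else 0)" for m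
    by (rule integrable_truncated[where B="4^m"]) (use int_sq_le in auto)
  have i2: "integrable p (\<lambda>j. if P j then (c::real) else 0)" for P c
    by (rule integrable_truncated[where B="\<bar>c\<bar>"]) auto
  have "?U k + 4 ^ k * (big_jump_prob p k - big_jump_prob p (Suc k)) =
    measure_pmf.expectation p (\<lambda>j. (if \<bar>j\<bar> \<le> 2 ^ k then (real_of_int j)\<^sup>2 else 0)
      + ((if 2^k < \<bar>j\<bar> then 4^k else 0) - (if 2^Suc k < \<bar>j\<bar> then 4^k else 0)))"
    by (subst Bochner_Integration.integral_add Bochner_Integration.integral_diff, 
      (intro int i2 Bochner_Integration.integrable_diff)+)+
      (simp add: expectation_indicator_pmf big_jump_prob_def algebra_simps)
  also have "\<dots> \<le> ?U (Suc k)"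
  proof (rule integral_mono)
    show "integrable p (\<lambda>j. (if \<bar>j\<bar> \<le> 2 ^ k then (real_of_int j)\<^sup>2 else 0)
      + ((if 2^k < \<bar>j\<bar> then 4^k else 0) - (if 2^Suc k < \<bar>j\<bar> then 4^k else 0)))"
      by (intro int i2 Bochner_Integration.integrable_diff Bochner_Integration.integrable_add)
  qed (use int_sq_ge[of k] int[of "Suc k"] in auto)
  finally show ?thesis .
qed

text \<open>Raising the cap from \<open>4 ^ k\<close> to \<open>4 ^ Suc k\<close> adds at most
  \<open>3 * 4 ^ k\<close>, and nothing where \<open>\<bar>j\<bar> \<le> 2 ^ k\<close>. Clipping
  instead of discarding keeps the contribution of large jumps, as an upper bound on displacement
  requires.\<close>

lemma clipped_variance_step:
  "measure_pmf.expectation p (\<lambda>j. min ((real_of_int j)\<^sup>2) (4 ^ Suc k))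
   \<le> measure_pmf.expectation p (\<lambda>j. min ((real_of_int j)\<^sup>2) (4 ^ k)) + 3 * 4 ^ k * big_jump_prob p k"
proof -
  have int: "integrable p (\<lambda>j. min ((real_of_int j)\<^sup>2) (4 ^ m))" for m
    by (rule integrable_truncated[where B="4^m"]) auto
  have i2: "integrable p (\<lambda>j. if P j then (c::real) else 0)" for P c
    by (rule integrable_truncated[where B="\<bar>c\<bar>"]) auto
  have "measure_pmf.expectation p (\<lambda>j. min ((real_of_int j)\<^sup>2) (4 ^ Suc k))
    \<le> measure_pmf.expectation p (\<lambda>j. min ((real_of_int j)\<^sup>2) (4 ^ k) + (if 2^k < \<bar>j\<bar> then 3*4^k else 0))"
  proof (rule integral_mono)
    fix j
    show "min ((real_of_int j)\<^sup>2) (4 ^ Suc k) \<le> min ((real_of_int j)\<^sup>2) (4 ^ k) + (if 2^k < \<bar>j\<bar> then 3*4^k else 0)"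
      using int_sq_le[of j k] int_sq_ge[of k j] by (auto simp: min_def)
  qed (intro int i2 Bochner_Integration.integrable_add)+
  also have "\<dots> = measure_pmf.expectation p (\<lambda>j. min ((real_of_int j)\<^sup>2) (4 ^ k)) + 3 * 4 ^ k * big_jump_prob p k"
    by (subst Bochner_Integration.integral_add) (auto simp: int i2 expectation_indicator_pmf big_jump_prob_def)
  finally show ?thesis .
qed

text \<open>The tail mean is cut into dyadic shells, on which
  \<open>\<bar>j\<bar> \<le> 2 ^ Suc m\<close>; the geometric decay of \<open>d\<close> then sums
  the shells.\<close>

lemma tail_first_moment_bound:
  assumes int: "integrable (measure_pmf p) real_of_int"
    and d: "\<And>j. k \<le> j \<Longrightarrow> 2 ^ Suc j * big_jump_prob p j \<le> d j"
    and geo: "\<And>j. k \<le> j \<Longrightarrow> d (Suc j) \<le> r * d j" and r: "0 < r" "r < 1"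
  shows "measure_pmf.expectation p (\<lambda>j. if 2 ^ k < \<bar>j\<bar> then \<bar>real_of_int j\<bar> else 0) \<le> d k / (1 - r)"
proof -
  define e where "e m = measure_pmf.expectation p (\<lambda>j. if 2 ^ m < \<bar>j\<bar> then \<bar>real_of_int j\<bar> else 0)" for m
  have iabs: "integrable p (\<lambda>j. \<bar>real_of_int j\<bar>)" using int by (rule integrable_abs)
  have im: "integrable p (\<lambda>j. if P j then \<bar>real_of_int j\<bar> else 0)" for P
    by (rule Bochner_Integration.integrable_bound[OF iabs]) auto
  have i2: "integrable p (\<lambda>j. if P j then (c::real) else 0)" for P c
    by (rule integrable_truncated[where B="\<bar>c\<bar>"]) auto
  have step: "e m \<le> e (Suc m) + 2 ^ Suc m * big_jump_prob p m" for m
  proof -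
    have "e m \<le> measure_pmf.expectation p (\<lambda>j. (if 2 ^ Suc m < \<bar>j\<bar> then \<bar>real_of_int j\<bar> else 0) + (if 2^m < \<bar>j\<bar> then 2^Suc m else 0))"
      unfolding e_def
    proof (rule integral_mono)
      fix j :: int
      show "(if 2 ^ m < \<bar>j\<bar> then \<bar>real_of_int j\<bar> else 0) \<le> (if 2 ^ Suc m < \<bar>j\<bar> then \<bar>real_of_int j\<bar> else 0) + (if 2^m < \<bar>j\<bar> then 2^Suc m else 0)"
      proof (cases "2 ^ Suc m < \<bar>j\<bar>")
        case False
        then have "real_of_int \<bar>j\<bar> \<le> real_of_int (2^Suc m)" by (simp only: of_int_le_iff)
        then show ?thesis by auto
      qed auto
    qed (intro im i2 Bochner_Integration.integrable_add)+
    also have "\<dots> = e (Suc m) + 2 ^ Suc m * big_jump_prob p m"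
      unfolding e_def by (subst Bochner_Integration.integral_add) (auto simp only: im i2 expectation_indicator_pmf big_jump_prob_def)
    finally show ?thesis .
  qed
  have dpos: "0 \<le> d j" if "k \<le> j" for j
  proof -
    have "0 \<le> 2 ^ Suc j * big_jump_prob p j" by (auto simp: big_jump_prob_def)
    then show ?thesis using d[OF that] by linarith
  qed
  \<comment> \<open>Each \<open>d m\<close> is charged to the drop \<open>d m - d (Suc m)\<close>,
    so the sum telescopes and no infinite series is needed.\<close>
  have bound: "e k \<le> e m + (d k - d m) / (1 - r)" if "k \<le> m" for m
    using that
  proof (induction m rule: dec_induct)
    case base
    then show ?case by simp
  next
    case (step m)
    have "e m \<le> e (Suc m) + d m" using \<open>\<And>m. e m \<le> e (Suc m) + _\<close>[of m] d[of m] step by auto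
    moreover have "(1 - r) * d m \<le> d m - d (Suc m)" using geo[of m] step by (simp add: algebra_simps)
    then have "d m \<le> (d m - d (Suc m)) / (1 - r)" using r by (simp add: field_simps)
    moreover have "(d k - d m) / (1 - r) + (d m - d (Suc m)) / (1 - r) = (d k - d (Suc m)) / (1 - r)"
      by (simp add: add_divide_distrib[symmetric])
    ultimately show ?case using step.IH by linarith
  qed
  \<comment> \<open>The remainder beyond level \<open>m\<close> vanishes by dominated convergence,
    with the integrable majorant \<open>\<bar>j\<bar>\<close>.\<close>
  have lim: "e \<longlonglongrightarrow> measure_pmf.expectation p (\<lambda>j. 0)"
    unfolding e_def
  proof (rule integral_dominated_convergence[OF _ _ iabs])
    show "AE j in p. (\<lambda>m. if 2 ^ m < \<bar>j\<bar> then \<bar>real_of_int j\<bar> else 0) \<longlonglongrightarrow> 0"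
    proof (rule AE_I2)
      fix j :: int
      have "eventually (\<lambda>m. \<not> 2 ^ m < \<bar>j\<bar>) sequentially"
        unfolding eventually_sequentially
      proof (intro exI[of _ "nat \<bar>j\<bar>"] allI impI)
        fix n assume "nat \<bar>j\<bar> \<le> n"
        then have "\<bar>j\<bar> \<le> int n" by linarith
        moreover have "int n < 2 ^ n" by (simp add: of_nat_less_two_power)
        ultimately show "\<not> 2 ^ n < \<bar>j\<bar>" by linarith
      qed
      then show "(\<lambda>m. if 2 ^ m < \<bar>j\<bar> then \<bar>real_of_int j\<bar> else 0) \<longlonglongrightarrow> 0"
        by (intro tendsto_eventually) (simp add: eventually_mono)
    qed
  qed auto
  have "e k - d k / (1 - r) \<le> 0"
  proof (rule tendsto_lowerbound[OF lim[simplified]])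
    show "\<forall>\<^sub>F m in sequentially. e k - d k / (1 - r) \<le> e m"
      using eventually_ge_at_top[of k]
    proof eventually_elim
      case (elim m)
      have "(d k - d m) / (1 - r) \<le> d k / (1 - r)" using dpos[of m] elim r by (intro divide_right_mono) auto
      then show ?case using bound[OF elim] by linarith
    qed
  qed simp
  then show ?thesis by (simp add: e_def)
qed

text \<open>\<open>W\<close> stands for the truncated variance up to constants. Being a sum of the
  terms \<open>4 ^ j * big_jump_prob p j\<close>, it inherits the growth factor \<open>q\<close>
  from the tails term by term. Working with the sum and not with its last term treats \<beta> = 2
  together with \<beta> < 2, since for \<beta> = 2 the last term need not be comparable to the
  variance.\<close>

lemma dyadic_variance_scale:
  assumes int: "integrable (measure_pmf p) real_of_int"
    and mean: "measure_pmf.expectation p real_of_int = 0"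
    and q: "1 < q" "q < 2" 
    and tail: "\<And>k. m \<le> k \<Longrightarrow> 0 < big_jump_prob p k \<and> 4 * big_jump_prob p (Suc k) \<le> q * big_jump_prob p k"
  obtains W :: "nat \<Rightarrow> real" and C c :: real and m' :: nat
  where "0 < C" "0 < c" 
    "\<And>k. m' \<le> k \<Longrightarrow> 0 < W k \<and> W k \<le> W (Suc k) \<and> W (Suc k) \<le> q * W k"
    "\<And>k. m' \<le> k \<Longrightarrow> measure_pmf.expectation p (\<lambda>j. min ((real_of_int j)\<^sup>2) (4 ^ k)) \<le> C * W k"
    "\<And>k. m' \<le> k \<Longrightarrow> \<bar>measure_pmf.expectation p (\<lambda>j. if \<bar>j\<bar> \<le> 2 ^ k then real_of_int j else 0)\<bar> \<le> C * W k / 2 ^ k"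
    "\<And>k. m' \<le> k \<Longrightarrow> c * W k \<le> measure_pmf.expectation p (\<lambda>j. if \<bar>j\<bar> \<le> 2 ^ k then (real_of_int j)\<^sup>2 else 0)"
proof -
  define b where "b k = 4 ^ k * big_jump_prob p k" for k
  \<comment> \<open>with this offset the ratio bound for \<open>W\<close> holds from the first index on\<close>
  define K where "K = b m / (q - 1)"
  define W where "W k = K + (\<Sum>j=m..<Suc k. b j)" for k
  have bpos: "0 < b k" if "m \<le> k" for k using tail[OF that] by (simp add: b_def)
  have bstep: "b (Suc k) \<le> q * b k" if "m \<le> k" for k
  proof -
    have "4^k * (4 * big_jump_prob p (Suc k)) \<le> 4^k * (q * big_jump_prob p k)" using tail[OF that] by (intro mult_left_mono) auto
    then show ?thesis by (simp add: b_def algebra_simps)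
  qed
  have Kpos: "0 < K" using bpos[of m] q by (simp add: K_def)
  have Wpos: "0 < W k" for k
    unfolding W_def by (rule add_pos_nonneg[OF Kpos sum_nonneg]) (auto intro: less_imp_le[OF bpos])
  have Wmono: "W k \<le> W (Suc k)" if "m \<le> k" for k
    using that bpos[of "Suc k"] by (simp add: W_def)
  have Wq: "W (Suc k) \<le> q * W k" if "m \<le> k" for k
    using that
  proof (induction k rule: dec_induct)
    case base
    have "W (Suc m) = K + b m + b (Suc m)" by (simp add: W_def)
    also have "\<dots> \<le> K + b m + q * b m" using bstep[of m] by simp
    also have "K + b m = q * K" using q by (simp add: K_def field_simps)
    finally show ?case by (simp add: W_def algebra_simps)
  next
    case (step k)
    have "W (Suc (Suc k)) = W (Suc k) + b (Suc (Suc k))" using step by (simp add: W_def)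
    also have "\<dots> \<le> q * W k + q * b (Suc k)" using step bstep[of "Suc k"] by simp
    also have "\<dots> = q * W (Suc k)" using step by (simp add: W_def algebra_simps)
    finally show ?case .
  qed
  have bW: "b k \<le> W k" if "m \<le> k" for k
  proof -
    have "b k \<le> (\<Sum>j=m..<Suc k. b j)" using that by (intro member_le_sum) (auto intro: less_imp_le[OF bpos])
    then show ?thesis using Kpos by (simp add: W_def)
  qed
  define V where "V k = measure_pmf.expectation p (\<lambda>j. min ((real_of_int j)\<^sup>2) (4 ^ k))" for k
  define U where "U k = measure_pmf.expectation p (\<lambda>j. if \<bar>j\<bar> \<le> 2 ^ k then (real_of_int j)\<^sup>2 else 0)" for k
  have VW: "V k \<le> V m + 3 * (\<Sum>j=m..<k. b j)" if "m \<le> k" for k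
    using that
  proof (induction k rule: dec_induct)
    case (step k)
    then show ?case using clipped_variance_step[of p k] by (simp add: V_def b_def)
  qed simp
  have Vpos: "V m \<ge> 0" by (auto simp: V_def intro!: integral_nonneg_AE)
  have V: "V k \<le> (V m / K + 3) * W k" if "m \<le> k" for k
  proof -
    have "V m \<le> V m / K * W k"
    proof -
      have "K \<le> W k" unfolding W_def by (simp del: sum.op_ivl_Suc) (auto intro!: sum_nonneg less_imp_le[OF bpos] simp del: sum.op_ivl_Suc)
      then have "V m / K * K \<le> V m / K * W k" using Vpos Kpos by (intro mult_left_mono) auto
      then show ?thesis using Kpos by simp
    qed
    moreover have "(\<Sum>j=m..<k. b j) \<le> W k" using Kpos bpos[of k] that by (simp add: W_def)
    ultimately show ?thesis using VW[OF that] by (simp add: algebra_simps)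
  qed
  \<comment> \<open>Since \<open>q < 2\<close>, at least half of the mass beyond
    \<open>2 ^ k\<close> lies in the next shell, so differences of tails may be replaced by half a
    tail.\<close>
  have UW: "(\<Sum>j=m..<k. b j) / 2 \<le> U k" if "m \<le> k" for k
    using that
  proof (induction k rule: dec_induct)
    case base
    show ?case by (auto simp: U_def intro!: integral_nonneg_AE)
  next
    case (step k)
    have "4 * big_jump_prob p (Suc k) \<le> 2 * big_jump_prob p k"
    proof -
      have "q * big_jump_prob p k \<le> 2 * big_jump_prob p k" using q tail[of k] step by (intro mult_right_mono) auto
      then show ?thesis using tail[of k] step by linarith
    qed
    then have "4 ^ k * (big_jump_prob p k / 2) \<le> 4 ^ k * (big_jump_prob p k - big_jump_prob p (Suc k))" by (intro mult_left_mono) auto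
    then have "b k / 2 \<le> 4 ^ k * (big_jump_prob p k - big_jump_prob p (Suc k))" by (simp add: b_def)
    moreover have "U k + 4 ^ k * (big_jump_prob p k - big_jump_prob p (Suc k)) \<le> U (Suc k)"
      using truncated_variance_step[of p k] by (simp only: U_def)
    moreover have "(\<Sum>j=m..<Suc k. b j) / 2 = (\<Sum>j=m..<k. b j) / 2 + b k / 2"
      using step by (simp add: add_divide_distrib)
    ultimately show ?case using step.IH by linarith
  qed
  \<comment> \<open>\<open>U k\<close> sees only the terms \<open>b j\<close> with
    \<open>j < k\<close>, while \<open>W k\<close> also contains \<open>b k\<close> and the offset
    \<open>K\<close>. One step of the growth bound absorbs the former, and
    \<open>b m \<le> \<Sum>\<close> absorbs the latter; this needs at least one term, hence the
    start at \<open>Suc m\<close>.\<close>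
  have U: "W k \<le> 2 * (q * (q / (q - 1))) * U k" if "Suc m \<le> k" for k
  proof -
    obtain l where l: "k = Suc l" "m \<le> l" using \<open>Suc m \<le> k\<close> by (cases k) auto
    have "b m \<le> (\<Sum>j=m..<Suc l. b j)" using l by (intro member_le_sum) (auto intro: less_imp_le[OF bpos])
    then have "W l \<le> (\<Sum>j=m..<Suc l. b j) / (q - 1) + (\<Sum>j=m..<Suc l. b j)"
      unfolding W_def K_def using q by (intro add_right_mono divide_right_mono) auto
    also have "\<dots> = q / (q - 1) * (\<Sum>j=m..<Suc l. b j)" using q by (simp add: field_simps)
    also have "\<dots> \<le> q / (q - 1) * (2 * U k)" using UW[of k] l q by (intro mult_left_mono) auto
    finally have "q * W l \<le> q * (q / (q - 1) * (2 * U k))" using q by (intro mult_left_mono) auto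
    then show ?thesis using Wq[of l] l by (simp add: algebra_simps)
  qed
  \<comment> \<open>As the mean is zero, the truncated mean is minus the tail mean, whose shells
    decay with ratio \<open>q / 2 < 1\<close>.\<close>
  have E: "\<bar>measure_pmf.expectation p (\<lambda>j. if \<bar>j\<bar> \<le> 2 ^ k then real_of_int j else 0)\<bar> \<le> 2 / (1 - q/2) * W k / 2 ^ k"
    if k: "m \<le> k" for k
  proof -
    have im: "integrable p (\<lambda>j. if P j then real_of_int j else 0)" for P
      by (rule Bochner_Integration.integrable_bound[OF int]) auto
    have "0 = measure_pmf.expectation p real_of_int" using mean by simp
    also have "\<dots> = measure_pmf.expectation p (\<lambda>j. (if \<bar>j\<bar> \<le> 2 ^ k then real_of_int j else 0) + (if 2^k < \<bar>j\<bar> then real_of_int j else 0))"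
      by (intro Bochner_Integration.integral_cong) auto
    also have "\<dots> = measure_pmf.expectation p (\<lambda>j. if \<bar>j\<bar> \<le> 2 ^ k then real_of_int j else 0) + measure_pmf.expectation p (\<lambda>j. if 2^k < \<bar>j\<bar> then real_of_int j else 0)"
      by (intro Bochner_Integration.integral_add im)
    finally have "\<bar>measure_pmf.expectation p (\<lambda>j. if \<bar>j\<bar> \<le> 2 ^ k then real_of_int j else 0)\<bar> = \<bar>measure_pmf.expectation p (\<lambda>j. if 2^k < \<bar>j\<bar> then real_of_int j else 0)\<bar>"
      by linarith
    also have "\<dots> \<le> measure_pmf.expectation p (\<lambda>j. \<bar>if 2^k < \<bar>j\<bar> then real_of_int j else 0\<bar>)"
      by (rule integral_abs_bound)
    also have "(\<lambda>j. \<bar>if 2^k < \<bar>j\<bar> then real_of_int j else 0\<bar>) = (\<lambda>j. if 2^k < \<bar>j\<bar> then \<bar>real_of_int j\<bar> else 0)" by auto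
    also have "measure_pmf.expectation p \<dots> \<le> (2 * W k / 2 ^ k) / (1 - q/2)"
    proof (rule tail_first_moment_bound[OF int])
      fix j assume "k \<le> j"
      then have "m \<le> j" using k by simp
      show "2 ^ Suc j * big_jump_prob p j \<le> 2 * W j / 2 ^ j"
      proof -
        have "2 ^ Suc j * big_jump_prob p j * 2 ^ j = 2 * b j"
        proof -
          have "(2::real) ^ j * 2 ^ j = 4 ^ j" by (simp flip: power_mult_distrib)
          moreover have "2 ^ Suc j * big_jump_prob p j * 2 ^ j = 2 * ((2 ^ j * 2 ^ j) * big_jump_prob p j)" by (simp only: power_Suc ac_simps)
          ultimately show ?thesis by (simp add: b_def)
        qed
        then show ?thesis using bW[OF \<open>m \<le> j\<close>] by (simp add: field_simps)
      qed
      show "2 * W (Suc j) / 2 ^ Suc j \<le> q/2 * (2 * W j / 2 ^ j)"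
        using Wq[OF \<open>m \<le> j\<close>] by (simp add: field_simps)
    qed (use q in auto)
    finally show ?thesis by (simp add: mult.commute)
  qed
  define C where "C = max (V m / K + 3) (2 / (1 - q/2))"
  show ?thesis
  proof (rule that[of C "1 / (2 * (q * (q / (q - 1))))" "Suc m" W])
    show "0 < C" using Vpos Kpos by (auto simp: C_def less_max_iff_disj intro!: add_nonneg_pos)
    show "0 < 1 / (2 * (q * (q / (q - 1))))" using q by auto
    fix k assume k: "Suc m \<le> k"
    show "0 < W k \<and> W k \<le> W (Suc k) \<and> W (Suc k) \<le> q * W k" using Wpos Wmono Wq k by auto
    have "(V m / K + 3) * W k \<le> C * W k" using Wpos[of k] by (intro mult_right_mono) (auto simp: C_def)
    then show "measure_pmf.expectation p (\<lambda>j. min ((real_of_int j)\<^sup>2) (4 ^ k)) \<le> C * W k"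
      using V[of k] k by (auto simp: V_def)
    have "2 / (1 - q/2) * W k / 2 ^ k \<le> C * W k / 2 ^ k" using Wpos[of k] 
      by (intro divide_right_mono mult_right_mono) (auto simp: C_def)
    then show "\<bar>measure_pmf.expectation p (\<lambda>j. if \<bar>j\<bar> \<le> 2 ^ k then real_of_int j else 0)\<bar> \<le> C * W k / 2 ^ k"
      using E[of k] k by linarith
    show "1 / (2 * (q * (q / (q - 1)))) * W k \<le> measure_pmf.expectation p (\<lambda>j. if \<bar>j\<bar> \<le> 2 ^ k then (real_of_int j)\<^sup>2 else 0)"
      using U[OF k] q by (simp add: U_def field_simps)
  qed
qed

section \<open>The path law\<close>

definition exp_measure :: "real measure" where
  "exp_measure = density lborel (exponential_density 1)"

lemma prob_space_exp_measure: "prob_space exp_measure"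
  unfolding exp_measure_def by (rule prob_space_exponential_density) simp

lemma sets_exp_measure [measurable_cong, simp]: "sets exp_measure = sets borel"
  by (simp add: exp_measure_def)

lemma space_exp_measure [simp]: "space exp_measure = UNIV"
  by (simp add: exp_measure_def)

lemma nn_integral_exp_measure_power: "(\<integral>\<^sup>+e. ennreal e ^ i \<partial>exp_measure) = ennreal (fact i)"
proof -
  have "(\<integral>\<^sup>+e. ennreal e ^ i \<partial>exp_measure) = (\<integral>\<^sup>+e. ennreal (exponential_density 1 e * e ^ i) \<partial>lborel)"
    unfolding exp_measure_def
    by (subst nn_integral_density) 
      (auto intro!: nn_integral_cong simp: exponential_density_def ennreal_mult ennreal_power)
  also have "\<dots> = ennreal (fact i)"
    using nn_integral_erlang_ith_moment[of 1 0 i] by simp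
  finally show ?thesis .
qed

lemma AE_exp_measure_nonneg: "AE e in exp_measure. 0 \<le> e"
  unfolding exp_measure_def by (subst AE_density) (auto simp: exponential_density_def)

lemma step_measure_eq: "step_measure p = measure_pmf p \<Otimes>\<^sub>M exp_measure"
  by (simp add: step_measure_def exp_measure_def)

lemma prob_space_step_measure: "prob_space (step_measure p)"
  unfolding step_measure_eq by (intro prob_space_pair prob_space_exp_measure prob_space_measure_pmf)

lemma space_step_measure [simp]: "space (step_measure p) = UNIV"
  by (simp add: step_measure_eq space_pair_measure)

lemma sets_step_measure [measurable_cong]: "sets (step_measure p) = sets (count_space UNIV \<Otimes>\<^sub>M borel)"
  unfolding step_measure_eq by (intro sets_pair_measure_cong) simp_all

lemma nn_integral_step_measure:
  assumes "f \<in> borel_measurable (step_measure p)"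
  shows "(\<integral>\<^sup>+s. f s \<partial>step_measure p) = (\<integral>\<^sup>+j. (\<integral>\<^sup>+e. f (j, e) \<partial>exp_measure) \<partial>measure_pmf p)"
proof -
  interpret prob_space exp_measure by (rule prob_space_exp_measure)
  show ?thesis using assms unfolding step_measure_eq by (simp add: nn_integral_fst)
qed

lemma sequence_space_step_measure: "sequence_space (step_measure p)"
proof -
  interpret prob_space "step_measure p" by (rule prob_space_step_measure)
  show ?thesis by unfold_locales
qed

lemma prob_space_path_law: "prob_space (path_law p)"
  unfolding path_law_def by (intro prob_space_PiM prob_space_step_measure)

lemma space_path_law [simp]: "space (path_law p) = UNIV"
  by (auto simp: path_law_def space_PiM)

lemma measurable_path_component [measurable]: "(\<lambda>\<omega>. \<omega> k) \<in> path_law p \<rightarrow>\<^sub>M step_measure p"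
  unfolding path_law_def by (rule measurable_component_singleton) simp

lemma measurable_increment [measurable]: "(\<lambda>\<omega>. fst (\<omega> k)) \<in> path_law p \<rightarrow>\<^sub>M count_space UNIV"
proof -
  have "fst \<in> step_measure p \<rightarrow>\<^sub>M count_space UNIV" by measurable
  from measurable_compose[OF measurable_path_component this] show ?thesis .
qed

lemma measurable_clock [measurable]: "(\<lambda>\<omega>. snd (\<omega> k)) \<in> borel_measurable (path_law p)"
proof -
  have "snd \<in> step_measure p \<rightarrow>\<^sub>M borel" by measurable
  from measurable_compose[OF measurable_path_component this] show ?thesis .
qed

lemma walk_Suc: "walk \<omega> (Suc n) = walk \<omega> n + fst (\<omega> n)"
  by (simp add: walk_def)

lemma walk_0 [simp]: "walk \<omega> 0 = 0"
  by (simp add: walk_def)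

lemma measurable_walk [measurable]: "(\<lambda>\<omega>. walk \<omega> n) \<in> path_law p \<rightarrow>\<^sub>M count_space UNIV"
proof (induction n)
  case (Suc n)
  have "(\<lambda>\<omega>. (\<lambda>i \<omega>. i + fst (\<omega> n)) (walk \<omega> n) \<omega>) \<in> path_law p \<rightarrow>\<^sub>M count_space UNIV"
  proof (rule measurable_compose_countable[OF _ Suc])
    fix i :: int
    show "(\<lambda>\<omega>. i + fst (\<omega> n)) \<in> path_law p \<rightarrow>\<^sub>M count_space UNIV"
      by (rule measurable_compose[OF measurable_increment]) simp
  qed
  then show ?case by (simp add: walk_Suc)
qed simp

lemma walk_case_nat: "walk (case_nat s \<omega>) (Suc n) = fst s + walk \<omega> n"
  by (simp add: walk_def sum.lessThan_Suc_shift del: sum.lessThan_Suc)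

lemma walk_comb_seq: "walk (comb_seq k \<omega> \<omega>') k = walk \<omega> k"
  "walk (comb_seq k \<omega> \<omega>') (k + m) = walk \<omega> k + walk \<omega>' m"
proof -
  show *: "walk (comb_seq k \<omega> \<omega>') k = walk \<omega> k" by (auto simp: walk_def comb_seq_def)
  show "walk (comb_seq k \<omega> \<omega>') (k + m) = walk \<omega> k + walk \<omega>' m"
    by (induction m) (simp_all add: * walk_Suc, simp add: comb_seq_def)
qed

lemma comb_seq_apply: "comb_seq k \<omega> \<omega>' (k + m) = \<omega>' m" "j < k \<Longrightarrow> comb_seq k \<omega> \<omega>' j = \<omega> j"
  by (auto simp: comb_seq_def)

lemma comb_seq_self: "comb_seq k \<omega> \<omega>' k = \<omega>' 0"
  by (simp add: comb_seq_def)

lemma measurable_fst_step: "fst \<in> step_measure p \<rightarrow>\<^sub>M count_space UNIV"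
  by measurable

lemma measurable_snd_step: "snd \<in> borel_measurable (step_measure p)"
  by measurable

text \<open>This lemma and \<open>nn_integral_path_split\<close> are the Markov property at time one
  and at time \<open>k\<close>, written as iterated integrals over independent pieces. Independence
  of the steps is used through them.\<close>

lemma nn_integral_path_first_step:
  assumes [measurable]: "f \<in> borel_measurable (path_law p)"
  shows "(\<integral>\<^sup>+\<omega>. f \<omega> \<partial>path_law p) = (\<integral>\<^sup>+s. (\<integral>\<^sup>+\<omega>. f (case_nat s \<omega>) \<partial>path_law p) \<partial>step_measure p)"
proof -
  interpret S: sequence_space "step_measure p" by (rule sequence_space_step_measure)
  interpret P: prob_space "path_law p" by (rule prob_space_path_law)
  have m: "(\<lambda>(s, \<omega>). case_nat s \<omega>) \<in> step_measure p \<Otimes>\<^sub>M path_law p \<rightarrow>\<^sub>M path_law p"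
    unfolding path_law_def by measurable
  have "(\<integral>\<^sup>+\<omega>. f \<omega> \<partial>path_law p) = (\<integral>\<^sup>+\<omega>. f \<omega> \<partial>distr (step_measure p \<Otimes>\<^sub>M path_law p) (path_law p) (\<lambda>(s, \<omega>). case_nat s \<omega>))"
    using S.PiM_iter by (simp add: path_law_def)
  also have "\<dots> = (\<integral>\<^sup>+x. f ((\<lambda>(s, \<omega>). case_nat s \<omega>) x) \<partial>(step_measure p \<Otimes>\<^sub>M path_law p))"
    by (rule nn_integral_distr[OF m]) simp
  also have "\<dots> = (\<integral>\<^sup>+s. (\<integral>\<^sup>+\<omega>. f (case_nat s \<omega>) \<partial>path_law p) \<partial>step_measure p)"
    by (subst P.nn_integral_fst[symmetric]) (use measurable_compose[OF m assms] in auto)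
  finally show ?thesis .
qed

lemma nn_integral_path_split:
  assumes [measurable]: "f \<in> borel_measurable (path_law p)"
  shows "(\<integral>\<^sup>+\<omega>. f \<omega> \<partial>path_law p) = (\<integral>\<^sup>+\<omega>. (\<integral>\<^sup>+\<omega>'. f (comb_seq k \<omega> \<omega>') \<partial>path_law p) \<partial>path_law p)"
proof -
  interpret S: sequence_space "step_measure p" by (rule sequence_space_step_measure)
  interpret P: prob_space "path_law p" by (rule prob_space_path_law)
  have m: "(\<lambda>(\<omega>, \<omega>'). comb_seq k \<omega> \<omega>') \<in> path_law p \<Otimes>\<^sub>M path_law p \<rightarrow>\<^sub>M path_law p"
    unfolding path_law_def by (rule measurable_comb_seq)
  have "(\<integral>\<^sup>+\<omega>. f \<omega> \<partial>path_law p) = (\<integral>\<^sup>+\<omega>. f \<omega> \<partial>distr (path_law p \<Otimes>\<^sub>M path_law p) (path_law p) (\<lambda>(\<omega>, \<omega>'). comb_seq k \<omega> \<omega>'))"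
    using S.PiM_comb_seq by (simp add: path_law_def)
  also have "\<dots> = (\<integral>\<^sup>+x. f ((\<lambda>(\<omega>, \<omega>'). comb_seq k \<omega> \<omega>') x) \<partial>(path_law p \<Otimes>\<^sub>M path_law p))"
    by (rule nn_integral_distr[OF m]) simp
  also have "\<dots> = (\<integral>\<^sup>+\<omega>. (\<integral>\<^sup>+\<omega>'. f (comb_seq k \<omega> \<omega>') \<partial>path_law p) \<partial>path_law p)"
    by (subst P.nn_integral_fst[symmetric]) (use measurable_compose[OF m assms] in auto)
  finally show ?thesis .
qed

lemma AE_clocks_nonneg: "AE \<omega> in path_law p. \<forall>k. 0 \<le> snd (\<omega> k)"
proof (subst AE_all_countable, intro allI)
  fix k
  interpret E: prob_space exp_measure by (rule prob_space_exp_measure)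
  interpret pair_prob_space "measure_pmf p" exp_measure ..
  have "AE s in step_measure p. 0 \<le> snd s"
    unfolding step_measure_eq using AE_exp_measure_nonneg
    by (intro AE_pair_measure) (auto simp: pred_def)
  then show "AE \<omega> in path_law p. 0 \<le> snd (\<omega> k)"
    unfolding path_law_def by (intro AE_PiM_component) (auto intro: prob_space_step_measure)
qed

lemma nn_integral_clock: "(\<integral>\<^sup>+\<omega>. ennreal (snd (\<omega> k)) ^ i \<partial>path_law p) = ennreal (fact i)"
proof -
  interpret S: prob_space "path_law p" by (rule prob_space_path_law)
  have [measurable]: "(\<lambda>\<omega>. snd (\<omega> k)) \<in> borel_measurable (path_law p)" for k by measurable
  have "(\<integral>\<^sup>+\<omega>. ennreal (snd (\<omega> k)) ^ i \<partial>path_law p) = (\<integral>\<^sup>+\<omega>. ennreal (snd (\<omega> 0)) ^ i \<partial>path_law p)"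
    by (subst nn_integral_path_split[where k=k]) (auto simp: comb_seq_def S.emeasure_space_1[simplified])
  also have "\<dots> = (\<integral>\<^sup>+s. ennreal (snd s) ^ i \<partial>step_measure p)"
    by (subst nn_integral_path_first_step) (auto simp: S.emeasure_space_1[simplified])
  also have "\<dots> = ennreal (fact i)"
    by (subst nn_integral_step_measure) (auto simp: nn_integral_exp_measure_power)
  finally show ?thesis .
qed

definition walk_prob :: "int pmf \<Rightarrow> nat \<Rightarrow> int \<Rightarrow> real" where
  "walk_prob p n i = measure (path_law p) {\<omega>. walk \<omega> n = i}"

lemma walk_event [measurable]: "{\<omega>. walk \<omega> n = i} \<in> sets (path_law p)"
  using measurable_sets[OF measurable_walk, of "{i}" n p] by (simp add: vimage_def)

lemma nn_integral_walk_prob: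
  "(\<integral>\<^sup>+\<omega>. (if walk \<omega> n = i then c else 0) \<partial>path_law p) = c * ennreal (walk_prob p n i)"
proof -
  interpret S: prob_space "path_law p" by (rule prob_space_path_law)
  have "(\<integral>\<^sup>+\<omega>. (if walk \<omega> n = i then c else 0) \<partial>path_law p) = (\<integral>\<^sup>+\<omega>. c * indicator {\<omega>. walk \<omega> n = i} \<omega> \<partial>path_law p)"
    by (intro nn_integral_cong) (auto simp: indicator_def)
  also have "\<dots> = c * emeasure (path_law p) {\<omega>. walk \<omega> n = i}"
    by (intro nn_integral_cmult_indicator) measurable
  finally show ?thesis by (simp add: walk_prob_def S.emeasure_eq_measure)
qed

lemma walk_prob_nonneg [simp]: "0 \<le> walk_prob p n i"
  by (simp add: walk_prob_def)

text \<open>The clipped square \<^term>\<open>min (y\<^sup>2) (4 ^ m)\<close> serves as a Lyapunov function: each step raises its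
  expectation by at most \<^term>\<open>D\<close>, so a first-step induction yields a maximal inequality without
  truncating or centring the steps.\<close>

lemma exit_probability_bound:
  assumes D: "0 \<le> D"
    and drift: "\<And>y. \<bar>y\<bar> < 2 ^ m \<Longrightarrow>
      measure_pmf.expectation p (\<lambda>j. min ((real_of_int (y + j))\<^sup>2) (4 ^ m)) \<le> (real_of_int y)\<^sup>2 + D"
  shows "measure (path_law p) {\<omega>. \<exists>k\<le>n. 2 ^ m \<le> \<bar>y + walk \<omega> k\<bar>} \<le> ((real_of_int y)\<^sup>2 + real n * D) / 4 ^ m"
proof -
  interpret S: prob_space "path_law p" by (rule prob_space_path_law)
  have ev [measurable]: "Measurable.pred (path_law p) (\<lambda>\<omega>. \<exists>k\<le>n. 2 ^ m \<le> \<bar>y + walk \<omega> k\<bar>)" for n y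
  proof -
    have "Measurable.pred (path_law p) (\<lambda>\<omega>. 2 ^ m \<le> \<bar>y + walk \<omega> k\<bar>)" for k
      by (rule measurable_compose[OF measurable_walk]) simp
    then show ?thesis by measurable
  qed
  have ev': "{\<omega>. \<exists>k\<le>n. 2 ^ m \<le> \<bar>y + walk \<omega> k\<bar>} \<in> sets (path_law p)" for n y
    using ev[of n y] by (simp add: pred_def)
  have "emeasure (path_law p) {\<omega>. \<exists>k\<le>n. 2 ^ m \<le> \<bar>y + walk \<omega> k\<bar>} \<le> ennreal (((real_of_int y)\<^sup>2 + real n * D) / 4 ^ m)"
  proof (induction n arbitrary: y)
    case 0
    show ?case
    proof (cases "2 ^ m \<le> \<bar>y\<bar>")
      case True
      then have "(1::real) \<le> (real_of_int y)\<^sup>2 / 4 ^ m" using int_sq_ge[of m y] by simp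
      then have "ennreal 1 \<le> ennreal ((real_of_int y)\<^sup>2 / 4 ^ m)" by (rule ennreal_leI)
      then show ?thesis by (intro order_trans[OF S.emeasure_le_1]) simp
    qed simp
  next
    case (Suc n)
    show ?case
    proof (cases "2 ^ m \<le> \<bar>y\<bar>")
      case True
      then have "4^m \<le> (real_of_int y)\<^sup>2" by (rule int_sq_ge)
      moreover have "0 \<le> real (Suc n) * D" using D by simp
      ultimately have "1 \<le> ((real_of_int y)\<^sup>2 + real (Suc n) * D) / 4 ^ m" by (simp del: of_nat_Suc)
      then have "ennreal 1 \<le> ennreal (((real_of_int y)\<^sup>2 + real (Suc n) * D) / 4 ^ m)" by (rule ennreal_leI)
      then show ?thesis by (intro order_trans[OF S.emeasure_le_1]) simp
    next
      case False
      let ?F = "\<lambda>n y. {\<omega>. \<exists>k\<le>n. 2 ^ m \<le> \<bar>y + walk \<omega> k\<bar>}"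
      \<comment> \<open>The induction hypothesis at \<open>y + j\<close>, with the square capped at
        \<open>4 ^ m\<close>. Where the cap acts the expression is at least 1, so it still dominates
        a probability, and its mean is what \<open>drift\<close> controls.\<close>
      let ?g = "\<lambda>j::int. (min ((real_of_int (y + j))\<^sup>2) (4 ^ m) + real n * D) / 4 ^ m"
      have "emeasure (path_law p) (?F (Suc n) y) = (\<integral>\<^sup>+\<omega>. indicator (?F (Suc n) y) \<omega> \<partial>path_law p)"
        using ev' by simp
      also have "\<dots> = (\<integral>\<^sup>+s. (\<integral>\<^sup>+\<omega>. indicator (?F (Suc n) y) (case_nat s \<omega>) \<partial>path_law p) \<partial>step_measure p)"
        by (intro nn_integral_path_first_step borel_measurable_indicator ev')
      also have "\<dots> = (\<integral>\<^sup>+s. emeasure (path_law p) (?F n (y + fst s)) \<partial>step_measure p)"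
      proof (intro nn_integral_cong)
        fix s :: "int \<times> real"
        have "case_nat s \<omega> \<in> ?F (Suc n) y \<longleftrightarrow> \<omega> \<in> ?F n (y + fst s)" for \<omega>
        proof
          assume "case_nat s \<omega> \<in> ?F (Suc n) y"
          then obtain k where k: "k \<le> Suc n" "2 ^ m \<le> \<bar>y + walk (case_nat s \<omega>) k\<bar>" by auto
          with False obtain k' where "k = Suc k'" by (cases k) auto
          then show "\<omega> \<in> ?F n (y + fst s)" using k by (auto simp: walk_case_nat add.assoc)
        next
          assume "\<omega> \<in> ?F n (y + fst s)"
          then obtain k where "k \<le> n" "2 ^ m \<le> \<bar>y + fst s + walk \<omega> k\<bar>" by auto
          then show "case_nat s \<omega> \<in> ?F (Suc n) y" by (intro CollectI exI[of _ "Suc k"]) (auto simp: walk_case_nat add.assoc)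
        qed
        then have "(\<integral>\<^sup>+\<omega>. indicator (?F (Suc n) y) (case_nat s \<omega>) \<partial>path_law p) = (\<integral>\<^sup>+\<omega>. indicator (?F n (y + fst s)) \<omega> \<partial>path_law p)"
          by (intro nn_integral_cong) (simp add: indicator_def)
        then show "(\<integral>\<^sup>+\<omega>. indicator (?F (Suc n) y) (case_nat s \<omega>) \<partial>path_law p) = emeasure (path_law p) (?F n (y + fst s))"
          using ev' by simp
      qed
      also have "\<dots> \<le> (\<integral>\<^sup>+s. ennreal (?g (fst s)) \<partial>step_measure p)"
      proof (intro nn_integral_mono)
        fix s :: "int \<times> real"
        show "emeasure (path_law p) (?F n (y + fst s)) \<le> ennreal (?g (fst s))"
        proof (cases "(real_of_int (y + fst s))\<^sup>2 \<le> 4 ^ m")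
          case True
          then show ?thesis using Suc.IH[of "y + fst s"] by (simp add: min_def)
        next
          case False
          then have "ennreal 1 \<le> ennreal (?g (fst s))" using D by (intro ennreal_leI) (simp add: min_def)
          then show ?thesis by (intro order_trans[OF S.emeasure_le_1]) simp
        qed
      qed
      also have "\<dots> = (\<integral>\<^sup>+j. ennreal (?g j) \<partial>measure_pmf p)"
        using prob_space.emeasure_space_1[OF prob_space_exp_measure]
        by (subst nn_integral_step_measure) (auto intro!: measurable_compose[OF measurable_fst])
      also have "\<dots> = ennreal (measure_pmf.expectation p ?g)"
        by (rule nn_integral_eq_integral, rule integrable_truncated[where B="(4^m + real n * D) / 4^m"])
          (use D in \<open>auto intro!: divide_right_mono AE_I2 divide_nonneg_nonneg\<close>)
      also have "\<dots> \<le> ennreal (((real_of_int y)\<^sup>2 + real (Suc n) * D) / 4 ^ m)"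
      proof (rule ennreal_leI)
        have "integrable p (\<lambda>j. min ((real_of_int (y + j))\<^sup>2) (4 ^ m))"
          by (rule integrable_truncated[where B="4^m"]) auto
        then have "measure_pmf.expectation p ?g = (measure_pmf.expectation p (\<lambda>j. min ((real_of_int (y + j))\<^sup>2) (4 ^ m)) + real n * D) / 4 ^ m"
          by simp
        also have "\<dots> \<le> ((real_of_int y)\<^sup>2 + D + real n * D) / 4 ^ m"
          using drift[of y] False by (intro divide_right_mono) auto
        finally show "measure_pmf.expectation p ?g \<le> ((real_of_int y)\<^sup>2 + real (Suc n) * D) / 4 ^ m"
          by (simp add: algebra_simps)
      qed
      finally show ?thesis .
    qed
  qed
  moreover have "0 \<le> ((real_of_int y)\<^sup>2 + real n * D) / 4 ^ m" using D by simp
  ultimately show ?thesis by (simp add: S.emeasure_eq_measure)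
qed

section \<open>Occupation times and time averages\<close>

definition green :: "int pmf \<Rightarrow> nat \<Rightarrow> int \<Rightarrow> real" where
  "green p n i = (\<Sum>k<n. walk_prob p k i)"

text \<open>Trap depths are left out so that the law does not depend on the environment;
  \<open>\<tau> i\<close> times this is real time spent at \<open>i\<close>. Values in
  \<open>ennreal\<close> send the null set of negative clocks to 0 and spare integrability
  conditions.\<close>

definition occupation :: "(nat \<Rightarrow> int \<times> real) \<Rightarrow> nat \<Rightarrow> int \<Rightarrow> ennreal" where
  "occupation \<omega> n i = (\<Sum>k<n. if walk \<omega> k = i then ennreal (snd (\<omega> k)) else 0)"

lemma pred_walk [measurable]: "Measurable.pred (path_law p) (\<lambda>\<omega>. walk \<omega> k = i)"
  using walk_event[of k i p] by (simp add: pred_def)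

lemma measurable_occupation [measurable]: "(\<lambda>\<omega>. occupation \<omega> n i) \<in> borel_measurable (path_law p)"
  unfolding occupation_def by measurable

lemma nn_integral_occupation: "(\<integral>\<^sup>+\<omega>. occupation \<omega> n i \<partial>path_law p) = ennreal (green p n i)"
proof -
  have "(\<integral>\<^sup>+\<omega>. (if walk \<omega> k = i then ennreal (snd (\<omega> k)) else 0) \<partial>path_law p) = ennreal (walk_prob p k i)" for k
  proof -
    have "(\<integral>\<^sup>+\<omega>. (if walk \<omega> k = i then ennreal (snd (\<omega> k)) else 0) \<partial>path_law p)
      = (\<integral>\<^sup>+\<omega>. (\<integral>\<^sup>+\<omega>'. (if walk \<omega> k = i then ennreal (snd (\<omega>' 0)) else 0) \<partial>path_law p) \<partial>path_law p)"
      by (subst nn_integral_path_split[where k=k]) (auto simp: walk_comb_seq comb_seq_self intro!: nn_integral_cong)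
    also have "\<dots> = (\<integral>\<^sup>+\<omega>. (if walk \<omega> k = i then 1 else 0) \<partial>path_law p)"
      using nn_integral_clock[of p 0 1] by (intro nn_integral_cong) auto
    finally show ?thesis by (simp add: nn_integral_walk_prob)
  qed
  then show ?thesis
    unfolding occupation_def green_def by (subst nn_integral_sum) auto
qed

text \<open>The factor 2 is the second moment of an exponential clock, needed when
  \<open>m = 0\<close>. For \<open>m > 0\<close> the clocks are distinct and are integrated in turn:
  the later one by splitting at \<open>m\<close>, the first one by a first-step decomposition,
  because it shares its coordinate with the first increment.\<close>

lemma nn_integral_clock_return:
  "(\<integral>\<^sup>+\<omega>. (if walk \<omega> m = 0 then ennreal (snd (\<omega> 0)) * ennreal (snd (\<omega> m)) else 0) \<partial>path_law p)
    \<le> 2 * ennreal (walk_prob p m 0)"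
proof (cases m)
  case 0
  interpret S: prob_space "path_law p" by (rule prob_space_path_law)
  have "walk_prob p 0 0 = 1" using S.prob_space by (simp add: walk_prob_def)
  then show ?thesis using 0 nn_integral_clock[of p 0 2] by (simp add: power2_eq_square)
next
  case (Suc m')
  interpret S: prob_space "path_law p" by (rule prob_space_path_law)
  have "(\<integral>\<^sup>+\<omega>. (if walk \<omega> m = 0 then ennreal (snd (\<omega> 0)) * ennreal (snd (\<omega> m)) else 0) \<partial>path_law p)
    = (\<integral>\<^sup>+\<omega>. (\<integral>\<^sup>+\<omega>'. (if walk \<omega> m = 0 then ennreal (snd (\<omega> 0)) else 0) * ennreal (snd (\<omega>' 0)) \<partial>path_law p) \<partial>path_law p)"
    using Suc by (subst nn_integral_path_split[where k=m])
      (auto simp: walk_comb_seq comb_seq_self comb_seq_apply(2) intro!: nn_integral_cong)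
  also have "\<dots> = (\<integral>\<^sup>+\<omega>. (if walk \<omega> m = 0 then ennreal (snd (\<omega> 0)) else 0) \<partial>path_law p)"
    using nn_integral_clock[of p 0 1] by (intro nn_integral_cong) (simp add: nn_integral_cmult)
  also have "\<dots> = (\<integral>\<^sup>+s. (\<integral>\<^sup>+\<omega>. (if walk \<omega> m' = - fst s then ennreal (snd s) else 0) \<partial>path_law p) \<partial>step_measure p)"
    by (subst nn_integral_path_first_step)
      (auto simp: Suc walk_case_nat intro!: nn_integral_cong arg_cong2[where f=nn_integral])
  also have "\<dots> = (\<integral>\<^sup>+s. ennreal (snd s) * ennreal (walk_prob p m' (- fst s)) \<partial>step_measure p)"
    by (simp add: nn_integral_walk_prob)
  also have "\<dots> = (\<integral>\<^sup>+j. ennreal (walk_prob p m' (- j)) \<partial>measure_pmf p)"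
  proof (subst nn_integral_step_measure)
    show "(\<lambda>s. ennreal (snd s) * ennreal (walk_prob p m' (- fst s))) \<in> borel_measurable (step_measure p)"
      by (intro borel_measurable_times_ennreal measurable_compose[OF _ measurable_ennreal] measurable_snd_step
          measurable_compose[OF measurable_fst_step]) auto
    show "(\<integral>\<^sup>+ j. (\<integral>\<^sup>+ e. ennreal (snd (j, e)) * ennreal (walk_prob p m' (- fst (j, e))) \<partial>exp_measure) \<partial>measure_pmf p)
      = (\<integral>\<^sup>+j. ennreal (walk_prob p m' (- j)) \<partial>measure_pmf p)"
      using nn_integral_exp_measure_power[of 1] by (intro nn_integral_cong) (simp add: nn_integral_multc)
  qed
  also have "\<dots> = ennreal (walk_prob p m 0)"
  proof -
    have "ennreal (walk_prob p m 0) = (\<integral>\<^sup>+\<omega>. (if walk \<omega> m = 0 then 1 else 0) \<partial>path_law p)" by (simp add: nn_integral_walk_prob)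
    also have "\<dots> = (\<integral>\<^sup>+s. (\<integral>\<^sup>+\<omega>. (if walk \<omega> m' = - fst s then 1 else 0) \<partial>path_law p) \<partial>step_measure p)"
      by (subst nn_integral_path_first_step)
        (auto simp: Suc walk_case_nat intro!: nn_integral_cong arg_cong2[where f=nn_integral])
    also have "\<dots> = (\<integral>\<^sup>+s. ennreal (walk_prob p m' (- fst s)) \<partial>step_measure p)"
      by (simp add: nn_integral_walk_prob)
    also have "\<dots> = (\<integral>\<^sup>+j. ennreal (walk_prob p m' (- j)) \<partial>measure_pmf p)"
      using prob_space.emeasure_space_1[OF prob_space_exp_measure]
      by (subst nn_integral_step_measure) (auto intro!: measurable_compose[OF measurable_fst_step])
    finally show ?thesis by simp
  qed
  finally show ?thesis by (simp add: mult_2)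
qed

text \<open>The diagonal is counted twice, which avoids subtraction in
  \<open>ennreal\<close>.\<close>

lemma square_sum_le:
  fixes a :: "nat \<Rightarrow> ennreal"
  shows "(\<Sum>k<n. a k)\<^sup>2 \<le> 2 * (\<Sum>k<n. \<Sum>l\<in>{k..<n}. a k * a l)"
proof (induction n)
  case (Suc n)
  have "(\<Sum>k<Suc n. a k)\<^sup>2 = (\<Sum>k<n. a k)\<^sup>2 + (2 * ((\<Sum>k<n. a k) * a n) + a n * a n)"
    by (simp add: power2_eq_square algebra_simps mult_2)
  also have "\<dots> \<le> 2 * (\<Sum>k<n. \<Sum>l\<in>{k..<n}. a k * a l) + (2 * (\<Sum>k<n. a k * a n) + 2 * (a n * a n))"
    using Suc by (intro add_mono) (simp_all add: sum_distrib_right mult_2)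
  also have "\<dots> = 2 * (\<Sum>k<Suc n. \<Sum>l\<in>{k..<Suc n}. a k * a l)"
    by (simp add: sum.distrib distrib_left add.assoc)
  finally show ?case .
qed simp

text \<open>After a visit at time \<open>k\<close>, a visit at \<open>l\<close> is a return to the
  origin in \<open>l - k\<close> steps, and these returns sum to at most
  \<open>green p n 0 \<le> g\<close>. The constant 4 is 2 for ordering the pair of times and 2 from
  \<open>nn_integral_clock_return\<close>.\<close>

lemma nn_integral_occupation_square:
  assumes g: "\<And>j. green p n j \<le> g"
  shows "(\<integral>\<^sup>+\<omega>. (occupation \<omega> n i)\<^sup>2 \<partial>path_law p) \<le> ennreal (4 * g\<^sup>2)"
proof -
  interpret S: prob_space "path_law p" by (rule prob_space_path_law)
  let ?a = "\<lambda>\<omega> k. if walk \<omega> k = i then ennreal (snd (\<omega> k)) else 0"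
  have pair: "(\<integral>\<^sup>+\<omega>. ?a \<omega> k * ?a \<omega> l \<partial>path_law p) \<le> ennreal (2 * walk_prob p k i * walk_prob p (l - k) 0)" if kl: "k \<le> l" for k l
  proof -
    obtain m where l: "l = k + m" using le_Suc_ex[OF kl] by blast
    have "(\<integral>\<^sup>+\<omega>. ?a \<omega> k * ?a \<omega> l \<partial>path_law p)
      = (\<integral>\<^sup>+\<omega>. (\<integral>\<^sup>+\<omega>'. (if walk \<omega> k = i then 1 else 0) * (if walk \<omega>' m = 0 then ennreal (snd (\<omega>' 0)) * ennreal (snd (\<omega>' m)) else 0) \<partial>path_law p) \<partial>path_law p)"
      by (subst nn_integral_path_split[where k=k])
       (auto simp: l walk_comb_seq comb_seq_apply(1) comb_seq_self intro!: nn_integral_cong)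
    also have "\<dots> \<le> (\<integral>\<^sup>+\<omega>. (if walk \<omega> k = i then 2 * ennreal (walk_prob p m 0) else 0) \<partial>path_law p)"
      using nn_integral_clock_return[of p m] by (intro nn_integral_mono) (auto simp: nn_integral_cmult)
    also have "\<dots> = ennreal (2 * walk_prob p k i * walk_prob p (l - k) 0)"
      by (simp add: nn_integral_walk_prob l ennreal_mult algebra_simps flip: ennreal_numeral)
    finally show ?thesis .
  qed
  have "(\<integral>\<^sup>+\<omega>. (occupation \<omega> n i)\<^sup>2 \<partial>path_law p) \<le> (\<integral>\<^sup>+\<omega>. 2 * (\<Sum>k<n. \<Sum>l\<in>{k..<n}. ?a \<omega> k * ?a \<omega> l) \<partial>path_law p)"
    unfolding occupation_def by (intro nn_integral_mono square_sum_le)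
  also have "\<dots> = 2 * (\<Sum>k<n. \<Sum>l\<in>{k..<n}. (\<integral>\<^sup>+\<omega>. ?a \<omega> k * ?a \<omega> l \<partial>path_law p))"
    by (simp add: nn_integral_cmult nn_integral_sum)
  also have "\<dots> \<le> 2 * (\<Sum>k<n. \<Sum>l\<in>{k..<n}. ennreal (2 * walk_prob p k i * walk_prob p (l - k) 0))"
    by (intro mult_left_mono sum_mono pair) auto
  also have "\<dots> = ennreal (2 * (\<Sum>k<n. \<Sum>l\<in>{k..<n}. 2 * walk_prob p k i * walk_prob p (l - k) 0))"
    by (simp add: sum_nonneg ennreal_mult flip: ennreal_numeral sum_ennreal)
  also have "\<dots> \<le> ennreal (4 * g\<^sup>2)"
  proof (rule ennreal_leI)
    have "(\<Sum>l\<in>{k..<n}. walk_prob p (l - k) 0) \<le> g" if "k < n" for k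
    proof -
      have "(\<Sum>l\<in>{k..<n}. walk_prob p (l - k) 0) = (\<Sum>m\<in>{..<n-k}. walk_prob p m 0)"
        by (rule sum.reindex_bij_witness[of _ "\<lambda>m. m + k" "\<lambda>l. l - k"]) auto
      also have "\<dots> \<le> (\<Sum>m<n. walk_prob p m 0)" by (intro sum_mono2) auto
      finally show ?thesis using g[of 0] by (simp add: green_def)
    qed
    then have "(\<Sum>k<n. \<Sum>l\<in>{k..<n}. 2 * walk_prob p k i * walk_prob p (l - k) 0) \<le> (\<Sum>k<n. 2 * walk_prob p k i * g)"
      unfolding sum_distrib_left[symmetric] by (intro sum_mono mult_left_mono) auto
    also have "\<dots> = 2 * g * green p n i" by (simp add: green_def sum_distrib_left sum_distrib_right algebra_simps)
    also have "\<dots> \<le> 2 * g * g"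
    proof -
      have "0 \<le> green p n 0" by (auto simp: green_def intro!: sum_nonneg)
      then have "0 \<le> g" using g[of 0] by linarith
      then show ?thesis using g[of i] by (intro mult_left_mono) auto
    qed
    finally show "2 * (\<Sum>k<n. \<Sum>l\<in>{k..<n}. 2 * walk_prob p k i * walk_prob p (l - k) 0) \<le> 4 * g\<^sup>2"
      by (simp add: power2_eq_square)
  qed
  finally show ?thesis .
qed

section \<open>From steps to real time\<close>

lemma measurable_jump_time [measurable]: "(\<lambda>\<omega>. jump_time \<tau> \<omega> n) \<in> borel_measurable (path_law p)"
proof -
  have "(\<lambda>\<omega>. \<tau> (walk \<omega> k)) \<in> borel_measurable (path_law p)" for k
    by (rule measurable_compose[OF measurable_walk]) simp
  then show ?thesis unfolding jump_time_def by measurable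
qed

text \<open>Joint measurability in path and time is what exchanging expectation and time integral in
  \<open>time_spent_lower_bound\<close> requires.\<close>

lemma measurable_trap_pos:
  "(\<lambda>(\<omega>, s). trap_pos \<tau> \<omega> s) \<in> path_law p \<Otimes>\<^sub>M lborel \<rightarrow>\<^sub>M count_space UNIV"
proof -
  have [measurable]: "(\<lambda>x. LEAST n. snd x < jump_time \<tau> (fst x) (Suc n)) \<in> path_law p \<Otimes>\<^sub>M lborel \<rightarrow>\<^sub>M count_space UNIV"
    by (rule measurable_Least) measurable
  have "(\<lambda>x. (\<lambda>n x. walk (fst x) n) (LEAST n. snd x < jump_time \<tau> (fst x) (Suc n)) x) \<in> path_law p \<Otimes>\<^sub>M lborel \<rightarrow>\<^sub>M count_space UNIV"
    by (rule measurable_compose_countable) measurable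
  then show ?thesis by (simp add: trap_pos_def case_prod_beta')
qed

lemma measurable_trap_indicator [measurable]:
  "(\<lambda>(\<omega>, s). if trap_pos \<tau> \<omega> s = i then 1 else 0 :: ennreal) \<in> borel_measurable (path_law p \<Otimes>\<^sub>M lborel)"
  using measurable_compose[OF measurable_trap_pos, of "\<lambda>j. if j = i then 1 else 0 :: ennreal" borel]
  by (simp add: case_prod_beta')

lemma nn_integral_trap_pos:
  "(\<integral>\<^sup>+\<omega>. (if trap_pos \<tau> \<omega> s = i then 1 else 0) \<partial>path_law p) = ennreal (quenched_prob p \<tau> s i)"
proof -
  interpret S: prob_space "path_law p" by (rule prob_space_path_law)
  have "(\<lambda>\<omega>. trap_pos \<tau> \<omega> s) \<in> path_law p \<rightarrow>\<^sub>M count_space UNIV"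
  proof -
    have "(\<lambda>\<omega>. (\<omega>, s)) \<in> path_law p \<rightarrow>\<^sub>M path_law p \<Otimes>\<^sub>M lborel" by simp
    from measurable_compose[OF this measurable_trap_pos] show ?thesis by simp
  qed
  from measurable_sets[OF this, of "{i}"] have m: "{\<omega>. trap_pos \<tau> \<omega> s = i} \<in> sets (path_law p)" by (simp add: vimage_def)
  have "(\<integral>\<^sup>+\<omega>. (if trap_pos \<tau> \<omega> s = i then 1 else 0) \<partial>path_law p) = (\<integral>\<^sup>+\<omega>. indicator {\<omega>. trap_pos \<tau> \<omega> s = i} \<omega> \<partial>path_law p)"
    by (intro nn_integral_cong) (auto simp: indicator_def)
  also have "\<dots> = ennreal (quenched_prob p \<tau> s i)"
    using m by (simp add: quenched_prob_def S.emeasure_eq_measure)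
  finally show ?thesis .
qed

lemma jump_time_Suc: "jump_time \<tau> \<omega> (Suc n) = jump_time \<tau> \<omega> n + \<tau> (walk \<omega> n) * snd (\<omega> n)"
  by (simp add: jump_time_def)

text \<open>On this interval the index \<open>n\<close> qualifies, so the unspecified value of
  \<open>LEAST\<close> for an empty set does not arise. Clocks may vanish, hence jump times are only
  weakly monotone; this already rules out a smaller index.\<close>

lemma trap_pos_between_jumps:
  assumes "\<And>i. 0 < \<tau> i" "\<And>k. 0 \<le> snd (\<omega> k)"
    and s: "jump_time \<tau> \<omega> n \<le> s" "s < jump_time \<tau> \<omega> (Suc n)"
  shows "trap_pos \<tau> \<omega> s = walk \<omega> n"
proof -
  have mono: "mono (jump_time \<tau> \<omega>)"
    using assms(1,2) by (intro mono_iff_le_Suc[THEN iffD2]) (auto simp: jump_time_Suc less_imp_le)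
  have "(LEAST n. s < jump_time \<tau> \<omega> (Suc n)) = n"
  proof (rule Least_equality)
    show "s < jump_time \<tau> \<omega> (Suc n)" by (rule s)
  next
    fix m assume m: "s < jump_time \<tau> \<omega> (Suc m)"
    show "n \<le> m"
    proof (rule ccontr)
      assume "\<not> n \<le> m"
      then have "jump_time \<tau> \<omega> (Suc m) \<le> jump_time \<tau> \<omega> n" by (intro monoD[OF mono]) simp
      then show False using m s by linarith
    qed
  qed
  then show ?thesis by (simp add: trap_pos_def)
qed

lemma occupation_le_time_spent:
  assumes \<tau>: "\<And>i. 0 < \<tau> i" and e: "\<And>k. 0 \<le> snd (\<omega> k)"
  shows "ennreal (\<tau> i) * occupation \<omega> n i
    \<le> (\<integral>\<^sup>+s. indicator {0..<jump_time \<tau> \<omega> n} s * (if trap_pos \<tau> \<omega> s = i then 1 else 0) \<partial>lborel)"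
proof (induction n)
  case (Suc n)
  let ?J = "jump_time \<tau> \<omega>"
  let ?f = "\<lambda>s. if trap_pos \<tau> \<omega> s = i then 1 else 0 :: ennreal"
  have [measurable]: "?f \<in> borel_measurable lborel"
  proof -
    \<comment> \<open>The path is fixed here; \<open>return_pmf 0\<close> merely supplies some path
      law whose joint measurability statement can be sectioned.\<close>
    have "(\<lambda>s. (\<omega>, s)) \<in> lborel \<rightarrow>\<^sub>M path_law (return_pmf 0) \<Otimes>\<^sub>M lborel" by simp
    from measurable_compose[OF this measurable_trap_indicator] show ?thesis by simp
  qed
  have J: "0 \<le> ?J n" "?J n \<le> ?J (Suc n)"
    using \<tau> e by (auto simp: jump_time_def less_imp_le intro!: sum_nonneg)
  have "ennreal (\<tau> i) * occupation \<omega> (Suc n) i = ennreal (\<tau> i) * occupation \<omega> n i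
    + (if walk \<omega> n = i then ennreal (\<tau> i * snd (\<omega> n)) else 0)"
    using \<tau>[of i] e[of n] by (simp add: occupation_def distrib_left ennreal_mult)
  also have "(if walk \<omega> n = i then ennreal (\<tau> i * snd (\<omega> n)) else 0) \<le> (\<integral>\<^sup>+s. indicator {?J n..<?J (Suc n)} s * ?f s \<partial>lborel)"
  proof (cases "walk \<omega> n = i")
    case True
    have "(\<integral>\<^sup>+s. indicator {?J n..<?J (Suc n)} s * ?f s \<partial>lborel) = (\<integral>\<^sup>+s. indicator {?J n..<?J (Suc n)} s \<partial>lborel)"
      using True trap_pos_between_jumps[of \<tau> \<omega> n, OF \<tau> e] by (intro nn_integral_cong) (auto simp: indicator_def)
    also have "\<dots> = ennreal (?J (Suc n) - ?J n)" using J by simp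
    finally show ?thesis using True by (simp add: jump_time_Suc)
  qed simp
  finally have "ennreal (\<tau> i) * occupation \<omega> (Suc n) i \<le> 
     (\<integral>\<^sup>+s. indicator {0..<?J n} s * ?f s \<partial>lborel) + (\<integral>\<^sup>+s. indicator {?J n..<?J (Suc n)} s * ?f s \<partial>lborel)"
    using Suc by (meson add_mono order_refl order_trans)
  also have "\<dots> = (\<integral>\<^sup>+s. indicator {0..<?J n} s * ?f s + indicator {?J n..<?J (Suc n)} s * ?f s \<partial>lborel)"
    by (intro nn_integral_add[symmetric]) measurable
  also have "\<dots> = (\<integral>\<^sup>+s. indicator {0..<?J (Suc n)} s * ?f s \<partial>lborel)"
    using J by (intro nn_integral_cong) (auto simp: indicator_def)
  finally show ?case .
qed (simp add: occupation_def)

lemma jump_time_eq_occupation: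
  assumes \<tau>: "\<And>i. 0 < \<tau> i" and e: "\<And>k. 0 \<le> snd (\<omega> k)" and A: "finite A" "\<And>k. k < n \<Longrightarrow> walk \<omega> k \<in> A"
  shows "ennreal (jump_time \<tau> \<omega> n) = (\<Sum>j\<in>A. ennreal (\<tau> j) * occupation \<omega> n j)"
proof -
  have "(\<Sum>j\<in>A. ennreal (\<tau> j) * occupation \<omega> n j) = (\<Sum>k<n. \<Sum>j\<in>A. if walk \<omega> k = j then ennreal (\<tau> j) * ennreal (snd (\<omega> k)) else 0)"
    unfolding occupation_def sum_distrib_left by (subst sum.swap) (auto intro!: sum.cong)
  also have "\<dots> = (\<Sum>k<n. ennreal (\<tau> (walk \<omega> k)) * ennreal (snd (\<omega> k)))"
    using A by (intro sum.cong) (auto simp: sum.delta')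
  also have "\<dots> = ennreal (jump_time \<tau> \<omega> n)"
    using \<tau> e by (simp add: jump_time_def less_imp_le ennreal_mult flip: sum_ennreal)
  finally show ?thesis by simp
qed

text \<open>Each \<epsilon> pays for one cause of a late clock: the walk leaves \<open>A\<close>, or
  the clock accumulated inside \<open>A\<close>, with mean at most
  \<open>g * (\<Sum>j\<in>A. \<tau> j)\<close>, exceeds \<open>t\<close> (Markov). Markov is applied
  to \<open>?T\<close> and not to the jump time itself, whose mean may be infinite because of remote
  traps.\<close>

lemma jump_time_tail:
  assumes \<tau>: "\<And>i. 0 < \<tau> i" and A: "finite A" and t: "0 < t"
    and g: "\<And>j. green p n j \<le> g"
    and exit: "measure (path_law p) {\<omega>. \<exists>k\<le>n. walk \<omega> k \<notin> A} \<le> \<epsilon>"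
    and mean: "g * (\<Sum>j\<in>A. \<tau> j) \<le> \<epsilon> * t"
  shows "measure (path_law p) {\<omega>. t < jump_time \<tau> \<omega> n} \<le> 2 * \<epsilon>"
proof -
  interpret S: prob_space "path_law p" by (rule prob_space_path_law)
  let ?T = "\<lambda>\<omega>. (\<Sum>j\<in>A. ennreal (\<tau> j) * occupation \<omega> n j)"
  let ?E1 = "{\<omega>. \<exists>k\<le>n. walk \<omega> k \<notin> A}" and ?E2 = "{\<omega>. 1 \<le> ennreal (1 / t) * ?T \<omega>}"
  have e0: "0 \<le> \<epsilon>" using exit measure_nonneg order_trans by blast
  have [measurable]: "Measurable.pred (path_law p) (\<lambda>\<omega>. walk \<omega> k \<in> A)" for k
    by (rule measurable_compose[OF measurable_walk]) simp
  have m1: "?E1 \<in> sets (path_law p)"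
  proof -
    have "Measurable.pred (path_law p) (\<lambda>\<omega>. \<exists>k\<le>n. walk \<omega> k \<notin> A)" by measurable
    then show ?thesis by (simp add: pred_def)
  qed
  have m2: "?E2 \<in> sets (path_law p)"
  proof -
    have "Measurable.pred (path_law p) (\<lambda>\<omega>. 1 \<le> ennreal (1 / t) * ?T \<omega>)" by measurable
    then show ?thesis by (simp add: pred_def)
  qed
  have "emeasure (path_law p) {\<omega>. t < jump_time \<tau> \<omega> n} \<le> emeasure (path_law p) (?E1 \<union> ?E2)"
  proof (rule emeasure_mono_AE)
    show "AE \<omega> in path_law p. \<omega> \<in> {\<omega>. t < jump_time \<tau> \<omega> n} \<longrightarrow> \<omega> \<in> ?E1 \<union> ?E2"
      using AE_clocks_nonneg
    proof eventually_elim
      case (elim \<omega>)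
      show ?case
      proof (intro impI, rule ccontr)
        assume a: "\<omega> \<in> {\<omega>. t < jump_time \<tau> \<omega> n}" "\<omega> \<notin> ?E1 \<union> ?E2"
        then have "ennreal (jump_time \<tau> \<omega> n) = ?T \<omega>" using elim \<tau> A by (intro jump_time_eq_occupation) auto
        then have "ennreal (1 / t) * ?T \<omega> = ennreal (jump_time \<tau> \<omega> n / t)" using t a by (simp add: ennreal_mult[symmetric] flip: \<open>_ = ?T \<omega>\<close>)
        moreover have "1 \<le> jump_time \<tau> \<omega> n / t" using a t by simp
        then have "ennreal 1 \<le> ennreal (jump_time \<tau> \<omega> n / t)" by (rule ennreal_leI)
        ultimately show False using a by simp
      qed
    qed
  qed (use m1 m2 in auto)
  also have "\<dots> \<le> emeasure (path_law p) ?E1 + emeasure (path_law p) ?E2"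
    using m1 m2 by (rule emeasure_subadditive)
  also have "\<dots> \<le> ennreal \<epsilon> + ennreal \<epsilon>"
  proof (rule add_mono)
    show "emeasure (path_law p) ?E1 \<le> ennreal \<epsilon>" using exit by (simp add: S.emeasure_eq_measure ennreal_leI)
    have "emeasure (path_law p) ?E2 \<le> ennreal (1 / t) * (\<integral>\<^sup>+\<omega>. ?T \<omega> * indicator UNIV \<omega> \<partial>path_law p)"
      using nn_integral_Markov_inequality[where u="?T" and M="path_law p" and A=UNIV and c="ennreal (1/t)"] sets.top[of "path_law p"] by simp
    also have "(\<integral>\<^sup>+\<omega>. ?T \<omega> * indicator UNIV \<omega> \<partial>path_law p) = (\<Sum>j\<in>A. ennreal (\<tau> j) * ennreal (green p n j))"
      by (simp add: nn_integral_sum nn_integral_cmult nn_integral_occupation)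
    also have "\<dots> \<le> (\<Sum>j\<in>A. ennreal (\<tau> j) * ennreal g)"
      using g by (intro sum_mono mult_left_mono ennreal_leI) auto
    also have "\<dots> = ennreal (g * (\<Sum>j\<in>A. \<tau> j))"
    proof -
      have "0 \<le> green p n 0" by (auto simp: green_def intro!: sum_nonneg)
      then have "0 \<le> g" using g[of 0] by linarith
      then show ?thesis using \<tau> by (simp add: less_imp_le ennreal_mult[symmetric] sum_distrib_left mult.commute)
    qed
    also have "\<dots> \<le> ennreal (\<epsilon> * t)" using mean by (rule ennreal_leI)
    also have "ennreal (1 / t) * ennreal (\<epsilon> * t) = ennreal \<epsilon>" using t e0 by (simp add: ennreal_mult[symmetric])
    finally show "emeasure (path_law p) ?E2 \<le> ennreal \<epsilon>" by (simp add: mult_left_mono)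
  qed
  also have "\<dots> = ennreal (2 * \<epsilon>)" using e0 by (simp add: ennreal_plus[symmetric] del: ennreal_plus)
  finally show ?thesis using e0 by (simp add: S.emeasure_eq_measure)
qed

text \<open>Of the expected occupation \<open>c * g\<close> of site \<open>i\<close>, late clocks
  destroy at most half. The loss is bounded by
  \<open>4 * g\<^sup>2 / K + 2 * K * \<epsilon>\<close>; with \<open>K = 16 * g / c\<close> the
  first term equals \<open>c * g / 4\<close>, and \<open>\<epsilon> \<le> c\<^sup>2 / 128\<close>
  makes the second no larger. The other half is occupation completed before time \<open>t\<close>,
  and Fubini converts it into quenched probabilities.\<close>

lemma time_spent_lower_bound:
  assumes \<tau>: "\<And>i. 0 < \<tau> i" and A: "finite A" and t: "0 < t"
    and g: "\<And>j. green p n j \<le> g" "0 < g" and c: "0 < c" "c * g \<le> green p n i"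
    and exit: "measure (path_law p) {\<omega>. \<exists>k\<le>n. walk \<omega> k \<notin> A} \<le> \<epsilon>" and eps: "\<epsilon> \<le> c\<^sup>2 / 128"
    and mean: "g * (\<Sum>j\<in>A. \<tau> j) \<le> \<epsilon> * t"
  shows "ennreal (\<tau> i * c * g / 2) \<le> (\<integral>\<^sup>+s. indicator {0..<t} s * ennreal (quenched_prob p \<tau> s i) \<partial>lborel)"
proof -
  interpret S: prob_space "path_law p" by (rule prob_space_path_law)
  interpret pair_sigma_finite "path_law p" lborel ..
  let ?G = "\<lambda>\<omega>. occupation \<omega> n i"
  let ?I = "\<lambda>\<omega>. if jump_time \<tau> \<omega> n \<le> t then ?G \<omega> else 0"
  let ?f = "\<lambda>\<omega> s. if trap_pos \<tau> \<omega> s = i then 1 else 0 :: ennreal"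
  \<comment> \<open>\<open>G \<le> G\<^sup>2 / K + K\<close> controls the part of the occupation time lost on late clocks\<close>
  define K where "K = 16 * g / c"
  have K: "0 < K" using g c by (simp add: K_def)
  have ev [measurable]: "{\<omega>. t < jump_time \<tau> \<omega> n} \<in> sets (path_law p)"
  proof -
    have "Measurable.pred (path_law p) (\<lambda>\<omega>. t < jump_time \<tau> \<omega> n)" by measurable
    then show ?thesis by (simp add: pred_def)
  qed
  have "ennreal (c * g) \<le> ennreal (green p n i)" using c by (intro ennreal_leI)
  also have "\<dots> = (\<integral>\<^sup>+\<omega>. ?G \<omega> \<partial>path_law p)" by (simp add: nn_integral_occupation)
  also have "\<dots> \<le> (\<integral>\<^sup>+\<omega>. ?I \<omega> + (ennreal (1 / K) * (?G \<omega>)\<^sup>2 + ennreal K * indicator {\<omega>. t < jump_time \<tau> \<omega> n} \<omega>) \<partial>path_law p)"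
  proof (intro nn_integral_mono)
    fix \<omega>
    show "?G \<omega> \<le> ?I \<omega> + (ennreal (1 / K) * (?G \<omega>)\<^sup>2 + ennreal K * indicator {\<omega>. t < jump_time \<tau> \<omega> n} \<omega>)"
    proof (cases "jump_time \<tau> \<omega> n \<le> t")
      case False
      have "?G \<omega> \<le> ennreal (1 / K) * (?G \<omega>)\<^sup>2 + ennreal K"
      proof (cases "?G \<omega> \<le> ennreal K")
        case True
        then show ?thesis by (simp add: add_increasing)
      next
        case False
        have "?G \<omega> = ennreal (1 / K) * (ennreal K * ?G \<omega>)" using K by (simp add: mult.assoc[symmetric] ennreal_mult[symmetric])
        also have "\<dots> \<le> ennreal (1 / K) * (?G \<omega> * ?G \<omega>)" using False by (intro mult_left_mono mult_right_mono) auto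
        finally show ?thesis by (simp add: power2_eq_square add_increasing2)
      qed
      then show ?thesis using False by simp
    qed (auto simp: add_increasing2)
  qed
  also have "\<dots> = (\<integral>\<^sup>+\<omega>. ?I \<omega> \<partial>path_law p) + (ennreal (1 / K) * (\<integral>\<^sup>+\<omega>. (?G \<omega>)\<^sup>2 \<partial>path_law p) + ennreal K * emeasure (path_law p) {\<omega>. t < jump_time \<tau> \<omega> n})"
    by (simp add: nn_integral_add nn_integral_cmult)
  also have "\<dots> \<le> (\<integral>\<^sup>+\<omega>. ?I \<omega> \<partial>path_law p) + (ennreal (1 / K) * ennreal (4 * g\<^sup>2) + ennreal K * ennreal (2 * \<epsilon>))"
    using jump_time_tail[OF \<tau> A t g(1) exit mean]
    by (intro add_mono mult_left_mono nn_integral_occupation_square g order_refl) (auto simp: S.emeasure_eq_measure ennreal_leI)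
  also have "\<dots> \<le> (\<integral>\<^sup>+\<omega>. ?I \<omega> \<partial>path_law p) + ennreal (c * g / 2)"
  proof (rule add_left_mono)
    have e0: "0 \<le> \<epsilon>" using exit measure_nonneg order_trans by blast
    have "ennreal (1 / K) * ennreal (4 * g\<^sup>2) + ennreal K * ennreal (2 * \<epsilon>) = ennreal (1 / K * (4 * g\<^sup>2) + K * (2 * \<epsilon>))"
      using K e0 by (simp add: ennreal_mult[symmetric] ennreal_plus[symmetric] del: ennreal_plus)
    also have "\<dots> \<le> ennreal (c * g / 2)"
    proof (rule ennreal_leI)
      have "K * (2 * \<epsilon>) \<le> K * (2 * (c\<^sup>2 / 128))" using K eps by (intro mult_left_mono) auto
      also have "\<dots> = c * g / 4" using c by (simp add: K_def power2_eq_square field_simps)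
      finally have "K * (2 * \<epsilon>) \<le> c * g / 4" .
      moreover have "1 / K * (4 * g\<^sup>2) = c * g / 4" using c g by (simp add: K_def power2_eq_square field_simps)
      ultimately show "1 / K * (4 * g\<^sup>2) + K * (2 * \<epsilon>) \<le> c * g / 2" by linarith
    qed
    finally show "ennreal (1 / K) * ennreal (4 * g\<^sup>2) + ennreal K * ennreal (2 * \<epsilon>) \<le> ennreal (c * g / 2)" .
  qed
  finally have "ennreal (c * g) \<le> (\<integral>\<^sup>+\<omega>. ?I \<omega> \<partial>path_law p) + ennreal (c * g / 2)" .
  moreover have "ennreal (c * g) = ennreal (c * g / 2) + ennreal (c * g / 2)" using c g by (simp add: ennreal_plus[symmetric] del: ennreal_plus)
  ultimately have half: "ennreal (c * g / 2) \<le> (\<integral>\<^sup>+\<omega>. ?I \<omega> \<partial>path_law p)"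
    by (simp add: add.commute ennreal_add_left_cancel_le)
  have "ennreal (\<tau> i * c * g / 2) = ennreal (\<tau> i) * ennreal (c * g / 2)"
    using \<tau>[of i] c g by (simp add: ennreal_mult[symmetric] less_imp_le mult.assoc)
  also have "\<dots> \<le> ennreal (\<tau> i) * (\<integral>\<^sup>+\<omega>. ?I \<omega> \<partial>path_law p)" using half by (intro mult_left_mono) auto
  also have "\<dots> = (\<integral>\<^sup>+\<omega>. ennreal (\<tau> i) * ?I \<omega> \<partial>path_law p)" by (intro nn_integral_cmult[symmetric]) measurable
  also have "\<dots> \<le> (\<integral>\<^sup>+\<omega>. (\<integral>\<^sup>+s. indicator {0..<t} s * ?f \<omega> s \<partial>lborel) \<partial>path_law p)"
  proof (rule nn_integral_mono_AE)
    show "AE \<omega> in path_law p. ennreal (\<tau> i) * ?I \<omega> \<le> (\<integral>\<^sup>+s. indicator {0..<t} s * ?f \<omega> s \<partial>lborel)"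
      using AE_clocks_nonneg
    proof eventually_elim
      case (elim \<omega>)
      show ?case
      proof (cases "jump_time \<tau> \<omega> n \<le> t")
        case True
        then have "ennreal (\<tau> i) * ?I \<omega> \<le> (\<integral>\<^sup>+s. indicator {0..<jump_time \<tau> \<omega> n} s * ?f \<omega> s \<partial>lborel)"
          using occupation_le_time_spent[of \<tau> \<omega> i n] \<tau> elim by simp
        also have "\<dots> \<le> (\<integral>\<^sup>+s. indicator {0..<t} s * ?f \<omega> s \<partial>lborel)"
          using True by (intro nn_integral_mono mult_right_mono) (auto simp: indicator_def)
        finally show ?thesis .
      qed simp
    qed
  qed
  also have "\<dots> = (\<integral>\<^sup>+s. (\<integral>\<^sup>+\<omega>. indicator {0..<t} s * ?f \<omega> s \<partial>path_law p) \<partial>lborel)"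
    by (rule Fubini'[symmetric]) measurable
  also have "\<dots> = (\<integral>\<^sup>+s. indicator {0..<t} s * ennreal (quenched_prob p \<tau> s i) \<partial>lborel)"
    by (intro nn_integral_cong) (auto simp: indicator_def nn_integral_trap_pos)
  finally show ?thesis .
qed

lemma quenched_prob_le_1: "quenched_prob p \<tau> s i \<le> 1"
  unfolding quenched_prob_def by (rule prob_space.prob_le_1[OF prob_space_path_law])

text \<open>If the supremum were below \<open>\<delta> / 2\<close> from time \<open>s1\<close> on,
  the integral up to \<open>t\<close> would be at most \<open>s1 + \<delta> / 2 * (t - s1)\<close>,
  which is less than \<open>\<delta> * t\<close> for large \<open>t\<close>. The site may change
  with \<open>t\<close>.\<close>

lemma not_tendsto_zero_if_time_averages:
  assumes \<delta>: "0 < \<delta>"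
    and avg: "\<And>T. \<exists>t>T. \<exists>i. ennreal (\<delta> * t) \<le> (\<integral>\<^sup>+s. indicator {0..<t} s * ennreal (quenched_prob p \<tau> s i) \<partial>lborel)"
  shows "\<not> ((\<lambda>t. SUP i::int. quenched_prob p \<tau> t i) \<longlongrightarrow> 0) at_top"
proof
  assume "((\<lambda>t. SUP i::int. quenched_prob p \<tau> t i) \<longlongrightarrow> 0) at_top"
  from order_tendstoD(2)[OF this, of "\<delta> / 2"] \<delta> obtain s0 where s0: "\<And>s. s0 \<le> s \<Longrightarrow> (SUP i::int. quenched_prob p \<tau> s i) < \<delta> / 2"
    by (auto simp: eventually_at_top_linorder)
  define s1 where "s1 = max s0 0"
  \<comment> \<open>The threshold makes \<open>t\<close> exceed both \<open>s1\<close> and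
    \<open>2 * s1 / \<delta>\<close>, so the initial stretch cannot account for half of
    \<open>\<delta> * t\<close>.\<close>
  obtain t i where t: "t > 2 * s1 / \<delta> + s1 + 1" and le: "ennreal (\<delta> * t) \<le> (\<integral>\<^sup>+s. indicator {0..<t} s * ennreal (quenched_prob p \<tau> s i) \<partial>lborel)"
    using avg by blast
  have s1: "0 \<le> s1" by (simp add: s1_def)
  moreover have "0 \<le> 2 * s1 / \<delta>" using \<delta> s1 by simp
  ultimately have s1: "0 \<le> s1" "s1 < t" "2 * s1 / \<delta> < t" using t by linarith+
  have small: "quenched_prob p \<tau> s i < \<delta> / 2" if "s1 \<le> s" for s
  proof -
    have "quenched_prob p \<tau> s i \<le> (SUP i::int. quenched_prob p \<tau> s i)"
      by (rule cSUP_upper) (auto intro!: bdd_aboveI[where M=1] quenched_prob_le_1)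
    then show ?thesis using s0[of s] that by (simp add: s1_def)
  qed
  have "(\<integral>\<^sup>+s. indicator {0..<t} s * ennreal (quenched_prob p \<tau> s i) \<partial>lborel) \<le> (\<integral>\<^sup>+s. indicator {0..<s1} s + ennreal (\<delta>/2) * indicator {s1..<t} s \<partial>lborel)"
  proof (intro nn_integral_mono)
    fix s :: real
    show "indicator {0..<t} s * ennreal (quenched_prob p \<tau> s i) \<le> indicator {0..<s1} s + ennreal (\<delta>/2) * indicator {s1..<t} s"
    proof (cases "s < s1")
      case True
      then show ?thesis using quenched_prob_le_1[of p \<tau> s i] by (auto simp: indicator_def ennreal_leI)
    next
      case False
      then show ?thesis using small[of s] by (auto simp: indicator_def ennreal_leI)
    qed
  qed
  also have "\<dots> = ennreal s1 + ennreal (\<delta>/2) * ennreal (t - s1)"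
    using s1 by (simp add: nn_integral_add nn_integral_cmult)
  also have "\<dots> = ennreal (s1 + \<delta>/2 * (t - s1))" using s1 \<delta> by (simp add: ennreal_mult[symmetric] ennreal_plus[symmetric] del: ennreal_plus)
  finally have "ennreal (\<delta> * t) \<le> ennreal (s1 + \<delta>/2 * (t - s1))" using le by simp
  then have "\<delta> * t \<le> s1 + \<delta>/2 * (t - s1)" using s1 \<delta> by (subst (asm) ennreal_le_iff) auto
  moreover have "0 \<le> \<delta> / 2 * s1" using s1 \<delta> by simp
  moreover have "\<delta> / 2 * (t - s1) = \<delta> * t / 2 - \<delta> / 2 * s1" by (simp add: field_simps)
  ultimately have "\<delta> * t \<le> 2 * s1" by linarith
  moreover have "2 * s1 < \<delta> * t"
  proof -
    have "2 * s1 / \<delta> < t" by (rule s1)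
    then show ?thesis using \<delta> by (simp add: field_simps)
  qed
  ultimately show False by simp
qed

section \<open>A Fourier bound on expected visits\<close>

lemma walk_prob_Suc: "walk_prob p (Suc n) i = measure_pmf.expectation p (\<lambda>j. walk_prob p n (i - j))"
proof -
  have le1: "walk_prob p n i \<le> 1" for n i
    unfolding walk_prob_def by (rule prob_space.prob_le_1[OF prob_space_path_law])
  have "ennreal (walk_prob p (Suc n) i) = (\<integral>\<^sup>+\<omega>. (if walk \<omega> (Suc n) = i then 1 else 0) \<partial>path_law p)" by (simp add: nn_integral_walk_prob)
  also have "\<dots> = (\<integral>\<^sup>+s. (\<integral>\<^sup>+\<omega>. (if walk \<omega> n = i - fst s then 1 else 0) \<partial>path_law p) \<partial>step_measure p)"
    by (subst nn_integral_path_first_step)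
      (auto simp: walk_case_nat intro!: nn_integral_cong arg_cong2[where f=nn_integral])
  also have "\<dots> = (\<integral>\<^sup>+s. ennreal (walk_prob p n (i - fst s)) \<partial>step_measure p)"
    by (simp add: nn_integral_walk_prob)
  also have "\<dots> = (\<integral>\<^sup>+j. ennreal (walk_prob p n (i - j)) \<partial>measure_pmf p)"
    using prob_space.emeasure_space_1[OF prob_space_exp_measure]
    by (subst nn_integral_step_measure) (auto intro!: measurable_compose[OF measurable_fst_step])
  also have "\<dots> = ennreal (measure_pmf.expectation p (\<lambda>j. walk_prob p n (i - j)))"
    by (rule nn_integral_eq_integral, rule integrable_truncated[where B=1]) (auto simp: le1)
  finally show ?thesis by (subst (asm) ennreal_inj) (auto intro!: integral_nonneg_AE)
qed

section \<open>Fourier inversion on the circle\<close>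

definition circle_measure :: "real measure" where
  "circle_measure = density lborel (\<lambda>x. ennreal (indicator {-pi..pi} x / (2 * pi)))"

lemma sets_circle_measure [measurable_cong, simp]: "sets circle_measure = sets borel"
  by (simp add: circle_measure_def)

lemma space_circle_measure [simp]: "space circle_measure = UNIV"
  by (simp add: circle_measure_def)

lemma emeasure_circle_measure:
  assumes [measurable]: "A \<in> sets borel"
  shows "emeasure circle_measure A = ennreal (1 / (2 * pi)) * emeasure lborel (A \<inter> {-pi..pi})"
proof -
  have "emeasure circle_measure A = (\<integral>\<^sup>+x. ennreal (1 / (2 * pi)) * indicator (A \<inter> {-pi..pi}) x \<partial>lborel)"
    unfolding circle_measure_def by (subst emeasure_density) (auto intro!: nn_integral_cong simp: indicator_def)
  then show ?thesis by (simp add: nn_integral_cmult)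
qed

lemma prob_space_circle_measure: "prob_space circle_measure"
  by (rule prob_spaceI) (simp add: emeasure_circle_measure ennreal_mult[symmetric])

lemma measure_circle_interval:
  assumes "0 \<le> r"
  shows "measure circle_measure {-r..r} \<le> r"
proof -
  interpret prob_space circle_measure by (rule prob_space_circle_measure)
  have "ennreal (measure circle_measure {-r..r}) = ennreal (1 / (2 * pi)) * emeasure lborel ({-r..r} \<inter> {-pi..pi})"
    using emeasure_circle_measure[of "{-r..r}"] by (simp add: emeasure_eq_measure)
  also have "\<dots> \<le> ennreal (1 / (2 * pi)) * emeasure lborel {-r..r}"
    by (intro mult_left_mono emeasure_mono) auto
  also have "\<dots> = ennreal (r / pi)" using assms by (simp add: ennreal_mult[symmetric])
  also have "\<dots> \<le> ennreal r"
  proof (rule ennreal_leI)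
    show "r / pi \<le> r" using assms pi_gt3 mult_right_mono[of 1 pi r] by (simp add: field_simps)
  qed
  finally show ?thesis using assms by simp
qed

lemma AE_circle_measure: "AE x in circle_measure. x \<in> {-pi..pi}"
  unfolding circle_measure_def by (subst AE_density) (auto simp: indicator_def)

lemma integral_circle_cis: "(\<integral>x. cis (real_of_int i * x) \<partial>circle_measure) = (if i = 0 then 1 else 0)"
proof -
  have cont: "continuous_on S (\<lambda>x. cis (real_of_int i * x))" for S by (intro continuous_intros)
  have m: "(\<lambda>x. cis (real_of_int i * x)) \<in> borel_measurable borel"
    by (rule borel_measurable_continuous_onI[OF cont])
  show ?thesis
  proof (cases "i = 0")
    case True
    then show ?thesis using prob_space.prob_space[OF prob_space_circle_measure] by simp
  next
    case False
    define F where "F x = cis (real_of_int i * x) / (\<i> * of_int i)" for x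
    have D: "(F has_vector_derivative cis (real_of_int i * x)) (at x within {-pi..pi})" for x
    proof -
      have "((\<lambda>z. exp (\<i> * of_int i * z) / (\<i> * of_int i)) has_field_derivative exp (\<i> * of_int i * of_real x)) (at (complex_of_real x))"
        using False by (auto intro!: derivative_eq_intros)
      from has_vector_derivative_real_field[OF this, of "{-pi..pi}"]
      show ?thesis by (simp add: F_def[abs_def] cis_conv_exp mult.assoc)
    qed
    have "(\<integral>x. cis (real_of_int i * x) \<partial>circle_measure) = (\<integral>x. (indicator {-pi..pi} x / (2 * pi)) *\<^sub>R cis (real_of_int i * x) \<partial>lborel)"
      unfolding circle_measure_def using m by (subst integral_density) auto
    also have "\<dots> = (\<integral>x. (1 / (2 * pi)) *\<^sub>R (indicator {-pi..pi} x *\<^sub>R cis (real_of_int i * x)) \<partial>lborel)"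
      by (intro Bochner_Integration.integral_cong) auto
    also have "\<dots> = (1 / (2 * pi)) *\<^sub>R (\<integral>x. indicator {-pi..pi} x *\<^sub>R cis (real_of_int i * x) \<partial>lborel)"
      by (rule integral_scaleR_right)
    also have "(\<integral>x. indicator {-pi..pi} x *\<^sub>R cis (real_of_int i * x) \<partial>lborel) = F pi - F (- pi)"
      by (rule integral_FTC_atLeastAtMost) (auto intro!: D cont)
    also have "cis (real_of_int i * pi) = cis (real_of_int i * (- pi))"
      by (simp add: complex_eq_iff)
         (metis mult.commute sin_int_times_real sin_npi_int)
    then have "F pi - F (- pi) = 0" by (simp add: F_def)
    finally show ?thesis using False by simp
  qed
qed

definition step_char :: "int pmf \<Rightarrow> real \<Rightarrow> complex" where
  "step_char p x = measure_pmf.expectation p (\<lambda>j. cis (x * real_of_int j))"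

lemma step_char_eq_char: "step_char p = char (distr (measure_pmf p) borel real_of_int)"
  unfolding step_char_def char_def by (rule ext) (simp add: integral_distr cis_conv_exp)

lemma continuous_step_char: "continuous_on S (step_char p)"
proof -
  interpret real_distribution "distr (measure_pmf p) borel real_of_int"
    by (rule prob_space.real_distribution_distr[OF measure_pmf.prob_space_axioms]) simp
  show ?thesis unfolding step_char_eq_char
    by (intro continuous_at_imp_continuous_on ballI isCont_char)
qed

lemma measurable_step_char [measurable]: "step_char p \<in> borel_measurable borel"
  by (rule borel_measurable_continuous_onI[OF continuous_step_char])

lemma norm_step_char_le_1: "norm (step_char p x) \<le> 1"
proof -
  have "norm (step_char p x) \<le> measure_pmf.expectation p (\<lambda>j. norm (cis (x * real_of_int j)))"
    unfolding step_char_def by (rule integral_norm_bound)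
  then show ?thesis by simp
qed

lemma integrable_cis_step: "integrable (measure_pmf p) (\<lambda>j. cis (x * real_of_int j))"
  by (rule measure_pmf.integrable_const_bound[where B=1]) auto

text \<open>The base case is orthogonality of characters; in the induction step, convolution with
  the step law becomes multiplication by \<open>step_char\<close> after Fubini.\<close>

lemma walk_prob_fourier:
  "complex_of_real (walk_prob p n i) = (\<integral>x. cis (real_of_int (- i) * x) * step_char p x ^ n \<partial>circle_measure)"
proof (induction n arbitrary: i)
  case 0
  have "walk_prob p 0 i = (if i = 0 then 1 else 0)"
    using prob_space.prob_space[OF prob_space_path_law, of p] by (simp add: walk_prob_def)
  then show ?case using integral_circle_cis[of "- i"] by simp
next
  case (Suc n)
  interpret C: prob_space circle_measure by (rule prob_space_circle_measure)
  interpret pair_prob_space "measure_pmf p" circle_measure ..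
  have [measurable]: "(\<lambda>x. cis (a * x)) \<in> borel_measurable borel" for a :: real
    by (intro borel_measurable_continuous_onI continuous_intros)
  have le1: "norm (cis a * step_char p x ^ n) \<le> 1" for a x
    using norm_step_char_le_1[of p x] by (simp add: norm_mult norm_power power_le_one)
  have int: "integrable (measure_pmf p \<Otimes>\<^sub>M circle_measure) (case_prod (\<lambda>j x. cis (real_of_int (- (i - j)) * x) * step_char p x ^ n))"
  proof (rule integrable_const_bound[where B=1])
    show "AE z in measure_pmf p \<Otimes>\<^sub>M circle_measure. norm (case_prod (\<lambda>j x. cis (real_of_int (- (i - j)) * x) * step_char p x ^ n) z) \<le> 1"
      using le1 by (intro AE_I2) (auto simp: case_prod_beta')
    have [measurable]: "(\<lambda>z. cis (real_of_int (- (i - fst z)) * snd z)) \<in> borel_measurable (measure_pmf p \<Otimes>\<^sub>M circle_measure)"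
    proof -
      have "(\<lambda>z. (\<lambda>j z. cis (real_of_int (- (i - j)) * snd z)) (fst z) z) \<in> borel_measurable (measure_pmf p \<Otimes>\<^sub>M circle_measure)"
        by (rule measurable_compose_countable; measurable)
      then show ?thesis by simp
    qed
    show "case_prod (\<lambda>j x. cis (real_of_int (- (i - j)) * x) * step_char p x ^ n) \<in> borel_measurable (measure_pmf p \<Otimes>\<^sub>M circle_measure)"
      unfolding case_prod_beta' by measurable
  qed
  have "complex_of_real (walk_prob p (Suc n) i) = measure_pmf.expectation p (\<lambda>j. complex_of_real (walk_prob p n (i - j)))"
    by (simp add: walk_prob_Suc)
  also have "\<dots> = measure_pmf.expectation p (\<lambda>j. (\<integral>x. cis (real_of_int (- (i - j)) * x) * step_char p x ^ n \<partial>circle_measure))"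
    by (simp only: Suc)
  also have "\<dots> = (\<integral>x. measure_pmf.expectation p (\<lambda>j. cis (real_of_int (- (i - j)) * x) * step_char p x ^ n) \<partial>circle_measure)"
    by (rule Fubini_integral[OF int, symmetric])
  also have "\<dots> = (\<integral>x. cis (real_of_int (- i) * x) * step_char p x ^ Suc n \<partial>circle_measure)"
  proof (intro Bochner_Integration.integral_cong refl)
    fix x
    have "measure_pmf.expectation p (\<lambda>j. cis (real_of_int (- (i - j)) * x) * step_char p x ^ n)
      = measure_pmf.expectation p (\<lambda>j. (cis (real_of_int (- i) * x) * step_char p x ^ n) * cis (x * real_of_int j))"
      by (intro Bochner_Integration.integral_cong refl) (simp add: cis_mult[symmetric] algebra_simps cis_mult)
    also have "\<dots> = (cis (real_of_int (- i) * x) * step_char p x ^ n) * step_char p x"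
      unfolding step_char_def by (rule integral_mult_right_zero)
    finally show "measure_pmf.expectation p (\<lambda>j. cis (real_of_int (- (i - j)) * x) * step_char p x ^ n)
      = cis (real_of_int (- i) * x) * step_char p x ^ Suc n" by (simp add: algebra_simps)
  qed
  finally show ?case .
qed

text \<open>Taking the modulus erases the phase that carries \<open>i\<close>, so one majorant
  serves all sites.\<close>

lemma green_le_integral:
  assumes F: "integrable circle_measure F"
    and bound: "\<And>x. x \<in> {-pi..pi} \<Longrightarrow> norm (\<Sum>k<n. step_char p x ^ k) \<le> F x"
  shows "green p n i \<le> (\<integral>x. F x \<partial>circle_measure)"
proof -
  interpret C: prob_space circle_measure by (rule prob_space_circle_measure)
  have [measurable]: "(\<lambda>x. cis (a * x)) \<in> borel_measurable borel" for a :: real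
    by (intro borel_measurable_continuous_onI continuous_intros)
  have int: "integrable circle_measure (\<lambda>x. cis (real_of_int (- i) * x) * step_char p x ^ k)" for k
  proof (rule C.integrable_const_bound[where B=1])
    show "(\<lambda>x. cis (real_of_int (- i) * x) * step_char p x ^ k) \<in> borel_measurable circle_measure" by measurable
  qed (auto simp: norm_mult norm_power power_le_one norm_step_char_le_1)
  have "complex_of_real (green p n i) = (\<Sum>k<n. (\<integral>x. cis (real_of_int (- i) * x) * step_char p x ^ k \<partial>circle_measure))"
    by (simp add: green_def walk_prob_fourier)
  also have "\<dots> = (\<integral>x. (\<Sum>k<n. cis (real_of_int (- i) * x) * step_char p x ^ k) \<partial>circle_measure)"
    by (rule Bochner_Integration.integral_sum[symmetric]) (rule int)
  also have "\<dots> = (\<integral>x. cis (real_of_int (- i) * x) * (\<Sum>k<n. step_char p x ^ k) \<partial>circle_measure)"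
    by (simp add: sum_distrib_left)
  finally have eq: "complex_of_real (green p n i) = (\<integral>x. cis (real_of_int (- i) * x) * (\<Sum>k<n. step_char p x ^ k) \<partial>circle_measure)" .
  have "green p n i \<le> norm (complex_of_real (green p n i))" by simp
  also have "\<dots> \<le> (\<integral>x. norm (cis (real_of_int (- i) * x) * (\<Sum>k<n. step_char p x ^ k)) \<partial>circle_measure)"
    unfolding eq by (rule integral_norm_bound)
  also have "\<dots> \<le> (\<integral>x. F x \<partial>circle_measure)"
  proof (rule integral_mono_AE[OF _ F])
    have "integrable circle_measure (\<lambda>x. (\<Sum>k<n. cis (real_of_int (- i) * x) * step_char p x ^ k))"
      by (rule Bochner_Integration.integrable_sum) (rule int)
    then show "integrable circle_measure (\<lambda>x. norm (cis (real_of_int (- i) * x) * (\<Sum>k<n. step_char p x ^ k)))"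
      by (intro integrable_norm) (simp add: sum_distrib_left)
    show "AE x in circle_measure. norm (cis (real_of_int (- i) * x) * (\<Sum>k<n. step_char p x ^ k)) \<le> F x"
      using AE_circle_measure by eventually_elim (simp add: norm_mult bound)
  qed
  finally show ?thesis .
qed

text \<open>\<open>(1 - z)\<close> times the sum is \<open>1 - z ^ n\<close>, of modulus at most 2,
  and \<open>norm (1 - z) \<ge> 1 - Re z\<close>. The bound is uniform in \<open>n\<close>.\<close>

lemma norm_geometric_sum_le:
  fixes z :: complex
  assumes "norm z \<le> 1" "0 < d" "d \<le> 1 - Re z"
  shows "norm (\<Sum>k<n. z ^ k) \<le> 2 / d"
proof -
  have d: "d \<le> norm (1 - z)" using assms complex_Re_le_cmod[of "1 - z"] by simp
  have "norm (1 - z) * norm (\<Sum>k<n. z ^ k) = norm (1 - z ^ n)"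
    by (simp add: one_diff_power_eq norm_mult)
  also have "\<dots> \<le> 1 + norm (z ^ n)" using norm_triangle_ineq4[of 1 "z^n"] by simp
  also have "\<dots> \<le> 2" using assms by (simp add: norm_power power_le_one)
  finally have "norm (1 - z) * norm (\<Sum>k<n. z ^ k) \<le> 2" .
  moreover have "d * norm (\<Sum>k<n. z ^ k) \<le> norm (1 - z) * norm (\<Sum>k<n. z ^ k)" using d by (intro mult_right_mono) auto
  ultimately show ?thesis using assms by (simp add: field_simps)
qed

text \<open>Since \<open>cos u \<ge> 1/2\<close> up to \<open>pi / 3\<close>, the mean value theorem
  gives \<open>sin z \<ge> z / 2\<close>; then \<open>1 - cos y = 2 * (sin (y/2))\<^sup>2\<close>
  yields the constant 1/8.\<close>

lemma one_minus_cos_ge: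
  fixes y :: real
  assumes "\<bar>y\<bar> \<le> 1"
  shows "y\<^sup>2 / 8 \<le> 1 - cos y"
proof -
  define z where "z = \<bar>y\<bar> / 2"
  have z: "0 \<le> z" "z \<le> 1/2" using assms by (auto simp: z_def)
  have "z / 2 \<le> sin z"
  proof (cases "z = 0")
    case False
    then obtain u where u: "0 < u" "u < z" "sin z - sin 0 = (z - 0) * cos u"
      using MVT2[of 0 z sin cos] z by (auto intro: DERIV_sin)
    have "cos (pi / 3) \<le> cos u" using u z pi_gt3 by (intro cos_monotone_0_pi_le) auto
    then have "z * (1/2) \<le> z * cos u" using z by (intro mult_left_mono) (auto simp: cos_60)
    then show ?thesis using u by simp
  qed simp
  then have "(z / 2)\<^sup>2 \<le> (sin z)\<^sup>2" using z by (intro power_mono) auto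
  moreover have "cos y = 1 - 2 * (sin z)\<^sup>2"
  proof -
    have "cos y = cos (2 * z)" by (simp add: z_def)
    then show ?thesis by (simp only: cos_double_sin)
  qed
  ultimately show ?thesis by (simp add: z_def power2_eq_square)
qed

lemma Re_step_char: "Re (step_char p x) = measure_pmf.expectation p (\<lambda>j. cos (x * real_of_int j))"
  unfolding step_char_def by (subst integral_Re[symmetric, OF integrable_cis_step]) simp

text \<open>Jumps beyond \<open>2 ^ k\<close> are dropped because \<open>1 - cos\<close> is
  nonnegative; for the others \<open>\<bar>x * j\<bar> \<le> 1\<close>, so the quadratic bound
  applies.\<close>

lemma step_char_near_zero:
  assumes x: "\<bar>x\<bar> \<le> 1 / 2 ^ k"
  shows "x\<^sup>2 / 8 * measure_pmf.expectation p (\<lambda>j. if \<bar>j\<bar> \<le> 2 ^ k then (real_of_int j)\<^sup>2 else 0) \<le> 1 - Re (step_char p x)"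
proof -
  have ic: "integrable p (\<lambda>j. cos (x * real_of_int j))"
    by (rule integrable_truncated[where B=1]) auto
  have iv: "integrable p (\<lambda>j. if \<bar>j\<bar> \<le> 2 ^ k then (real_of_int j)\<^sup>2 else 0)"
    by (rule integrable_truncated[where B="4^k"]) (use int_sq_le in auto)
  have "x\<^sup>2 / 8 * measure_pmf.expectation p (\<lambda>j. if \<bar>j\<bar> \<le> 2 ^ k then (real_of_int j)\<^sup>2 else 0)
    = measure_pmf.expectation p (\<lambda>j. x\<^sup>2 / 8 * (if \<bar>j\<bar> \<le> 2 ^ k then (real_of_int j)\<^sup>2 else 0))"
    using iv by simp
  also have "\<dots> \<le> measure_pmf.expectation p (\<lambda>j. 1 - cos (x * real_of_int j))"
  proof (rule integral_mono)
    fix j :: int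
    show "x\<^sup>2 / 8 * (if \<bar>j\<bar> \<le> 2 ^ k then (real_of_int j)\<^sup>2 else 0) \<le> 1 - cos (x * real_of_int j)"
    proof (cases "\<bar>j\<bar> \<le> 2 ^ k")
      case True
      then have "real_of_int \<bar>j\<bar> \<le> real_of_int (2 ^ k)" by (simp only: of_int_le_iff)
      then have "\<bar>x\<bar> * \<bar>real_of_int j\<bar> \<le> 1 / 2 ^ k * 2 ^ k" using x by (intro mult_mono) auto
      then have "\<bar>x * real_of_int j\<bar> \<le> 1" by (simp add: abs_mult)
      from one_minus_cos_ge[OF this] True show ?thesis by (simp add: power_mult_distrib)
    qed simp
  qed (use ic iv in auto)
  also have "\<dots> = 1 - Re (step_char p x)" using ic by (simp add: Re_step_char)
  finally show ?thesis .
qed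

text \<open>Real part 1 together with modulus at most 1 forces the value 1, which
  \<open>charfun\<close> allows only on the lattice of multiples of \<open>2 * pi\<close>.
  Compactness then makes the gap uniform.\<close>

lemma step_char_away_from_zero:
  assumes charfun: "\<And>t::real. step_char p t = 1 \<longleftrightarrow> (\<exists>m::int. t = 2 * pi * real_of_int m)"
    and r: "0 < r"
  obtains d where "0 < d" "\<And>x. r \<le> \<bar>x\<bar> \<Longrightarrow> \<bar>x\<bar> \<le> pi \<Longrightarrow> d \<le> 1 - Re (step_char p x)"
proof -
  let ?K = "{-pi..-r} \<union> {r..pi}"
  have pos: "0 < 1 - Re (step_char p x)" if "r \<le> \<bar>x\<bar>" "\<bar>x\<bar> \<le> pi" for x
  proof (rule ccontr)
    assume "\<not> 0 < 1 - Re (step_char p x)"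
    then have "Re (step_char p x) \<ge> 1" by simp
    moreover have "norm (step_char p x) \<le> 1" by (rule norm_step_char_le_1)
    ultimately have "Re (step_char p x) = 1" "norm (step_char p x) = 1"
      using complex_Re_le_cmod[of "step_char p x"] by linarith+
    then have "step_char p x = 1" by (auto simp: complex_eq_iff cmod_def)
    then obtain m :: int where m: "x = 2 * pi * real_of_int m" using charfun by blast
    show False
    proof (cases "m = 0")
      case True
      then show False using m that r by simp
    next
      case False
      then have "1 \<le> \<bar>real_of_int m\<bar>" by linarith
      then have "2 * pi * 1 \<le> 2 * pi * \<bar>real_of_int m\<bar>" by (intro mult_left_mono) auto
      then show False using m that pi_gt_zero by (simp add: abs_mult)
    qed
  qed
  show ?thesis
  proof (cases "r \<le> pi")
    case True
    have "\<exists>x\<in>?K. \<forall>y\<in>?K. 1 - Re (step_char p x) \<le> 1 - Re (step_char p y)"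
      using True by (intro continuous_attains_inf continuous_intros continuous_step_char) auto
    then obtain x where x: "x \<in> ?K" "\<And>y. y \<in> ?K \<Longrightarrow> 1 - Re (step_char p x) \<le> 1 - Re (step_char p y)" by blast
    show ?thesis
    proof (rule that[of "1 - Re (step_char p x)"])
      show "0 < 1 - Re (step_char p x)" using x(1) r by (intro pos) auto
      fix y assume "r \<le> \<bar>y\<bar>" "\<bar>y\<bar> \<le> pi"
      then show "1 - Re (step_char p x) \<le> 1 - Re (step_char p y)" by (intro x(2)) auto
    qed
  next
    case False
    then show ?thesis by (intro that[of 1]) auto
  qed
qed

lemma dyadic_bracket:
  fixes y :: real
  assumes "1 / 2 ^ k < y" "y \<le> 1 / 2 ^ m"
  shows "\<exists>j\<in>{m..<k}. 1 / 2 ^ Suc j < y \<and> y \<le> 1 / 2 ^ j"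
proof -
  define j where "j = (LEAST j. 1 / 2 ^ Suc j < y)"
  have "(1::real) / 2 ^ m \<le> 1" by simp
  moreover have "1 < y" if "k = 0" using assms(1) that by simp
  ultimately have "0 < k" using assms(2) by linarith
  then have ex: "1 / 2 ^ Suc (k - 1) < y" using assms by simp
  have j1: "1 / 2 ^ Suc j < y" unfolding j_def by (rule LeastI[of _ "k-1"]) (rule ex)
  have "j \<le> k - 1" unfolding j_def by (rule Least_le) (rule ex)
  have jm: "m \<le> j"
  proof (rule ccontr)
    assume "\<not> m \<le> j"
    then have "(1::real) / 2 ^ m \<le> 1 / 2 ^ Suc j" by (intro divide_left_mono power_increasing) auto
    then show False using j1 assms by linarith
  qed
  have "y \<le> 1 / 2 ^ j"
  proof (cases "j = 0")
    case True
    then show ?thesis using assms jm by simp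
  next
    case False
    then have "\<not> 1 / 2 ^ Suc (j - 1) < y" using not_less_Least[of "j - 1" "\<lambda>j. 1 / 2 ^ Suc j < y"] by (simp add: j_def)
    then show ?thesis using False by simp
  qed
  then show ?thesis using j1 jm \<open>j \<le> k - 1\<close> \<open>0 < k\<close> by (intro bexI[of _ j]) auto
qed

text \<open>Three frequency ranges. For \<open>\<bar>x\<bar> \<le> 1 / 2 ^ k\<close> the trivial
  bound \<open>n\<close> costs \<open>n / 2 ^ k\<close>; the shell at \<open>1 / 2 ^ j\<close> costs
  a multiple of \<open>2 ^ j / W j\<close>; frequencies bounded away from 0 cost a constant. As
  \<open>q < 2\<close>, the shell costs grow geometrically and the last one dominates.\<close>

lemma green_upper_bound:
  assumes charfun: "\<And>t::real. step_char p t = 1 \<longleftrightarrow> (\<exists>m::int. t = 2 * pi * real_of_int m)"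
    and q: "1 < q" "q < 2" and c: "0 < c"
    and W: "\<And>k. m \<le> k \<Longrightarrow> 0 < W k \<and> W (Suc k) \<le> q * W k"
    and var: "\<And>k. m \<le> k \<Longrightarrow> c * W k \<le> measure_pmf.expectation p (\<lambda>j. if \<bar>j\<bar> \<le> 2 ^ k then (real_of_int j)\<^sup>2 else 0)"
  obtains C where "0 < C" "\<And>k n i. m \<le> k \<Longrightarrow> green p n i \<le> real n / 2 ^ k + C * (2 ^ k / W k)"
proof -
  interpret C: prob_space circle_measure by (rule prob_space_circle_measure)
  obtain d where d: "0 < d" "\<And>x. 1 / 2 ^ m \<le> \<bar>x\<bar> \<Longrightarrow> \<bar>x\<bar> \<le> pi \<Longrightarrow> d \<le> 1 - Re (step_char p x)"
    using step_char_away_from_zero[OF charfun, of "1 / 2 ^ m"] by auto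
  \<comment> \<open>On shell \<open>j\<close> one has
    \<open>x\<^sup>2 \<ge> 1 / (4 * 4 ^ j)\<close>, so \<open>step_char_near_zero\<close> gives a
    gap of at least \<open>c * W j / (32 * 4 ^ j) = 2 / B j\<close>, and the geometric sum is at
    most \<open>B j\<close>.\<close>
  define B where "B j = 64 * 4 ^ j / (c * W j)" for j
  have Bpos: "0 < B j" if "m \<le> j" for j using W[OF that] c by (simp add: B_def)
  let ?a = "\<lambda>k. 2 ^ k / W k"
  have grow: "2 / q * ?a j \<le> ?a (Suc j)" if "m \<le> j" for j
  proof -
    have "2 * 2 ^ j / (q * W j) \<le> 2 * 2 ^ j / W (Suc j)"
      using W[OF that] W[of "Suc j"] that q by (intro divide_left_mono) auto
    then show ?thesis by simp
  qed
  have mono: "?a m \<le> ?a k" if "m \<le> k" for k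
    using that
  proof (induction k rule: dec_induct)
    case (step k)
    have "1 * ?a k \<le> 2 / q * ?a k" using q W[of k] step by (intro mult_right_mono) auto
    then show ?case using grow[of k] step by simp
  qed simp
  \<comment> \<open>The first summand is the geometric sum over shells; the second absorbs the
    constant \<open>2 / d\<close>, using that \<open>2 ^ k / W k\<close> is at least its value at
    \<open>m\<close>.\<close>
  define C1 where "C1 = 64 / c / (2 / q - 1) + 2 / d / ?a m"
  have am: "0 < ?a m" using W[of m] by simp
  have C1: "0 < C1"
    unfolding C1_def using q c d am W[of m] by (intro add_pos_pos divide_pos_pos) auto
  have "green p n i \<le> real n / 2 ^ k + C1 * ?a k" if k: "m \<le> k" for k n i
  proof -
    let ?S = "\<lambda>j::nat. {- (1 / 2 ^ j) .. 1 / 2 ^ j :: real}"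
    define F where "F x = real n * indicator (?S k) x + (\<Sum>j=m..<k. B j * indicator (?S j) x) + 2 / d" for x
    have iF: "integrable circle_measure (\<lambda>x. b * indicator (?S j) x)" for b :: real and j
      by (rule C.integrable_const_bound[where B="\<bar>b\<bar>"]) (auto simp: indicator_def)
    have intF: "integrable circle_measure F"
      unfolding F_def by (intro Bochner_Integration.integrable_add Bochner_Integration.integrable_sum iF) auto
    have isum: "integrable circle_measure (\<lambda>x. \<Sum>j=m..<k. B j * indicator (?S j) x)"
      by (intro Bochner_Integration.integrable_sum iF)
    have "(\<integral>x. F x \<partial>circle_measure) = (\<integral>x. real n * indicator (?S k) x + (\<Sum>j=m..<k. B j * indicator (?S j) x) \<partial>circle_measure) + (\<integral>x. 2 / d \<partial>circle_measure)"
      unfolding F_def by (rule Bochner_Integration.integral_add) (intro Bochner_Integration.integrable_add iF isum, simp)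
    also have "(\<integral>x. real n * indicator (?S k) x + (\<Sum>j=m..<k. B j * indicator (?S j) x) \<partial>circle_measure)
      = (\<integral>x. real n * indicator (?S k) x \<partial>circle_measure) + (\<integral>x. (\<Sum>j=m..<k. B j * indicator (?S j) x) \<partial>circle_measure)"
      by (rule Bochner_Integration.integral_add) (intro iF isum)+
    also have "(\<integral>x. (\<Sum>j=m..<k. B j * indicator (?S j) x) \<partial>circle_measure) = (\<Sum>j=m..<k. (\<integral>x. B j * indicator (?S j) x \<partial>circle_measure))"
      by (rule Bochner_Integration.integral_sum) (rule iF)
    finally have intF_eq: "(\<integral>x. F x \<partial>circle_measure) = real n * measure circle_measure (?S k) + (\<Sum>j=m..<k. B j * measure circle_measure (?S j)) + 2 / d"
      using C.prob_space by simp
    have sumnn: "0 \<le> (\<Sum>j=m..<k. B j * indicator (?S j) x)" for x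
      using Bpos by (intro sum_nonneg) (auto simp: less_imp_le)
    have "green p n i \<le> (\<integral>x. F x \<partial>circle_measure)"
    proof (rule green_le_integral[OF intF])
      fix x assume x: "x \<in> {-pi..pi}"
      let ?z = "norm (\<Sum>k<n. step_char p x ^ k)"
      consider "\<bar>x\<bar> \<le> 1 / 2 ^ k" | "1 / 2 ^ k < \<bar>x\<bar>" "\<bar>x\<bar> \<le> 1 / 2 ^ m" | "1 / 2 ^ m < \<bar>x\<bar>" by linarith
      then show "?z \<le> F x"
      proof cases
        case 1
        have "?z \<le> (\<Sum>k<n. norm (step_char p x ^ k))" by (rule norm_sum)
        also have "\<dots> \<le> (\<Sum>k<n. 1)" by (intro sum_mono) (simp add: norm_power power_le_one norm_step_char_le_1)
        finally have "?z \<le> real n" by simp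
        moreover have "real n * indicator (?S k) x = real n" using 1 by (auto simp: indicator_def)
        moreover have "0 \<le> 2 / d" using d by simp
        ultimately show ?thesis using sumnn[of x] unfolding F_def by linarith
      next
        case 2
        then obtain j where j: "j \<in> {m..<k}" "1 / 2 ^ Suc j < \<bar>x\<bar>" "\<bar>x\<bar> \<le> 1 / 2 ^ j"
          using dyadic_bracket[of k "\<bar>x\<bar>" m] by auto
        have "(1 / 2 ^ Suc j)\<^sup>2 \<le> \<bar>x\<bar>\<^sup>2" using j by (intro power_mono) auto
        moreover have "((1::real) / 2 ^ Suc j)\<^sup>2 = 1 / 4 / 4 ^ j"
          by (simp add: power2_eq_square power_mult_distrib[symmetric] field_simps)
        ultimately have x2: "1 / 4 / 4 ^ j \<le> x\<^sup>2" by simp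
        have "2 / B j = (1 / 4 / 4 ^ j) / 8 * (c * W j)" by (simp add: B_def)
        also have "\<dots> \<le> x\<^sup>2 / 8 * (c * W j)" using x2 W[of j] j c by (intro mult_right_mono divide_right_mono) auto
        also have "\<dots> \<le> x\<^sup>2 / 8 * measure_pmf.expectation p (\<lambda>i. if \<bar>i\<bar> \<le> 2 ^ j then (real_of_int i)\<^sup>2 else 0)"
          using var[of j] j by (intro mult_left_mono) auto
        also have "\<dots> \<le> 1 - Re (step_char p x)" by (rule step_char_near_zero) (rule j)
        finally have "?z \<le> 2 / (2 / B j)" using Bpos[of j] j by (intro norm_geometric_sum_le norm_step_char_le_1) auto
        then have "?z \<le> B j * indicator (?S j) x" using j by (auto simp: indicator_def)
        also have "\<dots> \<le> (\<Sum>j=m..<k. B j * indicator (?S j) x)"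
          using j Bpos by (intro member_le_sum) (auto simp: less_imp_le)
        also have "\<dots> \<le> F x" using d unfolding F_def by (intro add_increasing2 add_increasing order_refl) auto
        finally show ?thesis .
      next
        case 3
        then have "?z \<le> 2 / d" using d x by (intro norm_geometric_sum_le norm_step_char_le_1) auto
        then show ?thesis using sumnn[of x] unfolding F_def by (intro add_increasing add_nonneg_nonneg) auto
      qed
    qed
    also have "\<dots> = real n * measure circle_measure (?S k) + (\<Sum>j=m..<k. B j * measure circle_measure (?S j)) + 2 / d"
      by (rule intF_eq)
    also have "\<dots> \<le> real n * (1 / 2 ^ k) + (\<Sum>j=m..<k. B j * (1 / 2 ^ j)) + 2 / d"
      using Bpos by (intro add_mono sum_mono mult_left_mono measure_circle_interval) (auto simp: less_imp_le)
    also have "(\<Sum>j=m..<k. B j * (1 / 2 ^ j)) = 64 / c * (\<Sum>j=m..<k. ?a j)"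
      unfolding sum_distrib_left
    proof (intro sum.cong refl)
      fix j assume "j \<in> {m..<k}"
      have "(4::real) ^ j = 2 ^ j * 2 ^ j" by (simp flip: power_mult_distrib)
      then show "B j * (1 / 2 ^ j) = 64 / c * ?a j" by (simp add: B_def)
    qed
    also have "\<dots> \<le> 64 / c * (?a k / (2 / q - 1))"
      using q c k am grow by (intro mult_left_mono geometric_sum_le_last) auto
    also have "2 / d \<le> 2 / d / ?a m * ?a k"
    proof -
      have "2 / d / ?a m * ?a m \<le> 2 / d / ?a m * ?a k" using mono[OF k] d(1) am by (intro mult_left_mono divide_nonneg_nonneg[of "2 / d"]) (simp_all only: less_imp_le, simp)
      then show ?thesis using am W[of m] by simp
    qed
    finally show ?thesis by (simp add: C1_def algebra_simps)
  qed
  then show ?thesis using C1 by (intro that[of C1]) auto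
qed

section \<open>Favourite sites of the walk\<close>

text \<open>For jumps up to \<open>2 ^ k\<close> the square is expanded; larger jumps are paid by
  the cap \<open>4 ^ k\<close> in \<open>?v\<close>. The cross term is at most \<open>2 * D\<close>
  since \<open>\<bar>y\<bar> < 2 ^ k\<close> while the truncated mean is at most
  \<open>D / 2 ^ k\<close>; the quadratic term adds \<open>D\<close>.\<close>

lemma clipped_drift_bound:
  assumes C: "measure_pmf.expectation p (\<lambda>j. min ((real_of_int j)\<^sup>2) (4 ^ k)) \<le> D"
    "\<bar>measure_pmf.expectation p (\<lambda>j. if \<bar>j\<bar> \<le> 2 ^ k then real_of_int j else 0)\<bar> \<le> D / 2 ^ k"
    and y: "\<bar>y\<bar> < 2 ^ k"
  shows "measure_pmf.expectation p (\<lambda>j. min ((real_of_int (y + j))\<^sup>2) (4 ^ k)) \<le> (real_of_int y)\<^sup>2 + 3 * D"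
proof -
  let ?t = "\<lambda>j::int. if \<bar>j\<bar> \<le> 2 ^ k then real_of_int j else 0"
  let ?v = "\<lambda>j::int. min ((real_of_int j)\<^sup>2) (4 ^ k)"
  have it: "integrable p ?t"
  proof (rule integrable_truncated[where B="2^k"])
    fix j :: int
    show "\<bar>?t j\<bar> \<le> 2 ^ k"
    proof (cases "\<bar>j\<bar> \<le> 2 ^ k")
      case True
      then have "real_of_int \<bar>j\<bar> \<le> real_of_int (2 ^ k)" by (simp only: of_int_le_iff)
      then show ?thesis using True by simp
    qed simp
  qed
  have iv: "integrable p ?v" by (rule integrable_truncated[where B="4^k"]) auto
  have "measure_pmf.expectation p (\<lambda>j. min ((real_of_int (y + j))\<^sup>2) (4 ^ k))
    \<le> measure_pmf.expectation p (\<lambda>j. (real_of_int y)\<^sup>2 + 2 * real_of_int y * ?t j + ?v j)"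
  proof (rule integral_mono)
    show "integrable p (\<lambda>j. min ((real_of_int (y + j))\<^sup>2) (4 ^ k))" by (rule integrable_truncated[where B="4^k"]) auto
    show "integrable p (\<lambda>j. (real_of_int y)\<^sup>2 + 2 * real_of_int y * ?t j + ?v j)"
      using it iv by (intro Bochner_Integration.integrable_add integrable_mult_right) auto
    fix j :: int
    show "min ((real_of_int (y + j))\<^sup>2) (4 ^ k) \<le> (real_of_int y)\<^sup>2 + 2 * real_of_int y * ?t j + ?v j"
    proof (cases "\<bar>j\<bar> \<le> 2 ^ k")
      case True
      then have "?v j = (real_of_int j)\<^sup>2" using int_sq_le[of j k] by simp
      then show ?thesis using True by (simp add: power2_eq_square algebra_simps)
    next
      case False
      then have "?v j = 4 ^ k" using int_sq_ge[of k j] by simp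
      then show ?thesis using False by (simp add: min.coboundedI2 add_increasing)
    qed
  qed
  also have "\<dots> = (real_of_int y)\<^sup>2 + 2 * real_of_int y * measure_pmf.expectation p ?t + measure_pmf.expectation p ?v"
    using it iv by simp
  also have "\<dots> \<le> (real_of_int y)\<^sup>2 + 2 * D + D"
  proof (intro add_mono order_refl C(1))
    have "real_of_int \<bar>y\<bar> \<le> real_of_int (2 ^ k)" using y by (simp only: of_int_le_iff less_imp_le)
    then have "\<bar>real_of_int y\<bar> * \<bar>measure_pmf.expectation p ?t\<bar> \<le> 2 ^ k * (D / 2 ^ k)"
      using C(2) by (intro mult_mono) auto
    then have "\<bar>real_of_int y * measure_pmf.expectation p ?t\<bar> \<le> D" by (simp add: abs_mult)
    then show "2 * real_of_int y * measure_pmf.expectation p ?t \<le> 2 * D" by (simp add: abs_le_iff)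
  qed
  finally show ?thesis by simp
qed

lemma sum_walk_prob:
  assumes "finite A"
  shows "(\<Sum>j\<in>A. walk_prob p n j) = measure (path_law p) {\<omega>. walk \<omega> n \<in> A}"
proof -
  interpret S: prob_space "path_law p" by (rule prob_space_path_law)
  have "measure (path_law p) (\<Union>j\<in>A. {\<omega>. walk \<omega> n = j}) = (\<Sum>j\<in>A. measure (path_law p) {\<omega>. walk \<omega> n = j})"
    using assms by (intro S.finite_measure_finite_Union) (auto simp: disjoint_family_on_def)
  moreover have "(\<Union>j\<in>A. {\<omega>. walk \<omega> n = j}) = {\<omega>. walk \<omega> n \<in> A}" by auto
  ultimately show ?thesis by (simp add: walk_prob_def)
qed

text \<open>At each time before \<open>n\<close> the walk is in \<open>A\<close> with probability at
  least 1/2.\<close>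

lemma sum_green_ge:
  assumes A: "finite A" and exit: "measure (path_law p) {\<omega>. \<exists>l\<le>n. walk \<omega> l \<notin> A} \<le> 1 / 2"
  shows "real n / 2 \<le> (\<Sum>j\<in>A. green p n j)"
proof -
  interpret S: prob_space "path_law p" by (rule prob_space_path_law)
  have m: "Measurable.pred (path_law p) (\<lambda>\<omega>. walk \<omega> l \<in> A)" for l
    by (rule measurable_compose[OF measurable_walk]) simp
  have "Measurable.pred (path_law p) (\<lambda>\<omega>. \<exists>l\<le>n. walk \<omega> l \<notin> A)" using m by measurable
  then have ev: "{\<omega>. \<exists>l\<le>n. walk \<omega> l \<notin> A} \<in> sets (path_law p)" by (simp add: pred_def)
  have "1 / 2 \<le> (\<Sum>j\<in>A. walk_prob p l j)" if "l < n" for l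
  proof -
    have ml: "{\<omega>. walk \<omega> l \<in> A} \<in> sets (path_law p)" using m[of l] by (simp add: pred_def)
    have "measure (path_law p) (UNIV - {\<omega>. walk \<omega> l \<in> A}) \<le> measure (path_law p) {\<omega>. \<exists>l\<le>n. walk \<omega> l \<notin> A}"
      using that ev by (intro S.finite_measure_mono) (auto intro!: exI[of _ l])
    moreover have "measure (path_law p) (UNIV - {\<omega>. walk \<omega> l \<in> A}) = 1 - measure (path_law p) {\<omega>. walk \<omega> l \<in> A}"
      using S.prob_compl[OF ml] by simp
    ultimately show ?thesis using exit A by (simp add: sum_walk_prob)
  qed
  then have "(\<Sum>l<n. 1 / 2) \<le> (\<Sum>l<n. \<Sum>j\<in>A. walk_prob p l j)" by (intro sum_mono) auto
  also have "\<dots> = (\<Sum>j\<in>A. green p n j)" unfolding green_def by (rule sum.swap)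
  finally show ?thesis by simp
qed

text \<open>Pigeonhole: at least \<open>n k / 2\<close> expected visits fall into a ball, sites
  below the level \<open>c * g k\<close> take at most \<open>n k / 4\<close> of them, and no site
  takes more than \<open>g k\<close>. Hence at least \<open>n k / (4 * g k)\<close> sites lie above
  that level, a fixed multiple of \<open>2 ^ k\<close>.\<close>

lemma favourite_sites:
  assumes int: "integrable (measure_pmf p) real_of_int"
    and mean: "measure_pmf.expectation p real_of_int = 0"
    and charfun: "\<And>t::real. step_char p t = 1 \<longleftrightarrow> (\<exists>m::int. t = 2 * pi * real_of_int m)"
    and q: "1 < q" "q < 2"
    and tail: "\<And>k. m0 \<le> k \<Longrightarrow> 0 < big_jump_prob p k \<and> 4 * big_jump_prob p (Suc k) \<le> q * big_jump_prob p k"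
  obtains c c' :: real and r m :: nat and n :: "nat \<Rightarrow> nat" and g :: "nat \<Rightarrow> real" and S :: "nat \<Rightarrow> int set"
  where "0 < c" "0 < c'" "filterlim g at_top sequentially"
    "\<And>k j. m \<le> k \<Longrightarrow> green p (n k) j \<le> g k" "\<And>k. m \<le> k \<Longrightarrow> 0 < g k"
    "\<And>k. m \<le> k \<Longrightarrow> S k \<subseteq> {j. \<bar>j\<bar> < 2 ^ (k + r)}"
    "\<And>k. m \<le> k \<Longrightarrow> c' * 2 ^ k \<le> real (card (S k))"
    "\<And>k i. m \<le> k \<Longrightarrow> i \<in> S k \<Longrightarrow> c * g k \<le> green p (n k) i"
    "\<And>k. m \<le> k \<Longrightarrow> measure (path_law p) {\<omega>. \<exists>l\<le>n k. walk \<omega> l \<notin> {j. \<bar>j\<bar> < 2 ^ (k + r)}} \<le> c\<^sup>2 / 128"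
proof -
  obtain W C b m1 where C: "0 < C" and b: "0 < b"
    and W: "\<And>k. m1 \<le> k \<Longrightarrow> 0 < W k \<and> W k \<le> W (Suc k) \<and> W (Suc k) \<le> q * W k"
    and V: "\<And>k. m1 \<le> k \<Longrightarrow> measure_pmf.expectation p (\<lambda>j. min ((real_of_int j)\<^sup>2) (4 ^ k)) \<le> C * W k"
    and E: "\<And>k. m1 \<le> k \<Longrightarrow> \<bar>measure_pmf.expectation p (\<lambda>j. if \<bar>j\<bar> \<le> 2 ^ k then real_of_int j else 0)\<bar> \<le> C * W k / 2 ^ k"
    and U: "\<And>k. m1 \<le> k \<Longrightarrow> b * W k \<le> measure_pmf.expectation p (\<lambda>j. if \<bar>j\<bar> \<le> 2 ^ k then (real_of_int j)\<^sup>2 else 0)"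
  proof (rule dyadic_variance_scale[OF int mean q, where m=m0])
    show "0 < big_jump_prob p k \<and> 4 * big_jump_prob p (Suc k) \<le> q * big_jump_prob p k" if "m0 \<le> k" for k
      using that by (rule tail)
  qed (rule that)
  obtain C' where C': "0 < C'" and green: "\<And>k n i. m1 \<le> k \<Longrightarrow> green p n i \<le> real n / 2 ^ k + C' * (2 ^ k / W k)"
  proof (rule green_upper_bound[OF charfun q b, where m=m1 and W=W])
    show "0 < W k \<and> W (Suc k) \<le> q * W k" if "m1 \<le> k" for k using W[OF that] by simp
    show "b * W k \<le> measure_pmf.expectation p (\<lambda>j. if \<bar>j\<bar> \<le> 2 ^ k then (real_of_int j)\<^sup>2 else 0)" if "m1 \<le> k" for k
      using that by (rule U)
  qed (rule that)
  let ?a = "\<lambda>k. 2 ^ k / W k"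
  have Wpos: "0 < W k" if "m1 \<le> k" for k using W[OF that] by simp
  have Wpow: "W (k + r) \<le> q ^ r * W k" if "m1 \<le> k" for k r
  proof (induction r)
    case (Suc r)
    have "W (k + Suc r) \<le> q * W (k + r)" using W[of "k + r"] that by simp
    also have "\<dots> \<le> q * (q ^ r * W k)" using Suc q by (intro mult_left_mono) auto
    finally show ?case by (simp add: mult.assoc)
  qed simp
  \<comment> \<open>The visit scale grows at least like \<open>(2 / q) ^ r\<close>; this recurrence
    effect later sends the observation times to infinity.\<close>
  have agrow: "(2 / q) ^ r * ?a m1 \<le> ?a (m1 + r)" for r
  proof -
    have "2 ^ (m1 + r) / (q ^ r * W m1) \<le> ?a (m1 + r)"
      using Wpow[of m1 r] Wpos[of m1] Wpos[of "m1 + r"] q by (intro divide_left_mono) auto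
    moreover have "2 ^ (m1 + r) / (q ^ r * W m1) = (2 / q) ^ r * ?a m1" by (simp add: power_add power_divide)
    ultimately show ?thesis by simp
  qed
  have alim: "filterlim ?a at_top sequentially"
  proof -
    have "filterlim (\<lambda>r. (2 / q) ^ r) at_top sequentially"
      using q by (intro filterlim_at_infinity_imp_filterlim_at_top filterlim_realpow_sequentially_gt1) (auto intro!: always_eventually)
    then have "filterlim (\<lambda>r. ?a m1 * (2 / q) ^ r) at_top sequentially"
      using Wpos[of m1] by (intro filterlim_tendsto_pos_mult_at_top[OF tendsto_const]) auto
    then have "filterlim (\<lambda>r. ?a (r + m1)) at_top sequentially"
      by (rule filterlim_at_top_mono) (use agrow in \<open>auto simp: mult.commute add.commute\<close>)
    then have "eventually (\<lambda>r. Z \<le> ?a (r + m1)) sequentially" for Z by (simp add: filterlim_at_top)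
    then have "eventually (\<lambda>r. Z \<le> ?a r) sequentially" for Z by (subst eventually_sequentially_seg[where k=m1, symmetric])
    then show ?thesis by (simp add: filterlim_at_top)
  qed
  then have "eventually (\<lambda>k. 1 \<le> ?a k) sequentially" by (simp add: filterlim_at_top)
  then obtain m2 where m2: "\<And>k. m2 \<le> k \<Longrightarrow> 1 \<le> ?a k" by (auto simp: eventually_sequentially)
  define m where "m = max m1 m2"
  \<comment> \<open>The number of steps in which the variance truncated at \<open>2 ^ k\<close> adds
    up to \<open>4 ^ k\<close>, that is, the time to spread over distance
    \<open>2 ^ k\<close>.\<close>
  define n where "n k = nat \<lceil>4 ^ k / W k\<rceil>" for k
  have pow4: "(4::real) ^ k = 2 ^ k * 2 ^ k" for k by (simp flip: power_mult_distrib)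
  have n_ge: "4 ^ k / W k \<le> real (n k)" for k unfolding n_def by linarith
  have n_le: "real (n k) \<le> 2 * (4 ^ k / W k)" if "m \<le> k" for k
  proof -
    have "1 \<le> ?a k" using m2 that by (simp add: m_def)
    then have "1 * 1 \<le> 2 ^ k * ?a k" by (intro mult_mono) auto
    then have "1 \<le> 4 ^ k / W k" by (simp add: pow4)
    moreover have "real (n k) \<le> 4 ^ k / W k + 1" using calculation unfolding n_def by linarith
    ultimately show ?thesis by linarith
  qed
  \<comment> \<open>The 6 is 2 from rounding up \<open>n k\<close> times 3 from the drift bound.
    Each doubling of the radius raises the variance by at most \<open>q\<close> and the squared
    radius by 4.\<close>
  have exit: "measure (path_law p) {\<omega>. \<exists>l\<le>n k. walk \<omega> l \<notin> {j. \<bar>j\<bar> < 2 ^ (k + r)}} \<le> 6 * C * (q / 4) ^ r"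
    if k: "m \<le> k" for k r
  proof -
    have k1: "m1 \<le> k" "m1 \<le> k + r" using k by (auto simp: m_def)
    let ?D = "3 * (C * W (k + r))"
    have "measure (path_law p) {\<omega>. \<exists>l\<le>n k. 2 ^ (k + r) \<le> \<bar>0 + walk \<omega> l\<bar>} \<le> ((real_of_int 0)\<^sup>2 + real (n k) * ?D) / 4 ^ (k + r)"
      using C Wpos[OF k1(2)] V[OF k1(2)] E[OF k1(2)]
      by (intro exit_probability_bound clipped_drift_bound) auto
    also have "\<dots> \<le> (2 * (4 ^ k / W k) * (3 * (C * (q ^ r * W k)))) / 4 ^ (k + r)"
    proof -
      have "real (n k) * ?D \<le> 2 * (4 ^ k / W k) * (3 * (C * (q ^ r * W k)))"
        using n_le[OF k] Wpow[OF k1(1), of r] C Wpos[OF k1(1)] Wpos[OF k1(2)] by (intro mult_mono) auto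
      then show ?thesis by (intro divide_right_mono) auto
    qed
    also have "\<dots> = 6 * C * (q / 4) ^ r"
      using Wpos[OF k1(1)] by (simp add: power_add power_divide)
    finally show ?thesis by (simp add: not_less)
  qed
  have "(\<lambda>r. 6 * C * (q / 4) ^ r) \<longlonglongrightarrow> 6 * C * 0"
    using q by (intro tendsto_mult_left LIMSEQ_realpow_zero) auto
  then have small: "\<exists>N. \<forall>r\<ge>N. 6 * C * (q / 4) ^ r < e" if "0 < e" for e
    using order_tendstoD(2)[of "\<lambda>r. 6 * C * (q / 4) ^ r" 0 sequentially e] that by (simp add: eventually_sequentially)
  obtain r0 where r0: "6 * C * (q / 4) ^ r0 < 1 / 2" using small[of "1/2"] by auto
  \<comment> \<open>so that the sites outside \<open>S k\<close> carry at most a quarter of all \<open>n k\<close> visits\<close>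
  define c where "c = 1 / (8 * 2 ^ r0 * (1 + C'))"
  have c: "0 < c" using C' by (simp add: c_def)
  obtain N where N: "\<And>r. N \<le> r \<Longrightarrow> 6 * C * (q / 4) ^ r < c\<^sup>2 / 128" using small[of "c\<^sup>2 / 128"] c by auto
  \<comment> \<open>Two radii avoid a circular choice: \<open>r0\<close> only makes the exit
    probability at most 1/2 and fixes \<open>c\<close>; afterwards \<open>r\<close> is enlarged
    until the exit probability is at most \<open>c\<^sup>2 / 128\<close>.\<close>
  define r where "r = max N r0"
  define g where "g k = (1 + C') * real (n k) / 2 ^ k" for k
  have a_le: "?a k \<le> real (n k) / 2 ^ k" for k
  proof -
    have "?a k = (4 ^ k / W k) / 2 ^ k" by (simp add: pow4)
    then show ?thesis using n_ge[of k] by (metis divide_right_mono zero_le_numeral zero_le_power)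
  qed
  have g_ge: "?a k \<le> g k" for k
  proof -
    have "real (n k) / 2 ^ k \<le> g k" using C' by (auto simp: g_def algebra_simps intro!: divide_right_mono)
    then show ?thesis using a_le[of k] by linarith
  qed
  define S where "S k = {j. \<bar>j\<bar> < 2 ^ (k + r0) \<and> c * g k \<le> green p (n k) j}" for k
  show ?thesis
  proof (rule that[of c "1 / (4 * (1 + C'))" g m n S r])
    show "0 < c" by (rule c)
    show "0 < 1 / (4 * (1 + C'))" using C' by simp
    show "filterlim g at_top sequentially"
      by (rule filterlim_at_top_mono[OF alim]) (use g_ge in auto)
    fix k assume k: "m \<le> k"
    then have k1: "m1 \<le> k" by (simp add: m_def)
    show gr: "green p (n k) j \<le> g k" for j
    proof -
      have "C' * ?a k \<le> C' * (real (n k) / 2 ^ k)" using a_le[of k] C' by (intro mult_left_mono) auto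
      moreover have "g k = real (n k) / 2 ^ k + C' * (real (n k) / 2 ^ k)" by (simp add: g_def algebra_simps add_divide_distrib)
      ultimately show ?thesis using green[OF k1, of "n k" j] by linarith
    qed
    show gpos: "0 < g k" by (rule less_le_trans[OF _ g_ge]) (simp add: Wpos k1)
    have "(2::int) ^ (k + r0) \<le> 2 ^ (k + r)" by (intro power_increasing) (auto simp: r_def)
    from less_le_trans[OF _ this] show "S k \<subseteq> {j. \<bar>j\<bar> < 2 ^ (k + r)}" unfolding S_def by blast
    show "c * g k \<le> green p (n k) i" if "i \<in> S k" for i using that by (simp add: S_def)
    show "measure (path_law p) {\<omega>. \<exists>l\<le>n k. walk \<omega> l \<notin> {j. \<bar>j\<bar> < 2 ^ (k + r)}} \<le> c\<^sup>2 / 128"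
      using exit[OF k, of r] N[of r] by (simp add: r_def)
    show "1 / (4 * (1 + C')) * 2 ^ k \<le> real (card (S k))"
    proof -
      let ?A = "{j::int. \<bar>j\<bar> < 2 ^ (k + r0)}"
      note finA = card_int_ball(1)[of "k + r0"] and cardA = card_int_ball(2)[of "k + r0"]
      have "real (n k) / 2 \<le> (\<Sum>j\<in>?A. green p (n k) j)"
        using exit[OF k, of r0] r0 by (intro sum_green_ge[OF finA]) simp
      also have "\<dots> \<le> (\<Sum>j\<in>?A. c * g k + (if j \<in> S k then g k else 0))"
        using gr gpos c by (intro sum_mono) (auto simp: S_def add_increasing)
      also have "\<dots> = real (card ?A) * (c * g k) + real (card (S k)) * g k"
      proof -
        have "?A \<inter> S k = S k" by (auto simp: S_def)
        then show ?thesis using finA by (simp add: sum.distrib sum.inter_restrict[symmetric])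
      qed
      also have "\<dots> \<le> 2 * 2 ^ (k + r0) * (c * g k) + real (card (S k)) * g k"
        using cardA c gpos by (intro add_right_mono mult_right_mono) auto
      also have "2 * 2 ^ (k + r0) * (c * g k) = real (n k) / 4"
        using C' by (simp add: c_def g_def power_add)
      finally have "real (n k) / 4 \<le> real (card (S k)) * g k" by simp
      also have "\<dots> = real (card (S k)) * (1 + C') / 2 ^ k * real (n k)" by (simp add: g_def)
      finally have "1 / 4 * real (n k) \<le> real (card (S k)) * (1 + C') / 2 ^ k * real (n k)" by simp
      moreover have "0 < real (n k)" by (rule less_le_trans[OF _ n_ge]) (simp add: Wpos k1)
      ultimately have "1 / 4 \<le> real (card (S k)) * (1 + C') / 2 ^ k" by (simp only: mult_le_cancel_right_pos)
      then show ?thesis using C' by (simp add: field_simps)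
    qed
  qed
qed

section \<open>Dominating traps in the environment\<close>

locale trap_environment =
  fixes \<nu> :: "real measure"
  assumes nu_prob: "prob_space \<nu>" and nu_sets: "sets \<nu> = sets borel" and nu_pos: "AE x in \<nu>. x > 0"
begin

sublocale nu: prob_space \<nu> by (rule nu_prob)

sublocale env: prob_space "env_law \<nu>"
  unfolding env_law_def by (intro prob_space_PiM nu_prob)

declare nu_sets [measurable_cong, simp]

lemma space_nu [simp]: "space \<nu> = UNIV"
  using sets_eq_imp_space_eq[OF nu_sets] by simp

lemma space_env [simp]: "space (env_law \<nu>) = UNIV"
  by (simp add: env_law_def space_PiM)

lemma measurable_env_component [measurable]: "(\<lambda>\<tau>. \<tau> i) \<in> borel_measurable (env_law \<nu>)"
proof -
  have "(\<lambda>\<tau>. \<tau> i) \<in> env_law \<nu> \<rightarrow>\<^sub>M \<nu>"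
    unfolding env_law_def by (rule measurable_component_singleton) simp
  then show ?thesis by (simp add: measurable_cong_sets[OF refl nu_sets])
qed

lemma distr_env_component: "distr (env_law \<nu>) \<nu> (\<lambda>\<tau>. \<tau> i) = \<nu>"
  unfolding env_law_def by (rule distr_PiM_component[where M="\<lambda>_. \<nu>"]) (auto intro: nu_prob)

lemma env_event: "Measurable.pred (env_law \<nu>) P \<Longrightarrow> {\<tau>. P \<tau>} \<in> env.events"
  by (simp add: pred_def)

lemma env_component_prob:
  assumes "A \<in> sets borel"
  shows "env.prob {\<tau>. \<tau> i \<in> A} = nu.prob A"
proof -
  have "(\<lambda>\<tau>. \<tau> i) \<in> env_law \<nu> \<rightarrow>\<^sub>M \<nu>"
    unfolding env_law_def by (rule measurable_component_singleton) simp
  then have "measure (distr (env_law \<nu>) \<nu> (\<lambda>\<tau>. \<tau> i)) A = env.prob ((\<lambda>\<tau>. \<tau> i) -` A \<inter> space (env_law \<nu>))"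
    using assms by (intro measure_distr) auto
  then show ?thesis by (simp add: distr_env_component vimage_def)
qed

lemma AE_env_pos: "AE \<tau> in env_law \<nu>. \<forall>i. 0 < \<tau> i"
  unfolding AE_all_countable env_law_def
  by (intro allI AE_PiM_component) (auto intro: nu_prob nu_pos)

lemma env_prob_all_le:
  assumes "finite S"
  shows "env.prob {\<tau>. \<forall>i\<in>S. \<tau> i \<le> u} = (1 - nu.prob {u<..}) ^ card S"
proof -
  interpret product_prob_space "\<lambda>_::int. \<nu>" UNIV by unfold_locales
  have "{\<tau>. \<forall>i\<in>S. \<tau> i \<le> u} = emb UNIV S (Pi\<^sub>E S (\<lambda>_. {..u}))"
    by (auto simp: prod_emb_def space_PiM)
  then have "env.prob {\<tau>. \<forall>i\<in>S. \<tau> i \<le> u} = (\<Prod>i\<in>S. nu.prob {..u})"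
    unfolding env_law_def using assms by (simp add: measure_PiM_emb)
  moreover have "nu.prob {..u} = 1 - nu.prob {u<..}"
    using nu.prob_compl[of "{u<..}"] by (simp add: Compl_eq_Diff_UNIV[symmetric])
  ultimately show ?thesis by simp
qed

text \<open>\<open>cong\<close> says that the predicate \<open>P n\<close> reads only the
  coordinates in \<open>A n\<close>, so independence of the restrictions to disjoint blocks carries
  over.\<close>

lemma indep_events_disjoint_blocks:
  assumes disj: "disjoint_family (A :: nat \<Rightarrow> int set)"
    and P: "\<And>n. Measurable.pred (PiM (A n) (\<lambda>_::int. \<nu>)) (P n)"
    and cong: "\<And>n \<tau>. P n (restrict \<tau> (A n)) \<longleftrightarrow> P n \<tau>"
  shows "env.indep_events (\<lambda>n. {\<tau>. P n \<tau>}) UNIV"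
proof -
  have rv: "(\<lambda>\<tau>. \<tau> i) \<in> env_law \<nu> \<rightarrow>\<^sub>M \<nu>" for i
    unfolding env_law_def by (rule measurable_component_singleton) simp
  have "env.indep_vars (\<lambda>_. \<nu>) (\<lambda>i \<tau>. \<tau> i) UNIV"
  proof (subst env.indep_vars_iff_distr_eq_PiM')
    have id: "(\<lambda>\<tau>::int \<Rightarrow> real. \<lambda>i\<in>UNIV. \<tau> i) = (\<lambda>\<tau>. \<tau>)" by (auto simp: restrict_def)
    show "distr (env_law \<nu>) (PiM UNIV (\<lambda>i. \<nu>)) (\<lambda>\<tau>. \<lambda>i\<in>UNIV. \<tau> i) = PiM UNIV (\<lambda>i. distr (env_law \<nu>) \<nu> (\<lambda>\<tau>. \<tau> i))"
      unfolding distr_env_component id by (simp add: env_law_def)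
  qed (auto simp: rv)
  then have *: "env.indep_vars (\<lambda>n. PiM (A n) (\<lambda>_. \<nu>)) (\<lambda>n \<tau>. restrict (\<lambda>i. \<tau> i) (A n)) UNIV"
    using disj by (intro env.indep_vars_restrict) auto
  have "env.indep_events (\<lambda>n. {\<tau> \<in> space (env_law \<nu>). P n (restrict (\<lambda>i. \<tau> i) (A n))}) UNIV"
    by (rule env.indep_eventsI_indep_vars[OF *]) (use P in \<open>auto simp: pred_def\<close>)
  then show ?thesis by (simp add: cong)
qed

text \<open>By continuity from above the limsup event has probability at least \<open>d > 0\<close>,
  and the zero-one law lifts this to 1.\<close>

lemma AE_infinitely_often:
  fixes D :: "nat \<Rightarrow> (int \<Rightarrow> real) set"
  assumes ind: "env.indep_events D UNIV" and d: "0 < d" "\<And>n. d \<le> env.prob (D n)"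
  shows "AE \<tau> in env_law \<nu>. \<exists>\<^sub>\<infinity>n. \<tau> \<in> D n"
proof -
  have [measurable]: "D n \<in> env.events" for n using ind by (auto simp: env.indep_events_def)
  let ?U = "\<lambda>n. \<Union>m\<in>{n..}. D m"
  have "(\<lambda>n. env.prob (?U n)) \<longlonglongrightarrow> env.prob (\<Inter>n. ?U n)"
    by (intro env.finite_Lim_measure_decseq) (auto simp: decseq_def intro: order_trans)
  moreover have "d \<le> env.prob (?U n)" for n
    by (rule order_trans[OF d(2)[of n] env.finite_measure_mono]) auto
  ultimately have "d \<le> env.prob (\<Inter>n. ?U n)" by (intro LIMSEQ_le_const) auto
  with env.borel_0_1_law[OF ind] d have "env.prob (\<Inter>n. ?U n) = 1" by auto
  moreover have "(\<Inter>n. ?U n) \<in> env.events" by measurable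
  ultimately have "AE \<tau> in env_law \<nu>. \<tau> \<in> (\<Inter>n. ?U n)" by (simp add: env.prob_eq_1)
  then show ?thesis by eventually_elim (auto simp: INFM_nat_le)
qed

lemma sum_tightness:
  assumes "0 < e"
  shows "\<exists>T. \<forall>u\<ge>T. env.prob {\<tau>. u < (\<Sum>i\<in>A. \<tau> i)} < e"
proof -
  have [measurable]: "(\<lambda>\<tau>. \<Sum>i\<in>A. \<tau> i) \<in> borel_measurable (env_law \<nu>)" by measurable
  have ev: "{\<tau>. u < (\<Sum>i\<in>A. \<tau> i)} \<in> env.events" for u by (rule env_event) measurable
  let ?F = "\<lambda>n::nat. {\<tau>. real n < (\<Sum>i\<in>A. \<tau> i)}"
  have "(\<lambda>n. env.prob (?F n)) \<longlonglongrightarrow> env.prob (\<Inter>n. ?F n)"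
    using ev by (intro env.finite_Lim_measure_decseq) (auto simp: decseq_def intro: order_le_less_trans)
  moreover have "(\<Inter>n. ?F n) = {}"
  proof -
    have "\<exists>n. \<not> real n < (\<Sum>i\<in>A. \<tau> i)" for \<tau>
      using reals_Archimedean2[of "\<Sum>i\<in>A. \<tau> i"] less_asym by blast
    then show ?thesis by blast
  qed
  ultimately have "(\<lambda>n. env.prob (?F n)) \<longlonglongrightarrow> 0" by simp
  from order_tendstoD(2)[OF this assms] obtain n where n: "env.prob (?F n) < e" by (auto simp: eventually_sequentially)
  have "env.prob {\<tau>. u < (\<Sum>i\<in>A. \<tau> i)} < e" if "real n \<le> u" for u
  proof -
    have "env.prob {\<tau>. u < (\<Sum>i\<in>A. \<tau> i)} \<le> env.prob (?F n)" using that ev by (intro env.finite_measure_mono) auto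
    then show ?thesis using n by simp
  qed
  then show ?thesis by blast
qed

text \<open>The lower clip at 0 keeps the integrand bounded everywhere, positivity of traps being
  only almost sure.\<close>

definition clipped_mean :: "real \<Rightarrow> real" where
  "clipped_mean c = nu.expectation (\<lambda>x. max 0 (min x c))"

lemma measurable_clip [measurable]: "(\<lambda>x. max 0 (min x c)) \<in> borel_measurable \<nu>"
  unfolding measurable_cong_sets[OF nu_sets refl] by measurable

lemma integrable_clip: "0 \<le> c \<Longrightarrow> integrable \<nu> (\<lambda>x. max 0 (min x c))"
  by (rule nu.integrable_const_bound[where B=c]) auto

lemma clipped_mean_double: "0 \<le> c \<Longrightarrow> clipped_mean (2 * c) \<le> clipped_mean c + c * nu.prob {c<..}"
proof -
  assume c: "0 \<le> c"
  have "clipped_mean (2 * c) \<le> nu.expectation (\<lambda>x. max 0 (min x c) + c * indicator {c<..} x)"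
    unfolding clipped_mean_def
  proof (rule integral_mono)
    show "integrable \<nu> (\<lambda>x. max 0 (min x c) + c * indicator {c<..} x)"
      using c by (intro Bochner_Integration.integrable_add integrable_clip integrable_mult_right integrable_real_indicator)
         (auto simp: nu.emeasure_eq_measure)
    show "integrable \<nu> (\<lambda>x. max 0 (min x (2 * c)))" using c by (intro integrable_clip) simp
  qed (use c in \<open>auto simp: indicator_def max_def min_def\<close>)
  also have "\<dots> = clipped_mean c + c * nu.prob {c<..}"
    unfolding clipped_mean_def using c integrable_clip[OF c]
    by (subst Bochner_Integration.integral_add) (auto simp del: indicator_simps intro!: integrable_mult_right integrable_real_indicator simp: nu.emeasure_eq_measure)
  finally show ?thesis .
qed

lemma sum_exceeds_prob:
  assumes A: "finite A" and c: "0 < c" and u: "0 < u"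
  shows "env.prob {\<tau>. u < (\<Sum>i\<in>A. max 0 (min (\<tau> i) c))} \<le> real (card A) * clipped_mean c / u"
proof -
  have [measurable]: "(\<lambda>\<tau>. \<Sum>i\<in>A. max 0 (min (\<tau> i) c)) \<in> borel_measurable (env_law \<nu>)" by measurable
  have int: "integrable (env_law \<nu>) (\<lambda>\<tau>. max 0 (min (\<tau> i) c))" for i
    using c by (intro env.integrable_const_bound[where B=c]) auto
  have E: "env.expectation (\<lambda>\<tau>. max 0 (min (\<tau> i) c)) = clipped_mean c" for i
  proof -
    have rv: "(\<lambda>\<tau>. \<tau> i) \<in> env_law \<nu> \<rightarrow>\<^sub>M \<nu>"
      unfolding env_law_def by (rule measurable_component_singleton) simp
    have "clipped_mean c = (\<integral>x. max 0 (min x c) \<partial>distr (env_law \<nu>) \<nu> (\<lambda>\<tau>. \<tau> i))"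
      unfolding clipped_mean_def by (simp only: distr_env_component)
    also have "\<dots> = env.expectation (\<lambda>\<tau>. max 0 (min (\<tau> i) c))"
      by (rule integral_distr[OF rv]) simp
    finally show ?thesis by simp
  qed
  have "env.prob {\<tau>. u < (\<Sum>i\<in>A. max 0 (min (\<tau> i) c))} \<le> env.prob {\<tau>\<in>space (env_law \<nu>). u \<le> (\<Sum>i\<in>A. max 0 (min (\<tau> i) c))}"
    by (intro env.finite_measure_mono) (auto intro!: env_event)
  also have "\<dots> \<le> env.expectation (\<lambda>\<tau>. \<Sum>i\<in>A. max 0 (min (\<tau> i) c)) / u"
    using u int by (intro integral_Markov_inequality_measure[where A="{}"]) (auto intro!: AE_I2 sum_nonneg)
  also have "env.expectation (\<lambda>\<tau>. \<Sum>i\<in>A. max 0 (min (\<tau> i) c)) = real (card A) * clipped_mean c"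
    by (subst Bochner_Integration.integral_sum) (auto simp: int E)
  finally show ?thesis .
qed

text \<open>The level \<open>u\<close> is chosen with tail of order \<open>1 / L\<close>, so that
  about one trap among order \<open>L\<close> sites exceeds it. Traps above \<open>2 ^ a * u\<close>
  are unlikely for large \<open>a\<close>; the rest, clipped there, have a sum of mean of order
  \<open>u\<close> because the truncated mean is dominated by its top level. Giving up
  \<open>p1 / 4\<close> twice leaves \<open>p1 / 2\<close>. The level depends on \<open>T\<close>
  and \<open>L\<close> only, not on the sets.\<close>

lemma heavy_trap_probability:
  fixes \<rho> \<rho>' B c :: real
  defines "v \<equiv> \<lambda>j::nat. nu.prob {2 ^ j<..}"
  assumes \<rho>: "1 / 2 < \<rho>'" "\<rho> < 1" "0 < \<rho>"
    and v: "\<And>j. j0 \<le> j \<Longrightarrow> 0 < v j \<and> \<rho>' * v j \<le> v (Suc j) \<and> v (Suc j) \<le> \<rho> * v j"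
    and B: "0 < B" and c: "0 < c"
  obtains d K where "0 < d" "0 < K"
    "\<And>T. \<exists>L0. \<forall>L\<ge>L0. \<exists>u\<ge>T. \<forall>S A. finite A \<longrightarrow> S \<subseteq> A \<longrightarrow> c * L \<le> real (card S) \<longrightarrow> real (card A) \<le> B * L \<longrightarrow>
       d \<le> env.prob {\<tau>. (\<exists>i\<in>S. u < \<tau> i) \<and> (\<Sum>i\<in>A. \<tau> i) \<le> K * u}"
proof -
  have vpos: "0 < v j" if "j0 \<le> j" for j using v[OF that] by simp
  have vpow: "v (j + a) \<le> \<rho> ^ a * v j" if "j0 \<le> j" for j a
  proof (induction a)
    case (Suc a)
    have "v (j + Suc a) \<le> \<rho> * v (j + a)" using v[of "j + a"] that by simp
    also have "\<dots> \<le> \<rho> * (\<rho> ^ a * v j)" using Suc \<rho> by (intro mult_left_mono) auto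
    finally show ?case by (simp add: mult.assoc)
  qed simp
  have vanti: "v j' \<le> v j" if "j \<le> j'" for j j'
    unfolding v_def using that by (intro nu.finite_measure_mono) (auto intro: order_le_less_trans power_increasing)
  \<comment> \<open>The first summand pays for the levels below \<open>2 ^ j0\<close>, the second
    for the geometric sum above, which converges to its last term as
    \<open>2 * \<rho>' > 1\<close>.\<close>
  define C where "C = 2 ^ j0 / (2 ^ j0 * v j0) + 1 / (2 * \<rho>' - 1)"
  have mean: "clipped_mean (2 ^ j) \<le> C * (2 ^ j * v j)" if "j0 \<le> j" for j
  proof -
    have "clipped_mean (2 ^ j) \<le> 2 ^ j0 + (\<Sum>i=j0..<j. 2 ^ i * v i)"
      using that
    proof (induction j rule: dec_induct)
      case base
      have "clipped_mean (2 ^ j0) \<le> nu.expectation (\<lambda>_. 2 ^ j0)"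
        unfolding clipped_mean_def by (intro integral_mono integrable_clip) auto
      then show ?case using nu.prob_space by simp
    next
      case (step j)
      then show ?case using clipped_mean_double[of "2 ^ j"] by (simp add: v_def)
    qed
    also have "(\<Sum>i=j0..<j. 2 ^ i * v i) \<le> 2 ^ j * v j / (2 * \<rho>' - 1)"
    proof (rule geometric_sum_le_last[OF _ _ _ that])
      fix i assume "j0 \<le> i"
      then have "2 * 2 ^ i * (\<rho>' * v i) \<le> 2 * 2 ^ i * v (Suc i)" using v[of i] by (intro mult_left_mono) auto
      then show "2 * \<rho>' * (2 ^ i * v i) \<le> 2 ^ Suc i * v (Suc i)" by (simp add: algebra_simps)
    qed (use \<rho> vpos[of j0] in auto)
    also have "(2::real) ^ j0 \<le> 2 ^ j0 / (2 ^ j0 * v j0) * (2 ^ j * v j)"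
    proof -
      have "2 ^ j0 * v j0 \<le> 2 ^ j * v j"
        using that
      proof (induction j rule: dec_induct)
        case (step j)
        have "2 ^ j * v j \<le> 2 ^ j * (2 * (\<rho>' * v j))"
        proof (rule mult_left_mono)
          have "1 * v j \<le> (2 * \<rho>') * v j" using \<rho> vpos[of j] step by (intro mult_right_mono) auto
          then show "v j \<le> 2 * (\<rho>' * v j)" by simp
        qed simp
        also have "\<dots> \<le> 2 ^ j * (2 * v (Suc j))" using v[of j] step by (intro mult_left_mono) auto
        finally have "2 ^ j * v j \<le> 2 ^ Suc j * v (Suc j)" by (simp only: power_Suc ac_simps)
        then show ?case using step.IH by linarith
      qed simp
      then have "2 ^ j0 / (2 ^ j0 * v j0) * (2 ^ j0 * v j0) \<le> 2 ^ j0 / (2 ^ j0 * v j0) * (2 ^ j * v j)"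
        using vpos[of j0] by (intro mult_left_mono) auto
      then show ?thesis using vpos[of j0] by simp
    qed
    finally show ?thesis by (simp add: C_def algebra_simps)
  qed
  have C: "0 < C" unfolding C_def using \<rho> vpos[of j0] by (intro add_pos_pos divide_pos_pos) auto
  \<comment> \<open>A lower bound for seeing a trap above \<open>u\<close> in \<open>S\<close>: the
    expected number of such traps is at least \<open>c * L * (1 / (2 * L)) = c / 2\<close>.\<close>
  define p1 where "p1 = 1 - exp (- (c / 2))"
  have p1: "0 < p1" using c by (simp add: p1_def)
  have "(\<lambda>a. B * \<rho> ^ a) \<longlonglongrightarrow> B * 0" using \<rho> by (intro tendsto_mult_left LIMSEQ_realpow_zero) auto
  from order_tendstoD(2)[OF this, of "p1 / 4"] p1 obtain a where a: "B * \<rho> ^ a < p1 / 4"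
    by (auto simp: eventually_sequentially)
  \<comment> \<open>Chosen so that the Markov bound \<open>B * C * 2 ^ a / K\<close> equals
    \<open>p1 / 4\<close>.\<close>
  define K where "K = 4 * B * C * 2 ^ a / p1"
  have K: "0 < K" using B C p1 by (simp add: K_def)
  have main: "\<exists>L0. \<forall>L\<ge>L0. \<exists>u\<ge>T. \<forall>S A. finite A \<longrightarrow> S \<subseteq> A \<longrightarrow> c * L \<le> real (card S) \<longrightarrow> real (card A) \<le> B * L \<longrightarrow>
       p1 / 2 \<le> env.prob {\<tau>. (\<exists>i\<in>S. u < \<tau> i) \<and> (\<Sum>i\<in>A. \<tau> i) \<le> K * u}" for T
  proof -
    \<comment> \<open>For \<open>L \<ge> 2 / v J'\<close> the tail still exceeds
      \<open>1 / L\<close> at level \<open>J'\<close>, so the level found below lies beyond it and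
      \<open>u \<ge> T\<close>.\<close>
    obtain J where J: "T < 2 ^ J" using real_arch_pow[of 2 T] by auto
    define J' where "J' = max J j0"
    show ?thesis
    proof (rule exI[of _ "2 / v J'"], intro allI impI)
      fix L :: real assume L: "2 / v J' \<le> L"
      have vJ: "0 < v J'" by (intro vpos) (simp add: J'_def)
      then have Lpos: "0 < L" using L by (intro less_le_trans[OF _ L]) simp
      have LJ: "1 / L < v J'" using L vJ Lpos by (simp add: field_simps)
      have "(\<lambda>b. \<rho> ^ b * v J') \<longlonglongrightarrow> 0 * v J'" using \<rho> by (intro tendsto_mult_right LIMSEQ_realpow_zero) auto
      from order_tendstoD(2)[OF this, of "1 / L"] Lpos obtain b where b: "\<rho> ^ b * v J' < 1 / L"
        by (auto simp: eventually_sequentially)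
      have ex: "v (J' + b) \<le> 1 / L" using vpow[of J' b] b by (simp add: J'_def)
      \<comment> \<open>By minimality the preceding level has tail above \<open>1 / L\<close>, and
        one doubling loses at most the factor \<open>\<rho>' > 1/2\<close>; so \<open>v j\<close>
        lies between \<open>1 / (2 * L)\<close> and \<open>1 / L\<close>.\<close>
      define j where "j = (LEAST j. v j \<le> 1 / L)"
      have vj: "v j \<le> 1 / L" unfolding j_def by (rule LeastI[of _ "J' + b"]) (rule ex)
      have jJ: "J' < j"
      proof (rule ccontr)
        assume "\<not> J' < j"
        then have "v J' \<le> v j" by (intro vanti) simp
        then show False using vj LJ by simp
      qed
      have jj0: "j0 \<le> j" "j0 \<le> j - 1" "J \<le> j" using jJ by (auto simp: J'_def)
      have "\<not> v (j - 1) \<le> 1 / L" using not_less_Least[of "j - 1" "\<lambda>j. v j \<le> 1 / L"] jJ by (simp add: j_def)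
      then have "1 / 2 * (1 / L) \<le> \<rho>' * v (j - 1)" using \<rho> Lpos by (intro mult_mono) auto
      also have "\<dots> \<le> v j" using v[OF jj0(2)] jJ by simp
      finally have vj2: "1 / 2 * (1 / L) \<le> v j" .
      define u :: real where "u = 2 ^ j"
      have u: "0 < u" by (simp add: u_def)
      have "(2::real) ^ J \<le> 2 ^ j" using jj0 by (intro power_increasing) auto
      then have uT: "T \<le> u" using J unfolding u_def by linarith
      show "\<exists>u\<ge>T. \<forall>S A. finite A \<longrightarrow> S \<subseteq> A \<longrightarrow> c * L \<le> real (card S) \<longrightarrow> real (card A) \<le> B * L \<longrightarrow>
         p1 / 2 \<le> env.prob {\<tau>. (\<exists>i\<in>S. u < \<tau> i) \<and> (\<Sum>i\<in>A. \<tau> i) \<le> K * u}"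
      proof (intro exI[of _ u] conjI uT allI impI)
        fix S A :: "int set"
        assume A: "finite A" "S \<subseteq> A" and cS: "c * L \<le> real (card S)" and cA: "real (card A) \<le> B * L"
        have S: "finite S" using A finite_subset by blast
        let ?c = "2 ^ (j + a) :: real"
        let ?E1 = "{\<tau>. \<exists>i\<in>S. u < \<tau> i}" and ?E2 = "{\<tau>. \<exists>i\<in>A. ?c < \<tau> i}"
          and ?E3 = "{\<tau>. K * u < (\<Sum>i\<in>A. max 0 (min (\<tau> i) ?c))}"
          and ?D = "{\<tau>. (\<exists>i\<in>S. u < \<tau> i) \<and> (\<Sum>i\<in>A. \<tau> i) \<le> K * u}"
        have ev [simp]: "?E1 \<in> env.events" "?E2 \<in> env.events" "?E3 \<in> env.events" "?D \<in> env.events"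
          using S A by (auto intro!: env_event)
        \<comment> \<open>Off \<open>?E2\<close> the upper clip is inactive, so the true sum is at
          most the clipped one, which off \<open>?E3\<close> is at most
          \<open>K * u\<close>.\<close>
        have sub: "?E1 \<subseteq> ?D \<union> (?E2 \<union> ?E3)"
        proof
          fix \<tau> assume t: "\<tau> \<in> ?E1"
          show "\<tau> \<in> ?D \<union> (?E2 \<union> ?E3)"
          proof (rule ccontr)
            assume n: "\<tau> \<notin> ?D \<union> (?E2 \<union> ?E3)"
            then have "(\<Sum>i\<in>A. \<tau> i) \<le> (\<Sum>i\<in>A. max 0 (min (\<tau> i) ?c))"
              by (intro sum_mono) (auto simp: not_less)
            then show False using n t by auto
          qed
        qed
        have "env.prob ?E1 \<le> env.prob (?D \<union> (?E2 \<union> ?E3))" by (rule env.finite_measure_mono[OF sub]) (intro sets.Un ev)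
        also have "\<dots> \<le> env.prob ?D + env.prob (?E2 \<union> ?E3)" by (intro measure_Un_le sets.Un ev)
        also have "env.prob (?E2 \<union> ?E3) \<le> env.prob ?E2 + env.prob ?E3" by (intro measure_Un_le ev)
        finally have total: "env.prob ?E1 \<le> env.prob ?D + (env.prob ?E2 + env.prob ?E3)" by simp
        have e1: "p1 \<le> env.prob ?E1"
        proof -
          have "UNIV - ?E1 = {\<tau>. \<forall>i\<in>S. \<tau> i \<le> u}" by (auto simp: not_less)
          then have "env.prob ?E1 = 1 - env.prob {\<tau>. \<forall>i\<in>S. \<tau> i \<le> u}"
            using env.prob_compl[OF ev(1)] by simp
          also have "\<dots> = 1 - (1 - v j) ^ card S" using S by (simp add: env_prob_all_le v_def u_def)
          finally have E1: "env.prob ?E1 = 1 - (1 - v j) ^ card S" .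
          have "(1 - v j) ^ card S \<le> exp (- v j) ^ card S"
            using exp_ge_add_one_self[of "- v j"] nu.prob_le_1 by (intro power_mono) (auto simp: v_def)
          also have "\<dots> = exp (- (real (card S) * v j))" by (simp add: exp_of_nat_mult[symmetric])
          also have "\<dots> \<le> exp (- (c / 2))"
          proof -
            have "c * L * (1 / 2 * (1 / L)) \<le> real (card S) * v j"
              using cS vj2 c Lpos by (intro mult_mono) auto
            then show ?thesis using Lpos by simp
          qed
          finally show ?thesis using E1 by (simp add: p1_def)
        qed
        have cAv: "real (card A) * v j \<le> B"
        proof -
          have "real (card A) * v j \<le> (B * L) * (1 / L)" using cA vj vpos[OF jj0(1)] B Lpos by (intro mult_mono) auto
          then show ?thesis using Lpos by simp
        qed
        have e2: "env.prob ?E2 \<le> p1 / 4"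
        proof -
          have "?E2 = (\<Union>i\<in>A. {\<tau>. \<tau> i \<in> {?c<..}})" by auto
          also have "env.prob \<dots> \<le> (\<Sum>i\<in>A. env.prob {\<tau>. \<tau> i \<in> {?c<..}})"
            using A by (intro measure_UNION_le) (auto intro!: env_event)
          also have "\<dots> = (\<Sum>i\<in>A. v (j + a))" by (intro sum.cong refl) (simp only: env_component_prob v_def greaterThan_borel)
          also have "\<dots> = real (card A) * v (j + a)" by simp
          also have "\<dots> \<le> real (card A) * (\<rho> ^ a * v j)" by (intro mult_left_mono vpow jj0) auto
          also have "\<dots> = real (card A) * v j * \<rho> ^ a" by simp
          also have "\<dots> \<le> B * \<rho> ^ a" using cAv \<rho> by (intro mult_right_mono) auto
          finally show ?thesis using a by simp
        qed
        have e3: "env.prob ?E3 \<le> p1 / 4"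
        proof -
          have "env.prob ?E3 \<le> real (card A) * clipped_mean ?c / (K * u)" using A K u by (intro sum_exceeds_prob) auto
          also have "\<dots> \<le> real (card A) * (C * (?c * v (j + a))) / (K * u)"
            using K u jj0 by (intro divide_right_mono mult_left_mono mean) auto
          also have "\<dots> \<le> real (card A) * (C * (?c * v j)) / (K * u)"
            using K u C by (intro divide_right_mono mult_left_mono vanti) auto
          also have "\<dots> = (real (card A) * v j) * (C * 2 ^ a / K)" by (simp add: u_def power_add)
          also have "\<dots> \<le> B * (C * 2 ^ a / K)" using cAv C K by (intro mult_right_mono) auto
          also have "\<dots> = p1 / 4" using B C p1 by (simp add: K_def)
          finally show ?thesis .
        qed
        show "p1 / 2 \<le> env.prob ?D" using total e1 e2 e3 by linarith
      qed
    qed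
  qed
  have "0 < p1 / 2" using p1 by simp
  from that[OF this K main] show ?thesis .
qed

text \<open>In an annulus some favourite trap exceeds \<open>u\<close> while the annulus sum is at
  most \<open>K * u\<close>, infinitely often by independence. The inner ball eventually contributes
  at most another \<open>u\<close>, whence the fraction \<open>1 / (K + 1)\<close>.\<close>

lemma dominating_traps_infinitely_often:
  fixes \<rho> \<rho>' c :: real and S :: "nat \<Rightarrow> int set"
  assumes \<rho>: "1 / 2 < \<rho>'" "\<rho> < 1" "0 < \<rho>"
    and v: "\<And>j. j0 \<le> j \<Longrightarrow> 0 < nu.prob {2 ^ j<..} \<and> \<rho>' * nu.prob {2 ^ j<..} \<le> nu.prob {2 ^ Suc j<..}
       \<and> nu.prob {2 ^ Suc j<..} \<le> \<rho> * nu.prob {2 ^ j<..}"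
    and c: "0 < c" and S: "\<And>k. m \<le> k \<Longrightarrow> S k \<subseteq> {j. \<bar>j\<bar> < 2 ^ (k + r)}"
    and card: "\<And>k. m \<le> k \<Longrightarrow> c * 2 ^ k \<le> real (card (S k))"
  obtains \<delta> where "0 < \<delta>"
    "AE \<tau> in env_law \<nu>. \<forall>k0. \<exists>k\<ge>k0. \<exists>i\<in>S k. \<delta> * (\<Sum>j | \<bar>j\<bar> < 2 ^ (k + r). \<tau> j) \<le> \<tau> i"
proof -
  let ?I = "\<lambda>k. {j::int. \<bar>j\<bar> < 2 ^ (k + r)}"
  have I_mono: "?I k \<subseteq> ?I k'" if "k \<le> k'" for k k'
  proof -
    have "(2::int) ^ (k + r) \<le> 2 ^ (k' + r)" using that by (intro power_increasing) auto
    from less_le_trans[OF _ this] show ?thesis by blast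
  qed
  obtain d K where d: "0 < d" and K: "0 < K"
    and heavy: "\<And>T. \<exists>L0. \<forall>L\<ge>L0. \<exists>u\<ge>T. \<forall>S A. finite A \<longrightarrow> S \<subseteq> A \<longrightarrow> c / 2 * L \<le> real (card S) \<longrightarrow> real (card A) \<le> 2 * 2 ^ r * L \<longrightarrow>
       d \<le> env.prob {\<tau>. (\<exists>i\<in>S. u < \<tau> i) \<and> (\<Sum>i\<in>A. \<tau> i) \<le> K * u}"
  proof (rule heavy_trap_probability[OF \<rho> v, where B="2 * 2 ^ r" and c="c / 2"])
    show "0 < c / 2" using c by simp
  qed (simp, simp, rule that)
  \<comment> \<open>Relates consecutive scales: one threshold \<open>u\<close> both dominates the
    ball at \<open>k\<close> up to a summable error and is exceeded by a trap in the annulus up to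
    \<open>k'\<close>.\<close>
  define Q where "Q n k k' \<longleftrightarrow> k < k' \<and> (\<exists>u. env.prob {\<tau>. u < (\<Sum>j\<in>?I k. \<tau> j)} \<le> (1 / 2) ^ n
     \<and> d \<le> env.prob {\<tau>. (\<exists>i\<in>S k' - ?I k. u < \<tau> i) \<and> (\<Sum>i\<in>?I k' - ?I k. \<tau> i) \<le> K * u})" for n k k'
  have "\<exists>f. \<forall>n. m \<le> f n \<and> Q n (f n) (f (Suc n))"
  proof (rule dependent_nat_choice)
    show "\<exists>k. m \<le> k" by auto
    fix k n assume k: "m \<le> k"
    obtain T where T: "\<And>u. T \<le> u \<Longrightarrow> env.prob {\<tau>. u < (\<Sum>j\<in>?I k. \<tau> j)} < (1 / 2) ^ n"
      using sum_tightness[of "(1/2)^n" "?I k"] by auto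
    obtain L0 where L0: "\<And>L. L0 \<le> L \<Longrightarrow> \<exists>u\<ge>T. \<forall>S A. finite A \<longrightarrow> S \<subseteq> A \<longrightarrow> c / 2 * L \<le> real (card S) \<longrightarrow> real (card A) \<le> 2 * 2 ^ r * L \<longrightarrow>
       d \<le> env.prob {\<tau>. (\<exists>i\<in>S. u < \<tau> i) \<and> (\<Sum>i\<in>A. \<tau> i) \<le> K * u}" using heavy[of T] by blast
    \<comment> \<open>The second bound makes the ball at \<open>k\<close>, with at most
      \<open>2 * 2 ^ (k + r)\<close> sites, remove at most half of the guaranteed
      \<open>c * 2 ^ k'\<close> favourite sites.\<close>
    obtain k1 where k1: "max L0 (4 * 2 ^ (k + r) / c) < 2 ^ k1" using real_arch_pow[of 2 "max L0 (4 * 2 ^ (k + r) / c)"] by (auto simp del: max_less_iff_conj)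
    define k' where "k' = max k1 (Suc k)"
    have k': "k < k'" "m \<le> k'" using k by (auto simp: k'_def)
    have "(2::real) ^ k1 \<le> 2 ^ k'" by (intro power_increasing) (auto simp: k'_def)
    then have big: "L0 \<le> 2 ^ k'" "4 * 2 ^ (k + r) / c \<le> 2 ^ k'" using k1 by linarith+
    obtain u where u: "T \<le> u" and uD: "\<And>S A. finite A \<Longrightarrow> S \<subseteq> A \<Longrightarrow> c / 2 * 2 ^ k' \<le> real (card S) \<Longrightarrow> real (card A) \<le> 2 * 2 ^ r * 2 ^ k' \<Longrightarrow>
       d \<le> env.prob {\<tau>. (\<exists>i\<in>S. u < \<tau> i) \<and> (\<Sum>i\<in>A. \<tau> i) \<le> K * u}" using L0[OF big(1)] by blast
    have "d \<le> env.prob {\<tau>. (\<exists>i\<in>S k' - ?I k. u < \<tau> i) \<and> (\<Sum>i\<in>?I k' - ?I k. \<tau> i) \<le> K * u}"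
    proof (rule uD)
      show "finite (?I k' - ?I k)" using card_int_ball(1) by (rule finite_Diff)
      show "S k' - ?I k \<subseteq> ?I k' - ?I k" using S[OF k'(2)] by blast
      have "real (card (?I k' - ?I k)) \<le> real (card (?I k'))"
        using card_int_ball(1) by (intro of_nat_mono card_mono) auto
      also have "\<dots> \<le> 2 * 2 ^ (k' + r)" by (rule card_int_ball)
      finally show "real (card (?I k' - ?I k)) \<le> 2 * 2 ^ r * 2 ^ k'" by (simp add: power_add algebra_simps)
      have finS: "finite (S k')" using S[OF k'(2)] card_int_ball(1) by (rule finite_subset)
      have "card (S k') - card (?I k) \<le> card (S k' - ?I k)"
        by (rule diff_card_le_card_Diff[OF card_int_ball(1)])
      then have "real (card (S k')) \<le> real (card (S k' - ?I k)) + real (card (?I k))" by linarith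
      moreover have "real (card (?I k)) \<le> c / 2 * 2 ^ k'"
      proof -
        have "real (card (?I k)) \<le> 2 * 2 ^ (k + r)" by (rule card_int_ball)
        also have "\<dots> \<le> c / 2 * 2 ^ k'" using big(2) c by (simp add: field_simps)
        finally show ?thesis .
      qed
      ultimately show "c / 2 * 2 ^ k' \<le> real (card (S k' - ?I k))" using card[OF k'(2)] by linarith
    qed
    moreover have "env.prob {\<tau>. u < (\<Sum>j\<in>?I k. \<tau> j)} \<le> (1 / 2) ^ n" using T[OF u] by simp
    ultimately show "\<exists>k'. m \<le> k' \<and> Q n k k'" unfolding Q_def using k' by blast
  qed
  then obtain f where f: "\<And>n. m \<le> f n" and Qf: "\<And>n. Q n (f n) (f (Suc n))" by blast
  have "\<forall>n. \<exists>u. env.prob {\<tau>. u < (\<Sum>j\<in>?I (f n). \<tau> j)} \<le> (1 / 2) ^ n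
     \<and> d \<le> env.prob {\<tau>. (\<exists>i\<in>S (f (Suc n)) - ?I (f n). u < \<tau> i) \<and> (\<Sum>i\<in>?I (f (Suc n)) - ?I (f n). \<tau> i) \<le> K * u}"
    using Qf by (auto simp: Q_def)
  from choice[OF this] obtain u where u1: "\<And>n. env.prob {\<tau>. u n < (\<Sum>j\<in>?I (f n). \<tau> j)} \<le> (1 / 2) ^ n"
    and u2: "\<And>n. d \<le> env.prob {\<tau>. (\<exists>i\<in>S (f (Suc n)) - ?I (f n). u n < \<tau> i) \<and> (\<Sum>i\<in>?I (f (Suc n)) - ?I (f n). \<tau> i) \<le> K * u n}"
    by blast
  have fmono: "strict_mono f" using Qf by (intro strict_monoI_Suc) (simp add: Q_def)
  define A where "A n = ?I (f (Suc n)) - ?I (f n)" for n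
  define S' where "S' n = S (f (Suc n)) - ?I (f n)" for n
  have S'A: "S' n \<subseteq> A n" for n using S[OF f[of "Suc n"]] by (auto simp: S'_def A_def)
  have finA: "finite (A n)" for n unfolding A_def using card_int_ball(1) by (rule finite_Diff)
  have disj: "disjoint_family A"
  proof -
    have "A n \<inter> A n' = {}" if "n < n'" for n n'
    proof -
      have "?I (f (Suc n)) \<subseteq> ?I (f n')" using that fmono by (intro I_mono) (simp add: strict_mono_less_eq)
      then show ?thesis by (auto simp: A_def)
    qed
    then show ?thesis unfolding disjoint_family_on_def by (metis inf_commute linorder_neqE_nat)
  qed
  let ?P = "\<lambda>n \<tau>. (\<exists>i\<in>S' n. u n < \<tau> i) \<and> (\<Sum>i\<in>A n. \<tau> i) \<le> K * u n"
  have ind: "env.indep_events (\<lambda>n. {\<tau>. ?P n \<tau>}) UNIV"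
  proof (rule indep_events_disjoint_blocks[OF disj])
    fix n
    show "?P n (restrict \<tau> (A n)) \<longleftrightarrow> ?P n \<tau>" for \<tau>
      using S'A[of n] by (auto simp: subset_eq)
    have [measurable]: "(\<lambda>\<tau>. \<tau> i) \<in> borel_measurable (PiM (A n) (\<lambda>_. \<nu>))" if "i \<in> A n" for i
      using measurable_component_singleton[OF that, of "\<lambda>_. \<nu>"] by (simp add: measurable_cong_sets[OF refl nu_sets])
    have "(\<lambda>\<tau>. \<Sum>i\<in>A n. \<tau> i) \<in> borel_measurable (PiM (A n) (\<lambda>_. \<nu>))"
      by (rule borel_measurable_sum) measurable
    moreover have "Measurable.pred (PiM (A n) (\<lambda>_. \<nu>)) (\<lambda>\<tau>. \<exists>i\<in>S' n. u n < \<tau> i)"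
      using S'A[of n] finite_subset[OF S'A finA] by (intro pred_intros_finite) auto
    ultimately show "Measurable.pred (PiM (A n) (\<lambda>_. \<nu>)) (?P n)" by measurable
  qed
  have io: "AE \<tau> in env_law \<nu>. \<exists>\<^sub>\<infinity>n. \<tau> \<in> {\<tau>. ?P n \<tau>}"
    using u2 by (intro AE_infinitely_often[OF ind d]) (simp add: S'_def A_def)
  \<comment> \<open>The inner balls are nested, so these events are not independent; summability of
    \<open>(1 / 2) ^ n\<close> suffices for the first Borel--Cantelli lemma.\<close>
  have inner: "AE \<tau> in env_law \<nu>. eventually (\<lambda>n. \<tau> \<in> space (env_law \<nu>) - {\<tau>. u n < (\<Sum>j\<in>?I (f n). \<tau> j)}) sequentially"
  proof (rule borel_cantelli_AE1)
    show "{\<tau>. u n < (\<Sum>j\<in>?I (f n). \<tau> j)} \<in> env.events" for n by (rule env_event) measurable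
    show "summable (\<lambda>n. env.prob {\<tau>. u n < (\<Sum>j\<in>?I (f n). \<tau> j)})"
      by (rule summable_comparison_test'[OF summable_geometric[of "1/2::real"], of 0]) (use u1 in auto)
  qed (simp add: env.emeasure_eq_measure)
  have "AE \<tau> in env_law \<nu>. \<forall>k0. \<exists>k\<ge>k0. \<exists>i\<in>S k. 1 / (K + 1) * (\<Sum>j | \<bar>j\<bar> < 2 ^ (k + r). \<tau> j) \<le> \<tau> i"
    using io inner
  proof eventually_elim
    case (elim \<tau>)
    show ?case
    proof
      fix k0
      obtain n0 where n0: "\<And>n. n0 \<le> n \<Longrightarrow> (\<Sum>j\<in>?I (f n). \<tau> j) \<le> u n"
        using elim(2) by (auto simp: eventually_sequentially not_less)
      obtain n where n: "max k0 n0 \<le> n" "?P n \<tau>" using elim(1) unfolding INFM_nat_le mem_Collect_eq by blast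
      then obtain i where i: "i \<in> S' n" "u n < \<tau> i" by blast
      have "(\<Sum>j\<in>?I (f (Suc n)). \<tau> j) = (\<Sum>j\<in>A n. \<tau> j) + (\<Sum>j\<in>?I (f n). \<tau> j)"
        unfolding A_def using fmono by (intro sum.subset_diff card_int_ball I_mono) (simp add: strict_mono_less_eq)
      also have "\<dots> \<le> K * u n + u n" using n n0[of n] by (intro add_mono) auto
      also have "\<dots> = (K + 1) * u n" by (simp add: algebra_simps)
      also have "\<dots> \<le> (K + 1) * \<tau> i" using i K by (intro mult_left_mono) auto
      finally have "1 / (K + 1) * (\<Sum>j\<in>?I (f (Suc n)). \<tau> j) \<le> \<tau> i" using K by (simp add: field_simps)
      moreover have "k0 \<le> f (Suc n)" using n seq_suble[OF fmono, of "Suc n"] by simp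
      moreover have "i \<in> S (f (Suc n))" using i by (simp add: S'_def)
      ultimately show "\<exists>k\<ge>k0. \<exists>i\<in>S k. 1 / (K + 1) * (\<Sum>j | \<bar>j\<bar> < 2 ^ (k + r). \<tau> j) \<le> \<tau> i" by blast
    qed
  qed
  moreover have "0 < 1 / (K + 1)" using K by simp
  ultimately show ?thesis by (rule that[rotated])
qed

end

section \<open>Localization\<close>

theorem theorem7:
  fixes p :: "int pmf" and \<nu> :: "real measure"
    and \<alpha> \<beta> c_minus c_plus \<kappa> :: real and h s :: "real \<Rightarrow> real"
  assumes beta: "1 < \<beta>" "\<beta> \<le> 2"
    and integrable: "integrable (measure_pmf p) real_of_int"
    and mean_zero: "measure_pmf.expectation p real_of_int = 0"
    and charfun: "\<And>t::real. measure_pmf.expectation p (\<lambda>k. cis (t * real_of_int k)) = 1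
                      \<longleftrightarrow> (\<exists>m::int. t = 2 * pi * real_of_int m)"
    and c_pos: "c_minus > 0" "c_plus > 0"
    and h: "slowly_varying h"
    and left_tail: "((\<lambda>x. measure_pmf.prob p {k. real_of_int k < - x} / (x powr (- \<beta>) * h x))
                      \<longlongrightarrow> c_minus) at_top"
    and right_tail: "((\<lambda>x. measure_pmf.prob p {k. real_of_int k > x} / (x powr (- \<beta>) * h x))
                      \<longlongrightarrow> c_plus) at_top"
    and nu_prob: "prob_space \<nu>" and nu_sets: "sets \<nu> = sets borel"
    and nu_pos: "AE x in \<nu>. x > 0"
    and \<kappa>: "\<kappa> > 0"
    and s: "slowly_varying s"
    and tau_tail: "((\<lambda>x. measure \<nu> {x<..} / (x powr (- \<alpha>) * s x)) \<longlongrightarrow> \<kappa>) at_top"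
    and alpha: "0 < \<alpha>" "\<alpha> < 1"
  shows "AE \<tau> in env_law \<nu>.
           \<not> ((\<lambda>t. SUP i::int. quenched_prob p \<tau> t i) \<longlongrightarrow> 0) at_top"
proof -
  interpret trap_environment \<nu>
    by (intro trap_environment.intro nu_prob nu_sets nu_pos)

  have b1: "2 powr (- \<beta>) < (1/2::real)"
    using powr_less_mono[of "-\<beta>" "-1" 2] beta by (simp add: powr_minus_divide)
  \<comment> \<open>\<open>q\<close> has to lie above \<open>4 * 2 powr (- \<beta>)\<close> for the
    jump tails and above 1 for the variance scale, yet below 2; \<beta> > 1 leaves room.\<close>
  obtain q where q: "max (1 / 4) (2 powr (- \<beta>)) < q / 4" "q / 4 < 1 / 2"
  proof -
    have "max (1 / 4) (2 powr (- \<beta>)) < (1 / 2 :: real)" using b1 by simp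
    from dense[OF this] obtain z :: real where "max (1 / 4) (2 powr (- \<beta>)) < z" "z < 1 / 2" by blast
    then show ?thesis using that[of "4 * z"] by simp
  qed
  have H_eq: "measure_pmf.prob p {k. 2 ^ j < \<bar>real_of_int k\<bar>} = big_jump_prob p j" for j
  proof -
    have "2 ^ j < \<bar>real_of_int k\<bar> \<longleftrightarrow> 2 ^ j < \<bar>k\<bar>" for k
    proof -
      have "2 ^ j < \<bar>real_of_int k\<bar> \<longleftrightarrow> real_of_int (2 ^ j) < real_of_int \<bar>k\<bar>" by simp
      then show ?thesis by (simp only: of_int_less_iff)
    qed
    then show ?thesis by (simp add: big_jump_prob_def)
  qed
  have "\<exists>m. \<forall>k\<ge>m. 0 < measure_pmf.prob p {j. 2 ^ k < \<bar>real_of_int j\<bar>} \<and>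
      0 * measure_pmf.prob p {j. 2 ^ k < \<bar>real_of_int j\<bar>} \<le> measure_pmf.prob p {j. 2 ^ Suc k < \<bar>real_of_int j\<bar>} \<and>
      measure_pmf.prob p {j. 2 ^ Suc k < \<bar>real_of_int j\<bar>} \<le> q / 4 * measure_pmf.prob p {j. 2 ^ k < \<bar>real_of_int j\<bar>}"
    using c_pos q by (intro dyadic_doubling[OF h two_sided_tail[OF left_tail right_tail]]) auto
  then obtain m0 where m0: "\<And>k. m0 \<le> k \<Longrightarrow> 0 < big_jump_prob p k \<and> big_jump_prob p (Suc k) \<le> q / 4 * big_jump_prob p k"
    unfolding H_eq by blast
  have sc: "step_char p t = 1 \<longleftrightarrow> (\<exists>m::int. t = 2 * pi * real_of_int m)" for t
    using charfun by (simp add: step_char_def)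
  obtain c c' r m n g S where c: "0 < c" and c': "0 < c'" and glim: "filterlim g at_top sequentially"
    and green: "\<And>k j. m \<le> k \<Longrightarrow> green p (n k) j \<le> g k" and gpos: "\<And>k. m \<le> k \<Longrightarrow> 0 < g k"
    and S: "\<And>k. m \<le> k \<Longrightarrow> S k \<subseteq> {j. \<bar>j\<bar> < 2 ^ (k + r)}"
    and card: "\<And>k. m \<le> k \<Longrightarrow> c' * 2 ^ k \<le> real (card (S k))"
    and fav: "\<And>k i. m \<le> k \<Longrightarrow> i \<in> S k \<Longrightarrow> c * g k \<le> green p (n k) i"
    and exit: "\<And>k. m \<le> k \<Longrightarrow> measure (path_law p) {\<omega>. \<exists>l\<le>n k. walk \<omega> l \<notin> {j. \<bar>j\<bar> < 2 ^ (k + r)}} \<le> c\<^sup>2 / 128"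
  proof (rule favourite_sites[OF integrable mean_zero sc, of q m0])
    show "1 < q" "q < 2" using q by auto
    show "0 < big_jump_prob p k \<and> 4 * big_jump_prob p (Suc k) \<le> q * big_jump_prob p k" if "m0 \<le> k" for k
      using m0[OF that] by simp
  qed (rule that)

  \<comment> \<open>\<alpha> < 1 leaves room for \<open>\<rho>' > 1/2\<close> and \<alpha> > 0 for
    \<open>\<rho> < 1\<close>.\<close>
  have a1: "2 powr (- \<alpha>) < (1::real)" "1 / 2 < 2 powr (- \<alpha>)"
    using powr_less_mono[of "-\<alpha>" 0 2] powr_less_mono[of "-1" "-\<alpha>" 2] alpha by (auto simp: powr_minus_divide)
  obtain \<rho>' :: real where \<rho>': "1 / 2 < \<rho>'" "\<rho>' < 2 powr (- \<alpha>)" using dense[OF a1(2)] by blast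
  obtain \<rho> :: real where \<rho>: "2 powr (- \<alpha>) < \<rho>" "\<rho> < 1" using dense[OF a1(1)] by blast
  obtain j0 where j0: "\<And>j. j0 \<le> j \<Longrightarrow> 0 < nu.prob {2 ^ j<..} \<and> \<rho>' * nu.prob {2 ^ j<..} \<le> nu.prob {2 ^ Suc j<..}
       \<and> nu.prob {2 ^ Suc j<..} \<le> \<rho> * nu.prob {2 ^ j<..}"
    using dyadic_doubling[OF s tau_tail \<kappa> \<rho>'(2) \<rho>(1)] by blast
  have \<rho>pos: "0 < \<rho>" using \<rho>(1) by (rule less_trans[rotated]) simp
  obtain \<delta> where \<delta>: "0 < \<delta>"
    and dom: "AE \<tau> in env_law \<nu>. \<forall>k0. \<exists>k\<ge>k0. \<exists>i\<in>S k. \<delta> * (\<Sum>j | \<bar>j\<bar> < 2 ^ (k + r). \<tau> j) \<le> \<tau> i"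
  proof (rule dominating_traps_infinitely_often[OF \<rho>'(1) \<rho>(2) \<rho>pos, of j0 c' m S r])
    show "0 < nu.prob {2 ^ j<..} \<and> \<rho>' * nu.prob {2 ^ j<..} \<le> nu.prob {2 ^ Suc j<..}
       \<and> nu.prob {2 ^ Suc j<..} \<le> \<rho> * nu.prob {2 ^ j<..}" if "j0 \<le> j" for j using that by (rule j0)
    show "S k \<subseteq> {j. \<bar>j\<bar> < 2 ^ (k + r)}" if "m \<le> k" for k using that by (rule S)
    show "c' * 2 ^ k \<le> real (card (S k))" if "m \<le> k" for k using that by (rule card)
  qed (rule c', rule that)

  define \<epsilon> where "\<epsilon> = c\<^sup>2 / 128"
  have \<epsilon>: "0 < \<epsilon>" using c by (simp add: \<epsilon>_def)
  show ?thesis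
    using AE_env_pos dom
  proof eventually_elim
    case (elim \<tau>)
    then have \<tau>: "0 < \<tau> i" for i by simp
    show ?case
    proof (rule not_tendsto_zero_if_time_averages)
      show "0 < \<delta> * c * \<epsilon> / 2" using \<delta> c \<epsilon> by simp
      fix T :: real
      \<comment> \<open>The origin lies in every ball, so its trap alone gives
        \<open>?\<Sigma> \<ge> \<tau> 0\<close>; a large \<open>g k\<close> then forces
        \<open>t > \<bar>T\<bar>\<close>.\<close>
      have "eventually (\<lambda>k. \<bar>T\<bar> * \<epsilon> / \<tau> 0 + 1 \<le> g k) sequentially" using glim by (simp add: filterlim_at_top)
      then obtain k1 where k1: "\<And>k. k1 \<le> k \<Longrightarrow> \<bar>T\<bar> * \<epsilon> / \<tau> 0 + 1 \<le> g k" by (auto simp: eventually_sequentially)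
      obtain k i where k: "max k1 m \<le> k" and i: "i \<in> S k" "\<delta> * (\<Sum>j | \<bar>j\<bar> < 2 ^ (k + r). \<tau> j) \<le> \<tau> i"
        using elim(2) by blast
      let ?A = "{j::int. \<bar>j\<bar> < 2 ^ (k + r)}"
      let ?\<Sigma> = "\<Sum>j\<in>?A. \<tau> j"
      \<comment> \<open>With this \<open>t\<close> the bound \<open>g k * ?\<Sigma>\<close> on the
        mean clock inside the ball is exactly \<open>\<epsilon> * t\<close>. Since
        \<open>\<tau> i \<ge> \<delta> * ?\<Sigma>\<close>, time of at least
        \<open>\<delta> * c * \<epsilon> / 2 * t\<close> is spent at \<open>i\<close> in
        expectation.\<close>
      define t where "t = g k * ?\<Sigma> / \<epsilon>"
      have km: "m \<le> k" using k by simp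
      have "\<tau> 0 \<le> ?\<Sigma>" using card_int_ball(1)[of "k + r"] \<tau> by (intro member_le_sum) (auto simp: less_imp_le)
      then have "g k * \<tau> 0 \<le> g k * ?\<Sigma>" using gpos[OF km] by (intro mult_left_mono) auto
      moreover have "\<bar>T\<bar> * \<epsilon> / \<tau> 0 < g k" using k1[of k] k by simp
      then have "\<bar>T\<bar> * \<epsilon> < g k * \<tau> 0" using \<tau>[of 0] by (simp add: field_simps)
      ultimately have "\<bar>T\<bar> * \<epsilon> < g k * ?\<Sigma>" by linarith
      then have tT: "\<bar>T\<bar> < t" using \<epsilon> by (simp add: t_def field_simps)
      have tpos: "0 < t" using tT by linarith
      have mean: "g k * ?\<Sigma> = \<epsilon> * t" using \<epsilon> by (simp add: t_def)
      have "ennreal (\<tau> i * c * g k / 2) \<le> (\<integral>\<^sup>+s. indicator {0..<t} s * ennreal (quenched_prob p \<tau> s i) \<partial>lborel)"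
        using mean exit[OF km] unfolding \<epsilon>_def[symmetric]
        by (intro time_spent_lower_bound[where A="?A" and n="n k" and \<epsilon>=\<epsilon>] \<tau> card_int_ball tpos green[OF km] gpos[OF km] c fav[OF km i(1)])
          (auto simp: \<epsilon>_def)
      moreover have "\<delta> * c * \<epsilon> / 2 * t \<le> \<tau> i * c * g k / 2"
      proof -
        have "\<delta> * c * \<epsilon> / 2 * t = \<delta> * ?\<Sigma> * (c * g k / 2)" using mean by (simp add: algebra_simps)
        also have "\<dots> \<le> \<tau> i * (c * g k / 2)" using i(2) c gpos[OF km] by (intro mult_right_mono) auto
        finally show ?thesis by (simp add: algebra_simps)
      qed
      ultimately have "ennreal (\<delta> * c * \<epsilon> / 2 * t) \<le> (\<integral>\<^sup>+s. indicator {0..<t} s * ennreal (quenched_prob p \<tau> s i) \<partial>lborel)"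
        using ennreal_leI order_trans by blast
      then show "\<exists>t>T. \<exists>i. ennreal (\<delta> * c * \<epsilon> / 2 * t) \<le> (\<integral>\<^sup>+s. indicator {0..<t} s * ennreal (quenched_prob p \<tau> s i) \<partial>lborel)"
        using tT by (intro exI[of _ t]) auto
    qed
  qed
qed

end
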